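(* Let $G$ be a countable discrete ICC group. If $G$ has non-factorizable regular character, then every $G$-invariant subfactor $P$ of $L(G)$ is equal to $L(H)$ for some normal subgroup $H$ of $G$. If $G$ is further assumed to be non-amenable with trivial amenable radical, then $G$ has the ISR property.
   Context: A group is ICC if every non-trivial element has an infinite conjugacy class. A character on a countable discrete group $G$ is a function $\phi: G\to\mathbb{C}$ that is positive definite, conjugation-invariant ($\phi(hgh^{-1})=\phi(g)$ for all $g,h$) and normalized ($\phi(e)=1$). $\delta_e$ denotes the Dirac function at the identity $e$. The group $G$ has non-factorizable regular character if for any characters $\phi,\psi$ on $G$ such that $\phi(s)\psi(s)=0$ for all $s\in G\setminus\{e\}$, one has $\phi\equiv\delta_e$ or $\psi\equiv\delta_e$. $L(G)$ is the group von Neumann algebra of $G$, generated by the left translation unitaries $u_g$ on $\ell^2(G)$; for a subgroup $H\le G$, $L(H)$ is identified with the von Neumann subalgebra of $L(G)$ generated by $\{u_h:h\in H\}$. A von Neumann subalgebra $P\subseteq L(G)$ is $G$-invariant if $u_gPu_g^*=P$ for all $g\in G$; a $G$-invariant subfactor is a $G$-invariant von Neumann subalgebra with trivial center (containing the unit of $L(G)$). $G$ has the ISR property (invariant von Neumann subalgebras rigidity) if every $G$-invariant von Neumann subalgebra $P\subseteq L(G)$ equals $L(H)$ for some normal subgroup $H\lhd G$. The amenable radical is the largest amenable normal subgroup. *)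

theory Defs
  imports "HOL-Analysis.Analysis" "HOL-Algebra.Coset"
begin

definition icc_group :: "('a, 'b) monoid_scheme \<Rightarrow> bool" where
  "icc_group G \<longleftrightarrow>
     (\<forall>g\<in>carrier G. g \<noteq> \<one>\<^bsub>G\<^esub> \<longrightarrow>
        infinite {h \<otimes>\<^bsub>G\<^esub> g \<otimes>\<^bsub>G\<^esub> inv\<^bsub>G\<^esub> h | h. h \<in> carrier G})"

text \<open>
  A function on the group is a function on the whole type of which only the values on
  \<open>carrier G\<close> matter; equality of such functions is required on the carrier only.
  Membership in \<open>\<real>\<^sub>\<ge>\<^sub>0\<close> says that the complex number is real and nonnegative.
\<close>

definition positive_definite :: "('a, 'b) monoid_scheme \<Rightarrow> ('a \<Rightarrow> complex) \<Rightarrow> bool" where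
  "positive_definite G \<phi> \<longleftrightarrow>
     (\<forall>F c. finite F \<and> F \<subseteq> carrier G \<longrightarrow>
        (\<Sum>x\<in>F. \<Sum>y\<in>F. cnj (c x) * c y * \<phi> (inv\<^bsub>G\<^esub> x \<otimes>\<^bsub>G\<^esub> y)) \<in> \<real>\<^sub>\<ge>\<^sub>0)"

definition group_character :: "('a, 'b) monoid_scheme \<Rightarrow> ('a \<Rightarrow> complex) \<Rightarrow> bool" where
  "group_character G \<phi> \<longleftrightarrow>
     positive_definite G \<phi> \<and>
     (\<forall>g\<in>carrier G. \<forall>h\<in>carrier G. \<phi> (h \<otimes>\<^bsub>G\<^esub> g \<otimes>\<^bsub>G\<^esub> inv\<^bsub>G\<^esub> h) = \<phi> g) \<and>
     \<phi> \<one>\<^bsub>G\<^esub> = 1"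

definition is_dirac_at_one :: "('a, 'b) monoid_scheme \<Rightarrow> ('a \<Rightarrow> complex) \<Rightarrow> bool" where
  "is_dirac_at_one G \<phi> \<longleftrightarrow> (\<forall>g\<in>carrier G. \<phi> g = (if g = \<one>\<^bsub>G\<^esub> then 1 else 0))"

definition nonfactorizable_regular_character :: "('a, 'b) monoid_scheme \<Rightarrow> bool" where
  "nonfactorizable_regular_character G \<longleftrightarrow>
     (\<forall>\<phi> \<psi>. group_character G \<phi> \<and> group_character G \<psi> \<and>
        (\<forall>s\<in>carrier G - {\<one>\<^bsub>G\<^esub>}. \<phi> s * \<psi> s = 0) \<longrightarrow>
        is_dirac_at_one G \<phi> \<or> is_dirac_at_one G \<psi>)"

text \<open>
  Amenability of a discrete group: existence of a left-invariant mean on the bounded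
  real-valued functions. Positivity together with linearity forces the mean to depend
  only on the restriction of a function to the carrier.
\<close>

definition bounded_funs :: "('a, 'b) monoid_scheme \<Rightarrow> ('a \<Rightarrow> real) set" where
  "bounded_funs G = {f. bounded (f ` carrier G)}"

definition left_invariant_mean :: "('a, 'b) monoid_scheme \<Rightarrow> (('a \<Rightarrow> real) \<Rightarrow> real) \<Rightarrow> bool" where
  "left_invariant_mean G m \<longleftrightarrow>
     (\<forall>f\<in>bounded_funs G. \<forall>g\<in>bounded_funs G. m (\<lambda>x. f x + g x) = m f + m g) \<and>
     (\<forall>f\<in>bounded_funs G. \<forall>c. m (\<lambda>x. c * f x) = c * m f) \<and>
     (\<forall>f\<in>bounded_funs G. (\<forall>x\<in>carrier G. 0 \<le> f x) \<longrightarrow> 0 \<le> m f) \<and>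
     m (\<lambda>_. 1) = 1 \<and>
     (\<forall>f\<in>bounded_funs G. \<forall>s\<in>carrier G. m (\<lambda>x. f (s \<otimes>\<^bsub>G\<^esub> x)) = m f)"

definition amenable_group :: "('a, 'b) monoid_scheme \<Rightarrow> bool" where
  "amenable_group G \<longleftrightarrow> (\<exists>m. left_invariant_mean G m)"

definition is_amenable_radical :: "('a, 'b) monoid_scheme \<Rightarrow> 'a set \<Rightarrow> bool" where
  "is_amenable_radical G N \<longleftrightarrow>
     N \<lhd> G \<and> amenable_group (G\<lparr>carrier := N\<rparr>) \<and>
     (\<forall>M. M \<lhd> G \<and> amenable_group (G\<lparr>carrier := M\<rparr>) \<longrightarrow> M \<subseteq> N)"

text \<open>
  Vectors are functions that vanish outside the carrier, and operators are functions that
  send everything outside the Hilbert space to zero, so that equality of vectors and of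
  operators is equality in HOL and operators are closed under pointwise sums and composition.
\<close>

type_synonym 'a vec_fun = "'a \<Rightarrow> complex"
type_synonym 'a operator = "'a vec_fun \<Rightarrow> 'a vec_fun"

definition ell2 :: "('a, 'b) monoid_scheme \<Rightarrow> 'a vec_fun set" where
  "ell2 G = {f. (\<forall>x. x \<notin> carrier G \<longrightarrow> f x = 0) \<and>
                (\<lambda>x. (cmod (f x))\<^sup>2) summable_on carrier G}"

definition ell2_inner :: "('a, 'b) monoid_scheme \<Rightarrow> 'a vec_fun \<Rightarrow> 'a vec_fun \<Rightarrow> complex" where
  "ell2_inner G f g = (\<Sum>\<^sub>\<infinity>x\<in>carrier G. cnj (f x) * g x)"

definition ell2_norm :: "('a, 'b) monoid_scheme \<Rightarrow> 'a vec_fun \<Rightarrow> real" where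
  "ell2_norm G f = sqrt (\<Sum>\<^sub>\<infinity>x\<in>carrier G. (cmod (f x))\<^sup>2)"

definition bounded_ops :: "('a, 'b) monoid_scheme \<Rightarrow> 'a operator set" where
  "bounded_ops G = {T.
     (\<forall>f\<in>ell2 G. T f \<in> ell2 G) \<and>
     (\<forall>f. f \<notin> ell2 G \<longrightarrow> T f = (\<lambda>_. 0)) \<and>
     (\<forall>f\<in>ell2 G. \<forall>g\<in>ell2 G. T (\<lambda>x. f x + g x) = (\<lambda>x. T f x + T g x)) \<and>
     (\<forall>f\<in>ell2 G. \<forall>c. T (\<lambda>x. c * f x) = (\<lambda>x. c * T f x)) \<and>
     (\<exists>C. \<forall>f\<in>ell2 G. ell2_norm G (T f) \<le> C * ell2_norm G f)}"

definition op_adjoint :: "('a, 'b) monoid_scheme \<Rightarrow> 'a operator \<Rightarrow> 'a operator" where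
  "op_adjoint G T = (THE S. S \<in> bounded_ops G \<and>
     (\<forall>f\<in>ell2 G. \<forall>g\<in>ell2 G. ell2_inner G (S f) g = ell2_inner G f (T g)))"

definition scalar_op :: "('a, 'b) monoid_scheme \<Rightarrow> complex \<Rightarrow> 'a operator" where
  "scalar_op G c = (\<lambda>f. if f \<in> ell2 G then (\<lambda>x. c * f x) else (\<lambda>_. 0))"

definition commutant :: "('a, 'b) monoid_scheme \<Rightarrow> 'a operator set \<Rightarrow> 'a operator set" where
  "commutant G M = {T \<in> bounded_ops G. \<forall>S\<in>M. T \<circ> S = S \<circ> T}"

text \<open>
  Dixmier's definition: a self-adjoint set of bounded operators that equals its bicommutant.
  Such a set is automatically a subalgebra containing the identity operator.
\<close>

definition von_neumann_algebra :: "('a, 'b) monoid_scheme \<Rightarrow> 'a operator set \<Rightarrow> bool" where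
  "von_neumann_algebra G M \<longleftrightarrow>
     M \<subseteq> bounded_ops G \<and> (\<forall>T\<in>M. op_adjoint G T \<in> M) \<and> commutant G (commutant G M) = M"

definition vna_generated :: "('a, 'b) monoid_scheme \<Rightarrow> 'a operator set \<Rightarrow> 'a operator set" where
  "vna_generated G S = \<Inter>{M. von_neumann_algebra G M \<and> S \<subseteq> M}"

definition vna_center :: "('a, 'b) monoid_scheme \<Rightarrow> 'a operator set \<Rightarrow> 'a operator set" where
  "vna_center G M = M \<inter> commutant G M"

definition is_factor :: "('a, 'b) monoid_scheme \<Rightarrow> 'a operator set \<Rightarrow> bool" where
  "is_factor G M \<longleftrightarrow> von_neumann_algebra G M \<and> vna_center G M = range (scalar_op G)"

definition left_translation :: "('a, 'b) monoid_scheme \<Rightarrow> 'a \<Rightarrow> 'a operator" where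
  "left_translation G g = (\<lambda>f. if f \<in> ell2 G
     then (\<lambda>x. if x \<in> carrier G then f (inv\<^bsub>G\<^esub> g \<otimes>\<^bsub>G\<^esub> x) else 0) else (\<lambda>_. 0))"

text \<open>
  For a subgroup \<open>H\<close>, \<open>group_vna G H\<close> is \<open>L(H)\<close> realised on the square-summable functions
  on \<open>G\<close>; in particular \<open>group_vna G (carrier G)\<close> is \<open>L(G)\<close>.
\<close>

definition group_vna :: "('a, 'b) monoid_scheme \<Rightarrow> 'a set \<Rightarrow> 'a operator set" where
  "group_vna G H = vna_generated G (left_translation G ` H)"

definition invariant_subalgebra :: "('a, 'b) monoid_scheme \<Rightarrow> 'a operator set \<Rightarrow> bool" where
  "invariant_subalgebra G P \<longleftrightarrow>
     von_neumann_algebra G P \<and> P \<subseteq> group_vna G (carrier G) \<and>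
     (\<forall>g\<in>carrier G.
        (\<lambda>T. left_translation G g \<circ> T \<circ> op_adjoint G (left_translation G g)) ` P = P)"

definition invariant_subfactor :: "('a, 'b) monoid_scheme \<Rightarrow> 'a operator set \<Rightarrow> bool" where
  "invariant_subfactor G P \<longleftrightarrow> invariant_subalgebra G P \<and> is_factor G P"

definition ISR_property :: "('a, 'b) monoid_scheme \<Rightarrow> bool" where
  "ISR_property G \<longleftrightarrow>
     (\<forall>P. invariant_subalgebra G P \<longrightarrow> (\<exists>H. H \<lhd> G \<and> P = group_vna G H))"

end

theory Submission
  imports Defs
begin

text \<open>
  Let \<open>P\<close> be an invariant subfactor and \<open>E(g)\<close> the conditional expectation of the unitary \<open>u\<^sub>g\<close> onto \<open>P\<close>.
  It satisfies \<open>E(g) x = (u\<^sub>g x u\<^sub>g\<^sup>*) E(g)\<close> for \<open>x \<in> P\<close>, hence it is a multiple of a unitary. If conjugation by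
  \<open>g\<close> is inner on \<open>P\<close>, then \<open>u\<^sub>g = v\<^sub>g w\<^sub>g\<close> with unitaries \<open>v\<^sub>g\<close> in \<open>P\<close> and \<open>w\<^sub>g\<close> in its relative commutant,
  which are unique up to a phase. Therefore \<open>\<phi>(g) = |\<tau>(w\<^sub>g)|\<^sup>2\<close> and \<open>\<psi>(g) = |\<tau>(v\<^sub>g)|\<^sup>2\<close>, extended by 0,
  are characters, being Schur squares of Gram kernels, and \<open>\<phi>(g) \<psi>(g) = |\<tau>(u\<^sub>g)|\<^sup>2 = 0\<close> for \<open>g \<noteq> 1\<close>. If
  \<open>\<phi>\<close> is the Dirac function then \<open>P\<close> is trivial; if \<open>\<psi>\<close> is, then every \<open>v\<^sub>g\<close> is a multiple of \<open>u\<^sub>g\<close>.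

  For the second claim the center \<open>A\<close> of an invariant subalgebra is shown to be trivial. Let \<open>K\<close> be a
  minimal left ideal of the compact convolution semigroup of means on \<open>G\<close>. The elements of \<open>G\<close> fixing \<open>K\<close>
  pointwise form an amenable normal subgroup, so they are trivial. The unitaries of \<open>A\<close> commute, so by
  averaging there are states on all bounded operators that extend the trace and are central
  for \<open>A\<close>. Composed with the Poisson transform of a point of \<open>K\<close> they cover \<open>K\<close>, by minimality. A state that is
  extremal for this has the functions of the Poisson transform in its multiplicative domain, and comparing the
  two sides of centrality for a unitary \<open>u\<close> of \<open>A\<close> shows that the coefficient of \<open>u\<close> at \<open>h\<close> vanishes
  unless \<open>h\<close> fixes \<open>K\<close>.
\<close>

section \<open>The Hilbert space of square-summable functions\<close>

text \<open>The relation satisfied by E(g) puts \<open>adj p \<circ> p\<close> into the center of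
  \<open>P\<close>, and a trivial center turns it into a scalar. The second claim therefore reduces
  to the center, where two obstacles shape the argument. A state on all bounded operators is only
  norm continuous, while the Fourier series of a unitary is only known to converge in the 2-norm.
  Requiring the states to extend the trace repairs this: by Cauchy-Schwarz an error \<open>r\<close>
  in \<R> contributes at most a multiple of its 2-norm. Moreover no extreme point is constructed.
  Only finitely many translates of one Poisson transform enter the truncated series, so it suffices
  to maximize a linear term plus a finite sum of squares over the compact set of central states. The
  squares force zero variance on these translates; the linear term, with a large weight, keeps a
  translation by h visible at the maximizer. Two devices replace functional calculus: the
  expectation is a nearest point in an operator-norm ball, and facts about unitaries spread to a
  whole algebra through Cayley transforms, linear combinations and inverses.\<close>

context group
begin

abbreviation "\<H> \<equiv> ell2 G"
abbreviation "\<B> \<equiv> bounded_ops G"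
abbreviation "ip \<equiv> ell2_inner G"
abbreviation "nrm \<equiv> ell2_norm G"

lemma nrm_nonneg [simp]: "0 \<le> nrm f"
  by (simp add: ell2_norm_def infsum_nonneg)

lemma nrm_power2: "(nrm f)\<^sup>2 = (\<Sum>\<^sub>\<infinity>x\<in>carrier G. (cmod (f x))\<^sup>2)"
  by (simp add: ell2_norm_def infsum_nonneg)

lemma ell2_outside: "f \<in> \<H> \<Longrightarrow> x \<notin> carrier G \<Longrightarrow> f x = 0"
  by (simp add: ell2_def)

lemma ell2I:
  assumes "\<And>x. x \<notin> carrier G \<Longrightarrow> f x = 0"
    and b: "\<And>F. finite F \<Longrightarrow> F \<subseteq> carrier G \<Longrightarrow> (\<Sum>x\<in>F. (cmod (f x))\<^sup>2) \<le> C\<^sup>2"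
    and "0 \<le> C"
  shows "f \<in> \<H>" and "nrm f \<le> C"
proof -
  have s: "(\<lambda>x. (cmod (f x))\<^sup>2) summable_on carrier G"
    by (rule nonneg_bdd_above_summable_on) (auto intro!: bdd_aboveI2 b)
  then show "f \<in> \<H>"
    using assms(1) by (simp add: ell2_def)
  have "(nrm f)\<^sup>2 \<le> C\<^sup>2"
    unfolding nrm_power2 using s b by (rule infsum_le_finite_sums)
  then show "nrm f \<le> C"
    using \<open>0 \<le> C\<close> by (rule power2_le_imp_le)
qed

lemma sum_le_nrm2:
  assumes "f \<in> \<H>" "finite F" "F \<subseteq> carrier G"
  shows "(\<Sum>x\<in>F. (cmod (f x))\<^sup>2) \<le> (nrm f)\<^sup>2"
  unfolding nrm_power2 using assms by (intro finite_sum_le_infsum) (auto simp: ell2_def)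

lemma cmod_le_nrm:
  assumes "f \<in> \<H>" shows "cmod (f x) \<le> nrm f"
proof (cases "x \<in> carrier G")
  case True
  then have "(cmod (f x))\<^sup>2 \<le> (nrm f)\<^sup>2"
    using sum_le_nrm2[OF assms, of "{x}"] by simp
  then show ?thesis by (rule power2_le_imp_le) simp
next
  case False
  then show ?thesis using assms by (simp add: ell2_outside)
qed

lemma zero_ell2 [simp]: "(\<lambda>_. 0) \<in> \<H>"
  by (simp add: ell2_def)

lemma nrm_zero [simp]: "nrm (\<lambda>_. 0) = 0"
  by (simp add: ell2_norm_def)

lemma nrm_eq_0_iff: "f \<in> \<H> \<Longrightarrow> nrm f = 0 \<longleftrightarrow> f = (\<lambda>_. 0)"
  using cmod_le_nrm by fastforce

lemma scale_ell2 [simp]: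
  assumes "f \<in> \<H>" shows "(\<lambda>x. c * f x) \<in> \<H>"
  using assms by (auto simp: ell2_def norm_mult power_mult_distrib intro!: summable_on_cmult_right)

lemma nrm_scale: "nrm (\<lambda>x. c * f x) = cmod c * nrm f"
  by (simp add: ell2_norm_def norm_mult power_mult_distrib infsum_cmult_right' real_sqrt_mult)

lemma add_ell2 [simp]:
  assumes "f \<in> \<H>" "g \<in> \<H>" shows "(\<lambda>x. f x + g x) \<in> \<H>"
proof -
  have "norm ((cmod (f x + g x))\<^sup>2) \<le> 2 * (cmod (f x))\<^sup>2 + 2 * (cmod (g x))\<^sup>2" for x
  proof -
    have "(cmod (f x + g x))\<^sup>2 \<le> (cmod (f x) + cmod (g x))\<^sup>2"
      by (intro power_mono norm_triangle_ineq) simp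
    also have "\<dots> \<le> 2 * (cmod (f x))\<^sup>2 + 2 * (cmod (g x))\<^sup>2"
      using sum_squares_bound[of "cmod (f x)" "cmod (g x)"] by (simp add: power2_sum)
    finally show ?thesis by simp
  qed
  moreover have "(\<lambda>x. 2 * (cmod (f x))\<^sup>2 + 2 * (cmod (g x))\<^sup>2) summable_on carrier G"
    using assms by (auto simp: ell2_def intro!: summable_on_add summable_on_cmult_right)
  ultimately have "(\<lambda>x. (cmod (f x + g x))\<^sup>2) summable_on carrier G"
    by (intro summable_on_comparison_test[where f="\<lambda>x. 2 * (cmod (f x))\<^sup>2 + 2 * (cmod (g x))\<^sup>2" and g="\<lambda>x. (cmod (f x + g x))\<^sup>2"]) auto
  then show ?thesis using assms by (auto simp: ell2_def)
qed

lemma diff_ell2 [simp]: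
  assumes "f \<in> \<H>" "g \<in> \<H>" shows "(\<lambda>x. f x - g x) \<in> \<H>"
  using add_ell2[OF assms(1) scale_ell2[OF assms(2), of "-1"]] by simp

lemma sum_cmod_mult_le:
  assumes "f \<in> \<H>" "g \<in> \<H>" "finite F" "F \<subseteq> carrier G"
  shows "(\<Sum>x\<in>F. cmod (f x) * cmod (g x)) \<le> nrm f * nrm g"
proof -
  have l: "L2_set (\<lambda>x. cmod (h x)) F \<le> nrm h" if "h \<in> \<H>" for h
    unfolding L2_set_def using sum_le_nrm2[OF that assms(3,4)] by (simp add: real_le_lsqrt)
  have "(\<Sum>x\<in>F. cmod (f x) * cmod (g x)) \<le> L2_set (\<lambda>x. cmod (f x)) F * L2_set (\<lambda>x. cmod (g x)) F"
    using L2_set_mult_ineq[of "\<lambda>x. cmod (f x)" "\<lambda>x. cmod (g x)" F] by simp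
  also have "\<dots> \<le> nrm f * nrm g"
    using l assms by (intro mult_mono) auto
  finally show ?thesis .
qed

lemma ip_abs_summable:
  assumes "f \<in> \<H>" "g \<in> \<H>"
  shows "(\<lambda>x. cmod (cnj (f x) * g x)) summable_on carrier G"
  by (rule nonneg_bdd_above_summable_on)
     (auto simp: norm_mult intro!: bdd_aboveI2 sum_cmod_mult_le[OF assms])

lemma ip_summable:
  assumes "f \<in> \<H>" "g \<in> \<H>"
  shows "(\<lambda>x. cnj (f x) * g x) summable_on carrier G"
  using ip_abs_summable[OF assms] by (rule abs_summable_summable)

lemma cauchy_schwarz:
  assumes "f \<in> \<H>" "g \<in> \<H>"
  shows "cmod (ip f g) \<le> nrm f * nrm g"
proof -
  have "cmod (ip f g) \<le> (\<Sum>\<^sub>\<infinity>x\<in>carrier G. cmod (cnj (f x) * g x))"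
    unfolding ell2_inner_def by (rule norm_infsum_bound[OF ip_abs_summable[OF assms]])
  also have "\<dots> \<le> nrm f * nrm g"
    using ip_abs_summable[OF assms]
    by (rule infsum_le_finite_sums) (simp add: norm_mult sum_cmod_mult_le[OF assms])
  finally show ?thesis .
qed

lemma ip_commute: "cnj (ip f g) = ip g f"
  by (simp add: ell2_inner_def mult.commute flip: infsum_cnj)

lemma ip_scale_right: "ip f (\<lambda>x. c * g x) = c * ip f g"
  by (simp add: ell2_inner_def mult.left_commute infsum_cmult_right')

lemma ip_scale_left: "ip (\<lambda>x. c * f x) g = cnj c * ip f g"
  by (simp add: ell2_inner_def mult.assoc infsum_cmult_right')

lemma ip_add_right:
  assumes "f \<in> \<H>" "g \<in> \<H>" "h \<in> \<H>"
  shows "ip f (\<lambda>x. g x + h x) = ip f g + ip f h"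
  using assms by (simp add: ell2_inner_def distrib_left infsum_add ip_summable)

lemma ip_diff_right:
  assumes "f \<in> \<H>" "g \<in> \<H>" "h \<in> \<H>"
  shows "ip f (\<lambda>x. g x - h x) = ip f g - ip f h"
  using ip_add_right[OF assms(1,2) scale_ell2[OF assms(3), of "-1"]] ip_scale_right[of f "-1" h] by simp

lemma ip_add_left:
  assumes "f \<in> \<H>" "g \<in> \<H>" "h \<in> \<H>"
  shows "ip (\<lambda>x. g x + h x) f = ip g f + ip h f"
  using ip_add_right[OF assms] by (metis complex_cnj_add ip_commute)

lemma ip_diff_left:
  assumes "f \<in> \<H>" "g \<in> \<H>" "h \<in> \<H>"
  shows "ip (\<lambda>x. g x - h x) f = ip g f - ip h f"
  using ip_diff_right[OF assms] by (metis complex_cnj_diff ip_commute)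

lemma ip_zero_left [simp]: "ip (\<lambda>_. 0) f = 0"
  by (simp add: ell2_inner_def)

lemma ip_zero_right [simp]: "ip f (\<lambda>_. 0) = 0"
  by (simp add: ell2_inner_def)

lemma ip_self:
  assumes "f \<in> \<H>" shows "ip f f = of_real ((nrm f)\<^sup>2)"
proof -
  have "ip f f = (\<Sum>\<^sub>\<infinity>x\<in>carrier G. complex_of_real ((cmod (f x))\<^sup>2))"
    unfolding ell2_inner_def by (rule infsum_cong) (simp only: complex_norm_square mult.commute)
  also have "\<dots> = of_real ((nrm f)\<^sup>2)"
    unfolding nrm_power2
    using assms by (intro infsumI) (simp add: has_sum_of_real_iff ell2_def del: of_real_power)
  finally show ?thesis .
qed

lemma nrm_add_power2:
  assumes "f \<in> \<H>" "g \<in> \<H>"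
  shows "(nrm (\<lambda>x. f x + g x))\<^sup>2 = (nrm f)\<^sup>2 + 2 * Re (ip f g) + (nrm g)\<^sup>2"
proof -
  have "complex_of_real ((nrm (\<lambda>x. f x + g x))\<^sup>2) = ip f f + ip f g + (ip g f + ip g g)"
    using assms by (simp only: ip_self[symmetric] ip_add_left ip_add_right add_ell2)
  also have "Re \<dots> = (nrm f)\<^sup>2 + 2 * Re (ip f g) + (nrm g)\<^sup>2"
    using assms by (simp add: ip_self ip_commute[of f g, symmetric])
  finally show ?thesis by simp
qed

lemma nrm_diff_power2:
  assumes "f \<in> \<H>" "g \<in> \<H>"
  shows "(nrm (\<lambda>x. f x - g x))\<^sup>2 = (nrm f)\<^sup>2 - 2 * Re (ip f g) + (nrm g)\<^sup>2"
  using nrm_add_power2[OF assms(1) scale_ell2[OF assms(2), of "-1"]]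
    nrm_scale[of "-1" g] ip_scale_right[of f "-1" g] by simp

lemma nrm_triangle:
  assumes "f \<in> \<H>" "g \<in> \<H>"
  shows "nrm (\<lambda>x. f x + g x) \<le> nrm f + nrm g"
proof (rule power2_le_imp_le)
  have "Re (ip f g) \<le> nrm f * nrm g"
    using cauchy_schwarz[OF assms] complex_Re_le_cmod order_trans by blast
  then show "(nrm (\<lambda>x. f x + g x))\<^sup>2 \<le> (nrm f + nrm g)\<^sup>2"
    using nrm_add_power2[OF assms] by (simp add: power2_sum)
qed simp

lemma nrm_minus_commute: "nrm (\<lambda>x. f x - g x) = nrm (\<lambda>x. g x - f x)"
  by (simp add: ell2_norm_def norm_minus_commute)

lemma nrm_triangle_diff:
  assumes "f \<in> \<H>" "g \<in> \<H>" "h \<in> \<H>"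
  shows "nrm (\<lambda>x. f x - h x) \<le> nrm (\<lambda>x. f x - g x) + nrm (\<lambda>x. g x - h x)"
  using nrm_triangle[of "\<lambda>x. f x - g x" "\<lambda>x. g x - h x"] assms by simp

lemma parallelogram:
  assumes "f \<in> \<H>" "g \<in> \<H>"
  shows "(nrm (\<lambda>x. f x - g x))\<^sup>2 + (nrm (\<lambda>x. f x + g x))\<^sup>2 = 2 * (nrm f)\<^sup>2 + 2 * (nrm g)\<^sup>2"
  using nrm_add_power2[OF assms] nrm_diff_power2[OF assms] by simp

section \<open>Norm convergence and completeness\<close>

definition Cauchy2 :: "(nat \<Rightarrow> 'a \<Rightarrow> complex) \<Rightarrow> bool" where
  "Cauchy2 s \<longleftrightarrow> (\<forall>n. s n \<in> \<H>) \<and>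
     (\<forall>e>0. \<exists>N. \<forall>m\<ge>N. \<forall>n\<ge>N. nrm (\<lambda>x. s m x - s n x) < e)"

definition converges2 :: "(nat \<Rightarrow> 'a \<Rightarrow> complex) \<Rightarrow> ('a \<Rightarrow> complex) \<Rightarrow> bool" where
  "converges2 s f \<longleftrightarrow> (\<forall>n. s n \<in> \<H>) \<and> f \<in> \<H> \<and> (\<lambda>n. nrm (\<lambda>x. s n x - f x)) \<longlonglongrightarrow> 0"

text \<open>The limit is built coordinatewise. A bound on finite partial sums survives the
  coordinatewise limit, and \<open>ell2I\<close> turns it into membership and a norm
  estimate.\<close>

lemma Cauchy2_converges2:
  assumes "Cauchy2 s"
  obtains f where "converges2 s f"
proof -
  have s: "s n \<in> \<H>" for n using assms by (simp add: Cauchy2_def)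
  have C: "\<exists>N. \<forall>m\<ge>N. \<forall>n\<ge>N. nrm (\<lambda>x. s m x - s n x) < e" if "e > 0" for e
    using assms that by (simp add: Cauchy2_def)
  have "Cauchy (\<lambda>n. s n x)" for x
  proof (rule metric_CauchyI)
    fix e :: real assume "e > 0"
    with C obtain N where N: "\<forall>m\<ge>N. \<forall>n\<ge>N. nrm (\<lambda>x. s m x - s n x) < e" by blast
    have "dist (s m x) (s n x) < e" if "m \<ge> N" "n \<ge> N" for m n
      using cmod_le_nrm[OF diff_ell2[OF s[of m] s[of n]], of x] N that by (force simp: dist_norm)
    then show "\<exists>N. \<forall>m\<ge>N. \<forall>n\<ge>N. dist (s m x) (s n x) < e" by blast
  qed
  then have "\<forall>x. \<exists>l. (\<lambda>n. s n x) \<longlonglongrightarrow> l"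
    by (simp add: Cauchy_convergent_iff convergent_def)
  then obtain f where f: "\<And>x. (\<lambda>n. s n x) \<longlonglongrightarrow> f x" by metis
  have out: "f x = 0" if "x \<notin> carrier G" for x
    using f[of x] that s by (simp add: ell2_outside LIMSEQ_const_iff)
  have close: "\<exists>N. \<forall>n\<ge>N. (\<lambda>x. s n x - f x) \<in> \<H> \<and> nrm (\<lambda>x. s n x - f x) \<le> e" if "e > 0" for e
  proof -
    obtain N where N: "\<forall>m\<ge>N. \<forall>n\<ge>N. nrm (\<lambda>x. s m x - s n x) < e" using C \<open>e > 0\<close> by blast
    have "(\<lambda>x. s n x - f x) \<in> \<H> \<and> nrm (\<lambda>x. s n x - f x) \<le> e" if "n \<ge> N" for n
    proof -
      have fin: "(\<Sum>x\<in>F. (cmod (s n x - f x))\<^sup>2) \<le> e\<^sup>2" if F: "finite F" "F \<subseteq> carrier G" for F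
      proof (rule LIMSEQ_le_const2)
        show "(\<lambda>m. \<Sum>x\<in>F. (cmod (s n x - s m x))\<^sup>2) \<longlonglongrightarrow> (\<Sum>x\<in>F. (cmod (s n x - f x))\<^sup>2)"
          by (intro tendsto_intros f)
        have "(\<Sum>x\<in>F. (cmod (s n x - s m x))\<^sup>2) \<le> e\<^sup>2" if "m \<ge> N" for m
        proof -
          have "(\<Sum>x\<in>F. (cmod (s n x - s m x))\<^sup>2) \<le> (nrm (\<lambda>x. s n x - s m x))\<^sup>2"
            by (rule sum_le_nrm2[OF diff_ell2[OF s s] F])
          also have "\<dots> \<le> e\<^sup>2"
            using N \<open>n \<ge> N\<close> that by (intro power_mono) (auto intro: less_imp_le)
          finally show ?thesis .
        qed
        then show "\<exists>N. \<forall>m\<ge>N. (\<Sum>x\<in>F. (cmod (s n x - s m x))\<^sup>2) \<le> e\<^sup>2" by blast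
      qed
      have "s n x - f x = 0" if "x \<notin> carrier G" for x
        using that out ell2_outside[OF s] by simp
      then show ?thesis using ell2I[of "\<lambda>x. s n x - f x" e] fin \<open>e > 0\<close> by auto
    qed
    then show ?thesis by blast
  qed
  obtain n where "(\<lambda>x. s n x - f x) \<in> \<H>" using close[of 1] by auto
  then have fH: "f \<in> \<H>" using diff_ell2[OF s[of n]] by fastforce
  have "(\<lambda>n. nrm (\<lambda>x. s n x - f x)) \<longlonglongrightarrow> 0"
  proof (rule LIMSEQ_I)
    fix r :: real assume "r > 0"
    then obtain N where "\<forall>n\<ge>N. nrm (\<lambda>x. s n x - f x) \<le> r / 2" using close[of "r/2"] by auto
    then have "\<forall>n\<ge>N. norm (nrm (\<lambda>x. s n x - f x) - 0) < r" using \<open>r > 0\<close> by fastforce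
    then show "\<exists>N. \<forall>n\<ge>N. norm (nrm (\<lambda>x. s n x - f x) - 0) < r" by blast
  qed
  then show ?thesis using that s fH by (simp add: converges2_def)
qed

lemma converges2_Cauchy2:
  assumes "converges2 s f" shows "Cauchy2 s"
  unfolding Cauchy2_def
proof (intro conjI allI impI)
  have s: "s n \<in> \<H>" "f \<in> \<H>" for n using assms by (auto simp: converges2_def)
  then show "s n \<in> \<H>" for n by simp
  fix e :: real assume "e > 0"
  then have "eventually (\<lambda>n. nrm (\<lambda>x. s n x - f x) < e / 2) sequentially"
    using assms order_tendstoD(2)[of _ 0 sequentially "e/2"] by (simp add: converges2_def)
  then obtain N where N: "\<And>n. n \<ge> N \<Longrightarrow> nrm (\<lambda>x. s n x - f x) < e / 2"
    by (auto simp: eventually_sequentially)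
  have "nrm (\<lambda>x. s m x - s n x) < e" if "m \<ge> N" "n \<ge> N" for m n
    using nrm_triangle_diff[OF s(1)[of m] s(2) s(1)[of n]] N[OF that(1)] N[OF that(2)]
      nrm_minus_commute[of f "s n"] by simp
  then show "\<exists>N. \<forall>m\<ge>N. \<forall>n\<ge>N. nrm (\<lambda>x. s m x - s n x) < e" by blast
qed

lemma converges2_nrm_diff:
  assumes "converges2 s f" "g \<in> \<H>"
  shows "(\<lambda>n. nrm (\<lambda>x. s n x - g x)) \<longlonglongrightarrow> nrm (\<lambda>x. f x - g x)"
proof -
  have s: "s n \<in> \<H>" "f \<in> \<H>" for n using assms by (auto simp: converges2_def)
  have *: "\<bar>nrm (\<lambda>x. s n x - g x) - nrm (\<lambda>x. f x - g x)\<bar> \<le> nrm (\<lambda>x. s n x - f x)" for n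
    using nrm_triangle_diff[OF s(1)[of n] s(2) assms(2)] nrm_triangle_diff[OF s(2) s(1)[of n] assms(2)]
    unfolding nrm_minus_commute[of f "s n"] by linarith
  have "(\<lambda>n. nrm (\<lambda>x. s n x - g x) - nrm (\<lambda>x. f x - g x)) \<longlonglongrightarrow> 0"
  proof (rule Lim_null_comparison)
    show "(\<lambda>n. nrm (\<lambda>x. s n x - f x)) \<longlonglongrightarrow> 0" using assms(1) by (simp add: converges2_def)
  qed (use * in \<open>simp add: always_eventually\<close>)
  then show ?thesis by (simp add: LIM_zero_iff)
qed

lemma converges2_nrm:
  assumes "converges2 s f"
  shows "(\<lambda>n. nrm (s n)) \<longlonglongrightarrow> nrm f"
  using converges2_nrm_diff[OF assms zero_ell2] by simp

lemma converges2_unique: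
  assumes "converges2 s f" "converges2 s g" shows "f = g"
proof -
  have g: "g \<in> \<H>" "f \<in> \<H>" using assms by (simp_all add: converges2_def)
  have "nrm (\<lambda>x. f x - g x) = 0"
    using LIMSEQ_unique[OF converges2_nrm_diff[OF assms(1) g(1)]] assms(2) by (auto simp: converges2_def)
  then have "(\<lambda>x. f x - g x) = (\<lambda>_. 0)" using g by (simp add: nrm_eq_0_iff)
  then show ?thesis by (metis eq_iff_diff_eq_0 ext)
qed

lemma converges2_add:
  assumes "converges2 s f" "converges2 t g"
  shows "converges2 (\<lambda>n x. s n x + t n x) (\<lambda>x. f x + g x)"
proof -
  have s: "s n \<in> \<H>" "f \<in> \<H>" "t n \<in> \<H>" "g \<in> \<H>" for n using assms by (auto simp: converges2_def)
  have "nrm (\<lambda>x. s n x + t n x - (f x + g x)) \<le> nrm (\<lambda>x. s n x - f x) + nrm (\<lambda>x. t n x - g x)" for n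
    using nrm_triangle[of "\<lambda>x. s n x - f x" "\<lambda>x. t n x - g x"] s by (simp add: algebra_simps)
  then have "\<forall>\<^sub>F n in sequentially. norm (nrm (\<lambda>x. s n x + t n x - (f x + g x))) \<le> nrm (\<lambda>x. s n x - f x) + nrm (\<lambda>x. t n x - g x)"
    by (simp add: always_eventually)
  moreover have "(\<lambda>n. nrm (\<lambda>x. s n x - f x) + nrm (\<lambda>x. t n x - g x)) \<longlonglongrightarrow> 0 + 0"
    using assms by (intro tendsto_add) (simp_all add: converges2_def)
  ultimately have "(\<lambda>n. nrm (\<lambda>x. s n x + t n x - (f x + g x))) \<longlonglongrightarrow> 0"
    by (simp add: Lim_null_comparison)
  then show ?thesis using s by (simp add: converges2_def)
qed

lemma converges2_scale:
  assumes "converges2 s f"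
  shows "converges2 (\<lambda>n x. c * s n x) (\<lambda>x. c * f x)"
proof -
  have "nrm (\<lambda>x. c * s n x - c * f x) = cmod c * nrm (\<lambda>x. s n x - f x)" for n
    using nrm_scale[of c "\<lambda>x. s n x - f x"] by (simp add: algebra_simps)
  then show ?thesis using assms tendsto_mult_right_zero by (fastforce simp: converges2_def)
qed

text \<open>By the parallelogram law a minimizing sequence in a midpoint-convex set is Cauchy.\<close>

lemma minimizing_sequence:
  assumes "C \<subseteq> \<H>" "C \<noteq> {}" "g \<in> \<H>"
    and mid: "\<And>f h. f \<in> C \<Longrightarrow> h \<in> C \<Longrightarrow> (\<lambda>x. (f x + h x) / 2) \<in> C"
  shows "\<exists>s k. (\<forall>n. s n \<in> C) \<and> converges2 s k \<and>
    (\<forall>f\<in>C. nrm (\<lambda>x. k x - g x) \<le> nrm (\<lambda>x. f x - g x))"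
proof -
  define D where "D = (\<lambda>f. (nrm (\<lambda>x. f x - g x))\<^sup>2) ` C"
  define d where "d = Inf D"
  have D: "D \<noteq> {}" "bdd_below D" using assms(2) by (auto simp: D_def intro!: bdd_belowI2[where m=0])
  have dle: "d \<le> (nrm (\<lambda>x. f x - g x))\<^sup>2" if "f \<in> C" for f
    unfolding d_def using that D by (auto simp: D_def intro: cInf_lower)
  have "\<exists>f\<in>C. (nrm (\<lambda>x. f x - g x))\<^sup>2 < d + 1 / Suc n" for n
    using cInf_lessD[OF D(1), of "d + 1 / Suc n"] by (auto simp: D_def d_def)
  then obtain s where s: "\<And>n. s n \<in> C" "\<And>n. (nrm (\<lambda>x. s n x - g x))\<^sup>2 < d + 1 / Suc n" by metis
  have sH: "s n \<in> \<H>" for n using s(1) assms(1) by blast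
  have key: "(nrm (\<lambda>x. s m x - s n x))\<^sup>2 \<le> 2 / Suc m + 2 / Suc n" for m n
  proof -
    let ?a = "\<lambda>x. s m x - g x" and ?b = "\<lambda>x. s n x - g x"
    have "(nrm (\<lambda>x. s m x - s n x))\<^sup>2 = 2 * (nrm ?a)\<^sup>2 + 2 * (nrm ?b)\<^sup>2 - (nrm (\<lambda>x. ?a x + ?b x))\<^sup>2"
      using parallelogram[of ?a ?b] sH assms(3) by simp
    moreover have "(\<lambda>x. ?a x + ?b x) = (\<lambda>x. 2 * ((s m x + s n x) / 2 - g x))"
      by (auto simp: field_simps)
    then have "(nrm (\<lambda>x. ?a x + ?b x))\<^sup>2 = 4 * (nrm (\<lambda>x. (s m x + s n x) / 2 - g x))\<^sup>2"
      by (simp only: nrm_scale power_mult_distrib) simp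
    ultimately show ?thesis
      using s(2)[of m] s(2)[of n] dle[OF mid[OF s(1)[of m] s(1)[of n]]] by simp
  qed
  have "Cauchy2 s"
    unfolding Cauchy2_def
  proof (intro conjI allI impI sH)
    fix e :: real assume "e > 0"
    obtain N :: nat where N: "4 / e\<^sup>2 < Suc N"
      by (meson less_Suc_eq of_nat_less_iff order_less_trans reals_Archimedean2)
    then have N': "4 / Suc N < e\<^sup>2" using \<open>e > 0\<close> by (simp add: field_simps)
    have "nrm (\<lambda>x. s m x - s n x) < e" if "m \<ge> N" "n \<ge> N" for m n
    proof -
      have "2 / real (Suc m) \<le> 2 / real (Suc N)" "2 / real (Suc n) \<le> 2 / real (Suc N)"
        using that by (auto intro!: divide_left_mono)
      then have "(nrm (\<lambda>x. s m x - s n x))\<^sup>2 < e\<^sup>2" using key[of m n] N' by linarith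
      then show ?thesis using \<open>e > 0\<close> by (simp add: power2_less_imp_less)
    qed
    then show "\<exists>N. \<forall>m\<ge>N. \<forall>n\<ge>N. nrm (\<lambda>x. s m x - s n x) < e" by blast
  qed
  then obtain k where k: "converges2 s k" by (rule Cauchy2_converges2)
  \<comment> \<open>\<open>C\<close> is not assumed closed: \<open>k\<close> attains the infimum of
    the distances but may lie outside \<open>C\<close>, so the sequence is exported together with
    its limit.\<close>
  have "(nrm (\<lambda>x. k x - g x))\<^sup>2 \<le> d"
  proof (rule LIMSEQ_le)
    show "(\<lambda>n. (nrm (\<lambda>x. s n x - g x))\<^sup>2) \<longlonglongrightarrow> (nrm (\<lambda>x. k x - g x))\<^sup>2"
      by (intro tendsto_intros converges2_nrm_diff[OF k assms(3)])
    show "(\<lambda>n. d + 1 / Suc n) \<longlonglongrightarrow> d"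
      using tendsto_add[OF tendsto_const[of d] LIMSEQ_inverse_real_of_nat] by (simp add: inverse_eq_divide)
    show "\<exists>N. \<forall>n\<ge>N. (nrm (\<lambda>x. s n x - g x))\<^sup>2 \<le> d + 1 / real (Suc n)" using s(2) less_imp_le by blast
  qed
  then have "nrm (\<lambda>x. k x - g x) \<le> nrm (\<lambda>x. f x - g x)" if "f \<in> C" for f
    using dle[OF that] by (meson nrm_nonneg order_trans power2_le_imp_le)
  then show ?thesis using s(1) k by blast
qed

text \<open>For \<open>a\<close> outside the carrier this is the zero vector, which makes membership
  in \<H> unconditional.\<close>

definition delta :: "'a \<Rightarrow> 'a \<Rightarrow> complex" where
  "delta a = (\<lambda>x. if x = a \<and> a \<in> carrier G then 1 else 0)"

lemma delta_ell2 [simp]: "delta a \<in> \<H>"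
  and nrm_delta: "a \<in> carrier G \<Longrightarrow> nrm (delta a) = 1"
proof -
  have fin: "(\<Sum>x\<in>F. (cmod (delta a x))\<^sup>2) \<le> 1\<^sup>2" if "finite F" for F
  proof -
    have "(\<Sum>x\<in>F. (cmod (delta a x))\<^sup>2) \<le> (\<Sum>x\<in>F. if x = a then 1 else 0)"
      by (intro sum_mono) (auto simp: delta_def)
    also have "\<dots> \<le> 1\<^sup>2" using that by simp
    finally show ?thesis .
  qed
  show H: "delta a \<in> \<H>" by (rule ell2I[where C=1]) (use fin in \<open>auto simp: delta_def\<close>)
  have "nrm (delta a) \<le> 1" by (rule ell2I[where C=1]) (use fin in \<open>auto simp: delta_def\<close>)
  moreover assume "a \<in> carrier G"
  ultimately show "nrm (delta a) = 1"
    using cmod_le_nrm[OF H, of a] by (simp add: delta_def)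
qed

lemma ip_delta_left [simp]: "a \<in> carrier G \<Longrightarrow> ip (delta a) f = f a"
proof -
  assume a: "a \<in> carrier G"
  have "ip (delta a) f = (\<Sum>\<^sub>\<infinity>x\<in>{a}. cnj (delta a x) * f x)"
    unfolding ell2_inner_def by (rule infsum_cong_neutral) (auto simp: delta_def a)
  then show ?thesis using a by (simp add: delta_def)
qed

lemma ip_delta_right [simp]: "a \<in> carrier G \<Longrightarrow> ip f (delta a) = cnj (f a)"
  using ip_commute[of "delta a" f] by simp

lemma ell2_eqI:
  assumes "f \<in> \<H>" "g \<in> \<H>" "\<And>x. x \<in> carrier G \<Longrightarrow> f x = g x" shows "f = g"
  using assms by (metis ell2_outside ext)

lemma ell2_ip_eqI:
  assumes "f \<in> \<H>" "g \<in> \<H>" "\<And>h. h \<in> \<H> \<Longrightarrow> ip h f = ip h g" shows "f = g"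
  by (rule ell2_eqI[OF assms(1,2)]) (metis assms(3) delta_ell2 ip_delta_left)

definition restr :: "'a set \<Rightarrow> ('a \<Rightarrow> complex) \<Rightarrow> 'a \<Rightarrow> complex" where
  "restr F f = (\<lambda>x. if x \<in> F then f x else 0)"

lemma restr_ell2 [simp]:
  assumes "f \<in> \<H>" shows "restr F f \<in> \<H>"
proof (rule ell2I[where C="nrm f"])
  fix E assume E: "finite E" "E \<subseteq> carrier G"
  have "(\<Sum>x\<in>E. (cmod (restr F f x))\<^sup>2) \<le> (\<Sum>x\<in>E. (cmod (f x))\<^sup>2)"
    by (rule sum_mono) (simp add: restr_def)
  then show "(\<Sum>x\<in>E. (cmod (restr F f x))\<^sup>2) \<le> (nrm f)\<^sup>2"
    using sum_le_nrm2[OF assms E] by simp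
qed (use assms in \<open>auto simp: restr_def ell2_outside\<close>)

lemma restr_ell2_finite:
  assumes "finite F" "F \<subseteq> carrier G"
  shows "restr F f \<in> \<H>" "(nrm (restr F f))\<^sup>2 = (\<Sum>x\<in>F. (cmod (f x))\<^sup>2)"
proof -
  show "restr F f \<in> \<H>"
    unfolding ell2_def
  proof (safe)
    show "(\<lambda>x. (cmod (restr F f x))\<^sup>2) summable_on carrier G"
      using summable_on_finite[OF assms(1)] assms
      by (subst summable_on_cong_neutral[where T=F and g="\<lambda>x. (cmod (f x))\<^sup>2"]) (auto simp: restr_def)
  qed (use assms in \<open>auto simp: restr_def\<close>)
  have "(nrm (restr F f))\<^sup>2 = (\<Sum>\<^sub>\<infinity>x\<in>F. (cmod (f x))\<^sup>2)"
    unfolding nrm_power2 by (rule infsum_cong_neutral) (use assms in \<open>auto simp: restr_def\<close>)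
  then show "(nrm (restr F f))\<^sup>2 = (\<Sum>x\<in>F. (cmod (f x))\<^sup>2)" using assms by simp
qed

text \<open>The estimate is stated for every finite superset of \<open>F\<close>: the truncation of
  a Fourier series must later contain prescribed group elements.\<close>

lemma restr_approx:
  assumes "f \<in> \<H>" "e > 0"
  obtains F where "finite F" "F \<subseteq> carrier G"
    "\<And>E. F \<subseteq> E \<Longrightarrow> finite E \<Longrightarrow> E \<subseteq> carrier G \<Longrightarrow> nrm (\<lambda>x. f x - restr E f x) < e"
proof -
  have s: "(\<lambda>x. (cmod (f x))\<^sup>2) summable_on carrier G" using assms by (simp add: ell2_def)
  have e2: "e\<^sup>2 / 2 > 0" using \<open>e > 0\<close> by simp
  obtain F where F: "finite F" "F \<subseteq> carrier G"
    "dist (\<Sum>x\<in>F. (cmod (f x))\<^sup>2) (\<Sum>\<^sub>\<infinity>x\<in>carrier G. (cmod (f x))\<^sup>2) \<le> e\<^sup>2 / 2"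
    using infsum_finite_approximation[OF s e2] by metis
  have "nrm (\<lambda>x. f x - restr E f x) < e" if E: "F \<subseteq> E" "finite E" "E \<subseteq> carrier G" for E
  proof -
    have r: "restr E f \<in> \<H>" using assms by simp
    \<comment> \<open>\<open>restr E f\<close> is an orthogonal projection of \<open>f\<close>, so
      the squared error is the difference of the squared norms.\<close>
    have "cnj (f x) * restr E f x = cnj (restr E f x) * restr E f x" for x by (simp add: restr_def)
    then have "ip f (restr E f) = ip (restr E f) (restr E f)" unfolding ell2_inner_def by presburger
    then have "Re (ip f (restr E f)) = (nrm (restr E f))\<^sup>2" using r by (simp add: ip_self)
    then have "(nrm (\<lambda>x. f x - restr E f x))\<^sup>2 = (nrm f)\<^sup>2 - (\<Sum>x\<in>E. (cmod (f x))\<^sup>2)"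
      using nrm_diff_power2[OF assms(1) r] restr_ell2_finite(2)[OF E(2,3)] by simp
    also have "\<dots> \<le> (nrm f)\<^sup>2 - (\<Sum>x\<in>F. (cmod (f x))\<^sup>2)"
      using E by (simp add: sum_mono2)
    also have "\<dots> \<le> e\<^sup>2 / 2" using F(3) by (simp only: nrm_power2 dist_real_def)
    also have "\<dots> < e\<^sup>2" using \<open>e > 0\<close> by simp
    finally show ?thesis using \<open>e > 0\<close> by (simp add: power2_less_imp_less)
  qed
  then show ?thesis using that F by blast
qed

lemma restr_empty [simp]: "restr {} f = (\<lambda>_. 0)"
  by (auto simp: restr_def)

lemma restr_insert:
  assumes "a \<notin> F" "a \<in> carrier G"
  shows "restr (insert a F) f = (\<lambda>x. restr F f x + f a * delta a x)"
  using assms by (auto simp: restr_def delta_def)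

text \<open>The discriminant inequality, degenerate forms included; it gives Cauchy-Schwarz for
  states and, with \<open>a = 0\<close>, orthogonality at a minimum.\<close>

lemma nonneg_quadratic_imp:
  fixes z :: complex and a b :: real
  assumes "\<And>c. 0 \<le> a + 2 * Re (c * z) + (cmod c)\<^sup>2 * b"
  shows "(cmod z)\<^sup>2 \<le> a * b"
proof (cases "z = 0")
  case True
  have "0 \<le> a" using assms[of 0] by simp
  moreover have "0 \<le> b"
  proof (rule ccontr)
    assume "\<not> 0 \<le> b"
    then have "b < 0" by simp
    \<comment> \<open>This choice of \<open>c\<close> would make the quadratic expression equal to
      -1.\<close>
    have *: "(cmod (complex_of_real (sqrt ((a + 1) / - b))))\<^sup>2 = (a + 1) / - b"
      using \<open>b < 0\<close> \<open>0 \<le> a\<close> by (simp add: divide_nonneg_neg)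
    show False using assms[of "complex_of_real (sqrt ((a + 1) / - b))"] True \<open>b < 0\<close>
      unfolding * by (simp add: field_simps)
  qed
  ultimately show ?thesis using True by simp
next
  case False
  have r: "0 \<le> a - 2 * t * (cmod z)\<^sup>2 + t\<^sup>2 * (cmod z)\<^sup>2 * b" for t :: real
  proof -
    have "cnj z * z = of_real ((cmod z)\<^sup>2)" by (metis complex_norm_square mult.commute)
    then have "Re (- of_real t * cnj z * z) = - t * (cmod z)\<^sup>2"
      by (metis (no_types, lifting) Re_complex_of_real mult.assoc of_real_minus of_real_mult)
    then show ?thesis using assms[of "- of_real t * cnj z"] by (simp add: norm_mult power_mult_distrib)
  qed
  have z: "(cmod z)\<^sup>2 > 0" using False by simp
  have "b > 0"
  proof (rule ccontr)
    assume "\<not> b > 0"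
    \<comment> \<open>For \<open>b \<le> 0\<close> the value at this \<open>t\<close> is at most
      \<open>a - 2 * (\<bar>a\<bar> + 1)\<close>, which is negative.\<close>
    define t where "t = (\<bar>a\<bar> + 1) / (cmod z)\<^sup>2"
    have "t > 0" using z by (simp add: t_def divide_pos_pos add_nonneg_pos)
    have "t * (cmod z)\<^sup>2 = \<bar>a\<bar> + 1" using z by (simp add: t_def)
    moreover have "t\<^sup>2 * (cmod z)\<^sup>2 * b \<le> 0" using \<open>\<not> b > 0\<close> by (simp add: mult_nonneg_nonpos)
    ultimately show False using r[of t] by simp
  qed
  \<comment> \<open>\<open>t = 1 / b\<close> minimizes the quadratic in \<open>t\<close>.\<close>
  have "0 \<le> a - 2 * (1/b) * (cmod z)\<^sup>2 + (1/b)\<^sup>2 * (cmod z)\<^sup>2 * b" by (rule r)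
  also have "\<dots> = a - (cmod z)\<^sup>2 / b" using \<open>b > 0\<close> by (simp add: field_simps power2_eq_square)
  finally show ?thesis using \<open>b > 0\<close> by (simp add: field_simps)
qed

section \<open>Bounded operators and adjoints\<close>

lemma bop_ell2 [simp]:
  assumes "T \<in> \<B>" shows "T f \<in> \<H>"
  using assms unfolding bounded_ops_def by (cases "f \<in> \<H>") (blast, use zero_ell2 in fastforce)

lemma bop_outside: "T \<in> \<B> \<Longrightarrow> f \<notin> \<H> \<Longrightarrow> T f = (\<lambda>_. 0)"
  unfolding bounded_ops_def by blast

lemma bop_add: "T \<in> \<B> \<Longrightarrow> f \<in> \<H> \<Longrightarrow> g \<in> \<H> \<Longrightarrow> T (\<lambda>x. f x + g x) = (\<lambda>x. T f x + T g x)"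
  unfolding bounded_ops_def by blast

lemma bop_scale: "T \<in> \<B> \<Longrightarrow> f \<in> \<H> \<Longrightarrow> T (\<lambda>x. c * f x) = (\<lambda>x. c * T f x)"
  unfolding bounded_ops_def by blast

lemma bop_add_scale:
  assumes "T \<in> \<B>" "f \<in> \<H>" "g \<in> \<H>"
  shows "T (\<lambda>x. f x + c * g x) = (\<lambda>x. T f x + c * T g x)"
  using bop_add[OF assms(1,2) scale_ell2[OF assms(3)]] bop_scale[OF assms(1,3)] by simp

lemma bop_diff:
  assumes "T \<in> \<B>" "f \<in> \<H>" "g \<in> \<H>"
  shows "T (\<lambda>x. f x - g x) = (\<lambda>x. T f x - T g x)"
  using bop_add[OF assms(1,2) scale_ell2[OF assms(3), of "-1"]] bop_scale[OF assms(1,3), of "-1"] by simp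

lemma bop_zero [simp]: "T \<in> \<B> \<Longrightarrow> T (\<lambda>_. 0) = (\<lambda>_. 0)"
  using bop_scale[of T "\<lambda>_. 0" 0] by simp

text \<open>A bound on the operator norm, kept as a relation so that no supremum has to be formed.
  The clause \<open>0 \<le> C\<close> lets bounds be multiplied.\<close>

definition op_le :: "'a operator \<Rightarrow> real \<Rightarrow> bool" where
  "op_le T C \<longleftrightarrow> 0 \<le> C \<and> (\<forall>f\<in>\<H>. nrm (T f) \<le> C * nrm f)"

lemma op_leD: "op_le T C \<Longrightarrow> f \<in> \<H> \<Longrightarrow> nrm (T f) \<le> C * nrm f"
  by (simp add: op_le_def)

lemma bop_op_le:
  assumes "T \<in> \<B>" obtains C where "op_le T C"
proof -
  obtain C where C: "\<forall>f\<in>\<H>. nrm (T f) \<le> C * nrm f" using assms unfolding bounded_ops_def by blast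
  have "nrm (T f) \<le> max C 0 * nrm f" if "f \<in> \<H>" for f
    using C that mult_right_mono[of C "max C 0" "nrm f"] by force
  then have "op_le T (max C 0)" by (simp add: op_le_def)
  then show ?thesis by (rule that)
qed

lemma bopI:
  assumes "\<And>f. f \<in> \<H> \<Longrightarrow> T f \<in> \<H>" "\<And>f. f \<notin> \<H> \<Longrightarrow> T f = (\<lambda>_. 0)"
    "\<And>f g. f \<in> \<H> \<Longrightarrow> g \<in> \<H> \<Longrightarrow> T (\<lambda>x. f x + g x) = (\<lambda>x. T f x + T g x)"
    "\<And>f c. f \<in> \<H> \<Longrightarrow> T (\<lambda>x. c * f x) = (\<lambda>x. c * T f x)"
    "op_le T C"
  shows "T \<in> \<B>"
  using assms unfolding bounded_ops_def op_le_def by blast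

lemma bop_eqI: "S \<in> \<B> \<Longrightarrow> T \<in> \<B> \<Longrightarrow> (\<And>f. f \<in> \<H> \<Longrightarrow> S f = T f) \<Longrightarrow> S = T"
  using bop_outside[of S] bop_outside[of T] by (intro ext[of S T]) force

lemma op_le_add:
  assumes "S \<in> \<B>" "T \<in> \<B>" "op_le S C" "op_le T D"
  shows "op_le (\<lambda>f x. S f x + T f x) (C + D)"
  unfolding op_le_def
proof (intro conjI ballI)
  fix f assume f: "f \<in> \<H>"
  have "nrm (\<lambda>x. S f x + T f x) \<le> nrm (S f) + nrm (T f)" using assms by (intro nrm_triangle) auto
  then show "nrm (\<lambda>x. S f x + T f x) \<le> (C + D) * nrm f"
    using op_leD[OF assms(3) f] op_leD[OF assms(4) f] by (simp add: distrib_right)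
qed (use assms in \<open>simp add: op_le_def\<close>)

lemma op_le_scale: "op_le T C \<Longrightarrow> op_le (\<lambda>f x. c * T f x) (cmod c * C)"
  by (auto simp: op_le_def nrm_scale mult.assoc intro: mult_left_mono)

lemma op_le_comp:
  assumes "T \<in> \<B>" "op_le S C" "op_le T D"
  shows "op_le (S \<circ> T) (C * D)"
  unfolding op_le_def
proof (intro conjI ballI)
  fix f assume f: "f \<in> \<H>"
  have "nrm (S (T f)) \<le> C * nrm (T f)" using assms by (simp add: op_leD)
  also have "\<dots> \<le> C * (D * nrm f)"
    using op_leD[OF assms(3) f] assms(2) by (intro mult_left_mono) (auto simp: op_le_def)
  finally show "nrm ((S \<circ> T) f) \<le> C * D * nrm f" by (simp add: mult.assoc)
qed (use assms in \<open>simp add: op_le_def\<close>)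

lemma bop_plus [simp]:
  assumes "S \<in> \<B>" "T \<in> \<B>" shows "(\<lambda>f x. S f x + T f x) \<in> \<B>"
proof -
  obtain C D where "op_le S C" "op_le T D" using assms by (metis bop_op_le)
  from op_le_add[OF assms this] show ?thesis
    by (rule bopI[rotated -1]) (use assms in \<open>auto simp: bop_outside bop_add bop_scale algebra_simps\<close>)
qed

lemma bop_smult [simp]:
  assumes "T \<in> \<B>" shows "(\<lambda>f x. c * T f x) \<in> \<B>"
proof -
  obtain C where "op_le T C" using assms by (metis bop_op_le)
  from op_le_scale[OF this] show ?thesis
    by (rule bopI[rotated -1]) (use assms in \<open>auto simp: bop_outside bop_add bop_scale algebra_simps\<close>)
qed

lemma bop_comp [simp]:
  assumes "S \<in> \<B>" "T \<in> \<B>" shows "S \<circ> T \<in> \<B>"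
proof -
  obtain C D where "op_le S C" "op_le T D" using assms by (metis bop_op_le)
  from op_le_comp[OF assms(2) this] show ?thesis
    by (rule bopI[rotated -1]) (use assms in \<open>auto simp: bop_outside bop_add bop_scale\<close>)
qed

lemma op_le_scalar_op: "op_le (scalar_op G c) (cmod c)"
  by (simp add: op_le_def scalar_op_def nrm_scale)

lemma bop_scalar [simp]: "scalar_op G c \<in> \<B>"
  by (rule bopI[OF _ _ _ _ op_le_scalar_op]) (auto simp: scalar_op_def algebra_simps)

lemma scalar_op_apply: "f \<in> \<H> \<Longrightarrow> scalar_op G c f = (\<lambda>x. c * f x)"
  by (simp add: scalar_op_def)

abbreviation "idop \<equiv> scalar_op G 1"

lemma idop_apply [simp]: "f \<in> \<H> \<Longrightarrow> idop f = f"
  by (simp add: scalar_op_def)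

lemma bop_converges2:
  assumes "T \<in> \<B>" "converges2 s f"
  shows "converges2 (\<lambda>n. T (s n)) (T f)"
proof -
  obtain C where C: "op_le T C" using assms by (metis bop_op_le)
  have s: "s n \<in> \<H>" "f \<in> \<H>" for n using assms by (auto simp: converges2_def)
  have "nrm (\<lambda>x. T (s n) x - T f x) \<le> C * nrm (\<lambda>x. s n x - f x)" for n
    using op_leD[OF C diff_ell2[OF s]] s by (simp add: bop_diff[OF assms(1)])
  then have "\<forall>\<^sub>F n in sequentially. norm (nrm (\<lambda>x. T (s n) x - T f x)) \<le> C * nrm (\<lambda>x. s n x - f x)"
    by (simp add: always_eventually)
  moreover have "(\<lambda>n. C * nrm (\<lambda>x. s n x - f x)) \<longlonglongrightarrow> 0"
    using assms by (intro tendsto_mult_right_zero) (simp add: converges2_def)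
  ultimately have "(\<lambda>n. nrm (\<lambda>x. T (s n) x - T f x)) \<longlonglongrightarrow> 0"
    by (rule Lim_null_comparison)
  then show ?thesis using assms(1) s by (simp add: converges2_def)
qed

text \<open>Finitely supported vectors are dense and both sides are continuous in \<open>g\<close>,
  so the basis vectors decide.\<close>

lemma ip_eqI_delta:
  assumes "T \<in> \<B>" "S \<in> \<B>" "f \<in> \<H>"
    and d: "\<And>x. x \<in> carrier G \<Longrightarrow> ip (S f) (delta x) = ip f (T (delta x))"
    and g: "g \<in> \<H>"
  shows "ip (S f) g = ip f (T g)"
proof -
  obtain C where C: "op_le T C" using assms by (metis bop_op_le)
  have fin: "ip (S f) (restr F g) = ip f (T (restr F g))" if "finite F" "F \<subseteq> carrier G" for F
    using that
  proof (induction F)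
    case empty
    then show ?case using assms by simp
  next
    case (insert a F)
    then have H: "restr F g \<in> \<H>" "(\<lambda>x. g a * delta a x) \<in> \<H>" using g by auto
    have "T (restr (insert a F) g) = (\<lambda>x. T (restr F g) x + g a * T (delta a) x)"
      using insert assms bop_add_scale[OF assms(1) H(1) delta_ell2] by (simp add: restr_insert)
    then have "ip f (T (restr (insert a F) g)) = ip f (T (restr F g)) + g a * ip f (T (delta a))"
      using assms by (simp add: ip_add_right ip_scale_right)
    moreover have "ip (S f) (restr (insert a F) g) = ip (S f) (restr F g) + g a * ip (S f) (delta a)"
      using insert H assms by (simp add: restr_insert ip_add_right ip_scale_right del: ip_delta_right)
    ultimately show ?case using insert d by simp
  qed
  have "cmod (ip (S f) g - ip f (T g)) \<le> e" if "e > 0" for e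
  proof -
    \<comment> \<open>The two sides differ by a functional of norm at most \<open>K - 1\<close>; the
      summand 1 keeps \<open>K\<close> positive.\<close>
    define K where "K = nrm (S f) + C * nrm f + 1"
    have "K > 0" using C by (simp add: K_def op_le_def add_nonneg_pos)
    then have "e / K > 0" using \<open>e > 0\<close> by simp
    then obtain F where F: "finite F" "F \<subseteq> carrier G" "nrm (\<lambda>x. g x - restr F g x) < e / K"
      using restr_approx[OF g] by (metis order_refl)
    let ?d = "\<lambda>x. g x - restr F g x"
    have dH: "?d \<in> \<H>" using g by simp
    have "ip (S f) g - ip f (T g) = ip (S f) ?d - ip f (T ?d)"
      using assms fin[OF F(1,2)] by (simp add: ip_diff_right bop_diff)
    also have "cmod \<dots> \<le> nrm (S f) * nrm ?d + nrm f * nrm (T ?d)"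
      using assms dH by (intro order_trans[OF norm_triangle_ineq4] add_mono cauchy_schwarz) auto
    also have "\<dots> \<le> nrm (S f) * nrm ?d + nrm f * (C * nrm ?d)"
      using op_leD[OF C dH] by (intro add_left_mono mult_left_mono) auto
    also have "\<dots> \<le> K * nrm ?d" by (simp add: K_def algebra_simps)
    also have "\<dots> \<le> K * (e / K)" using F \<open>K > 0\<close> by (intro mult_left_mono) auto
    also have "\<dots> = e" using \<open>K > 0\<close> by simp
    finally show ?thesis .
  qed
  then have "cmod (ip (S f) g - ip f (T g)) \<le> 0" by (rule dense_ge)
  then show ?thesis by simp
qed

text \<open>The matrix entries of the adjoint are forced. Its bound comes from duality: test against
  the finite restriction \<open>g\<close> of \<open>S f\<close> itself, where
  \<open>(nrm g)\<^sup>2 = ip (T g) f\<close> is at most \<open>C * nrm g * nrm f\<close>.\<close>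

lemma adjoint_exists:
  assumes T: "T \<in> \<B>" and C: "op_le T C"
  shows "\<exists>S\<in>\<B>. op_le S C \<and> (\<forall>f\<in>\<H>. \<forall>g\<in>\<H>. ip (S f) g = ip f (T g))"
proof -
  define S where "S f = (if f \<in> \<H> then (\<lambda>x. if x \<in> carrier G then ip (T (delta x)) f else 0) else (\<lambda>_. 0))" for f
  have "0 \<le> C" using C by (simp add: op_le_def)
  have fin: "(\<Sum>x\<in>F. (cmod (S f x))\<^sup>2) \<le> (C * nrm f)\<^sup>2"
    if F: "finite F" "F \<subseteq> carrier G" and f: "f \<in> \<H>" for f F
  proof -
    define g where "g = restr F (S f)"
    have gH: "g \<in> \<H>" and ng: "(nrm g)\<^sup>2 = (\<Sum>x\<in>F. (cmod (S f x))\<^sup>2)"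
      using restr_ell2_finite[OF F] by (auto simp: g_def)
    have "ip (T (restr E (S f))) f = of_real (\<Sum>x\<in>E. (cmod (S f x))\<^sup>2)" if "finite E" "E \<subseteq> carrier G" for E
      using that
    proof (induction E)
      case empty
      then show ?case using T by simp
    next
      case (insert a E)
      have H: "restr E (S f) \<in> \<H>" using insert restr_ell2_finite by simp
      have "T (restr (insert a E) (S f)) = (\<lambda>x. T (restr E (S f)) x + S f a * T (delta a) x)"
        using insert bop_add_scale[OF T H delta_ell2] by (simp add: restr_insert)
      then have "ip (T (restr (insert a E) (S f))) f = ip (T (restr E (S f))) f + cnj (S f a) * ip (T (delta a)) f"
        using T f by (simp add: ip_add_left ip_scale_left)
      also have "ip (T (delta a)) f = S f a" using f insert by (simp add: S_def)
      also have "cnj (S f a) * S f a = of_real ((cmod (S f a))\<^sup>2)"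
        by (simp only: complex_norm_square mult.commute)
      finally show ?case using insert by simp
    qed
    from this[OF F] have "of_real ((nrm g)\<^sup>2) = ip (T g) f" by (simp add: g_def[symmetric] ng)
    then have "(nrm g)\<^sup>2 = cmod (ip (T g) f)"
      by (metis abs_of_nonneg norm_of_real zero_le_power2)
    also have "\<dots> \<le> nrm (T g) * nrm f" using T f by (intro cauchy_schwarz) auto
    also have "\<dots> \<le> C * nrm g * nrm f" using op_leD[OF C gH] by (intro mult_right_mono) auto
    finally have "nrm g * nrm g \<le> C * nrm f * nrm g" by (simp add: power2_eq_square algebra_simps)
    then have "nrm g \<le> C * nrm f"
      using \<open>0 \<le> C\<close> by (cases "nrm g = 0") (simp_all add: less_le)
    then show ?thesis unfolding ng[symmetric] by (intro power_mono) auto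
  qed
  have SH: "S f \<in> \<H>" "nrm (S f) \<le> C * nrm f" if "f \<in> \<H>" for f
    using ell2I[of "S f" "C * nrm f"] fin[OF _ _ that] \<open>0 \<le> C\<close> by (auto simp: S_def)
  have le: "op_le S C" using SH \<open>0 \<le> C\<close> by (simp add: op_le_def)
  have SB: "S \<in> \<B>"
    by (rule bopI[OF _ _ _ _ le]) (auto simp: SH(1), auto simp: S_def T ip_add_right ip_scale_right)
  have "ip (S f) (delta x) = ip f (T (delta x))" if "f \<in> \<H>" "x \<in> carrier G" for f x
    using that by (simp add: S_def ip_commute)
  then have "\<forall>f\<in>\<H>. \<forall>g\<in>\<H>. ip (S f) g = ip f (T g)"
    using ip_eqI_delta[OF T SB] by blast
  then show ?thesis using SB le by blast
qed

abbreviation adj :: "'a operator \<Rightarrow> 'a operator" where "adj \<equiv> op_adjoint G"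

lemma adj_unique:
  assumes "S \<in> \<B>" "\<And>f g. f \<in> \<H> \<Longrightarrow> g \<in> \<H> \<Longrightarrow> ip (S f) g = ip f (T g)"
  shows "adj T = S"
  unfolding op_adjoint_def
proof (rule the_equality)
  show "S \<in> \<B> \<and> (\<forall>f\<in>\<H>. \<forall>g\<in>\<H>. ip (S f) g = ip f (T g))" using assms by blast
  fix R assume R: "R \<in> \<B> \<and> (\<forall>f\<in>\<H>. \<forall>g\<in>\<H>. ip (R f) g = ip f (T g))"
  show "R = S"
  proof (rule bop_eqI)
    fix f assume f: "f \<in> \<H>"
    show "R f = S f"
      by (rule ell2_ip_eqI) (use R assms f in \<open>auto intro!: arg_cong[where f=cnj] simp flip: ip_commute[of "R f"] ip_commute[of "S f"]\<close>)
  qed (use R assms in auto)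
qed

lemma
  assumes "T \<in> \<B>"
  shows adj_bop [simp]: "adj T \<in> \<B>"
    and adj_left: "f \<in> \<H> \<Longrightarrow> g \<in> \<H> \<Longrightarrow> ip (adj T f) g = ip f (T g)"
    and op_le_adj: "op_le T C \<Longrightarrow> op_le (adj T) C"
proof -
  obtain D where "op_le T D" using assms by (metis bop_op_le)
  then show "adj T \<in> \<B>" "f \<in> \<H> \<Longrightarrow> g \<in> \<H> \<Longrightarrow> ip (adj T f) g = ip f (T g)"
    using adjoint_exists[OF assms] adj_unique by metis+
  show "op_le T C \<Longrightarrow> op_le (adj T) C"
    using adjoint_exists[OF assms] adj_unique by metis
qed

lemma adj_right: "T \<in> \<B> \<Longrightarrow> f \<in> \<H> \<Longrightarrow> g \<in> \<H> \<Longrightarrow> ip f (adj T g) = ip (T f) g"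
  using adj_left[of T g f] by (metis ip_commute)

lemma adj_adj [simp]: "T \<in> \<B> \<Longrightarrow> adj (adj T) = T"
  by (rule adj_unique) (simp_all add: adj_right)

lemma adj_comp: "S \<in> \<B> \<Longrightarrow> T \<in> \<B> \<Longrightarrow> adj (S \<circ> T) = adj T \<circ> adj S"
  by (rule adj_unique) (simp_all add: adj_left)

lemma adj_plus: "S \<in> \<B> \<Longrightarrow> T \<in> \<B> \<Longrightarrow> adj (\<lambda>f x. S f x + T f x) = (\<lambda>f x. adj S f x + adj T f x)"
  by (rule adj_unique) (simp_all add: adj_left ip_add_left ip_add_right)

lemma adj_smult: "T \<in> \<B> \<Longrightarrow> adj (\<lambda>f x. c * T f x) = (\<lambda>f x. cnj c * adj T f x)"
  by (rule adj_unique) (simp_all add: adj_left ip_scale_left ip_scale_right)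

lemma adj_scalar: "adj (scalar_op G c) = scalar_op G (cnj c)"
  by (rule adj_unique) (simp_all add: scalar_op_apply ip_scale_left ip_scale_right)

text \<open>The sum converges since the row of matrix entries is the conjugate of the vector
  \<open>adj T (delta y)\<close>.\<close>

lemma bop_apply:
  assumes "T \<in> \<B>" "f \<in> \<H>" "y \<in> carrier G"
  shows "T f y = (\<Sum>\<^sub>\<infinity>z\<in>carrier G. T (delta z) y * f z)"
proof -
  have "T f y = ip (adj T (delta y)) f" using assms by (simp add: adj_left)
  also have "\<dots> = (\<Sum>\<^sub>\<infinity>z\<in>carrier G. T (delta z) y * f z)"
    unfolding ell2_inner_def
  proof (rule infsum_cong)
    fix z assume z: "z \<in> carrier G"
    have "adj T (delta y) z = ip (delta z) (adj T (delta y))" using z by simp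
    also have "\<dots> = ip (T (delta z)) (delta y)" using assms by (simp only: adj_right delta_ell2)
    finally show "cnj (adj T (delta y) z) * f z = T (delta z) y * f z" using assms by simp
  qed
  finally show ?thesis .
qed

lemma bop_eqI_delta:
  assumes "S \<in> \<B>" "T \<in> \<B>" "\<And>x y. x \<in> carrier G \<Longrightarrow> y \<in> carrier G \<Longrightarrow> S (delta x) y = T (delta x) y"
  shows "S = T"
proof (rule bop_eqI[OF assms(1,2)])
  fix f assume f: "f \<in> \<H>"
  show "S f = T f"
  proof (rule ell2_eqI)
    fix y assume y: "y \<in> carrier G"
    show "S f y = T f y"
      unfolding bop_apply[OF assms(1) f y] bop_apply[OF assms(2) f y]
      by (rule infsum_cong) (simp add: assms(3) y)
  qed (use assms in simp_all)
qed

lemma strong_limit: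
  assumes t: "\<And>n. t n \<in> \<B>" "\<And>n. op_le (t n) C"
    and conv: "\<And>f. f \<in> \<H> \<Longrightarrow> \<exists>k. converges2 (\<lambda>n. t n f) k"
  shows "\<exists>T\<in>\<B>. op_le T C \<and> (\<forall>f\<in>\<H>. converges2 (\<lambda>n. t n f) (T f))"
proof -
  define T where "T f = (if f \<in> \<H> then SOME k. converges2 (\<lambda>n. t n f) k else (\<lambda>_. 0))" for f
  have T: "converges2 (\<lambda>n. t n f) (T f)" if "f \<in> \<H>" for f
    using conv[OF that] that by (simp add: T_def someI_ex)
  have le: "op_le T C"
    unfolding op_le_def
  proof (intro conjI ballI)
    show "0 \<le> C" using t(2) by (simp add: op_le_def)
    fix f assume f: "f \<in> \<H>"
    show "nrm (T f) \<le> C * nrm f"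
      by (rule LIMSEQ_le_const2[OF converges2_nrm[OF T[OF f]]]) (use op_leD[OF t(2) f] in blast)
  qed
  have "T \<in> \<B>"
  proof (rule bopI[OF _ _ _ _ le])
    fix f g c assume f: "f \<in> \<H>"
    show "T f \<in> \<H>" using T[OF f] by (simp add: converges2_def)
    show "T (\<lambda>x. c * f x) = (\<lambda>x. c * T f x)"
      using converges2_unique[OF T[OF scale_ell2[OF f, of c]]] converges2_scale[OF T[OF f], of c] f t(1)
      by (simp add: bop_scale)
    assume g: "g \<in> \<H>"
    show "T (\<lambda>x. f x + g x) = (\<lambda>x. T f x + T g x)"
      using converges2_unique[OF T[OF add_ell2[OF f g]]] converges2_add[OF T[OF f] T[OF g]] f g t(1)
      by (simp add: bop_add)
  qed (simp add: T_def)
  then show ?thesis using le T by blast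
qed

text \<open>Uniform boundedness upgrades convergence on a basis to convergence everywhere, by
  splitting the error into three parts.\<close>

lemma converges2_from_delta:
  assumes t: "\<And>n. t n \<in> \<B>" "\<And>n. op_le (t n) C"
    and conv: "\<And>x. x \<in> carrier G \<Longrightarrow> \<exists>k. converges2 (\<lambda>n. t n (delta x)) k"
    and f: "f \<in> \<H>"
  shows "\<exists>k. converges2 (\<lambda>n. t n f) k"
proof -
  have fin: "\<exists>k. converges2 (\<lambda>n. t n (restr F f)) k" if "finite F" "F \<subseteq> carrier G" for F
    using that
  proof (induction F)
    case empty
    have "converges2 (\<lambda>n. \<lambda>_. 0) (\<lambda>_. 0)" by (simp add: converges2_def)
    then show ?case using t by auto
  next
    case (insert a F)
    then obtain k l where k: "converges2 (\<lambda>n. t n (restr F f)) k" and l: "converges2 (\<lambda>n. t n (delta a)) l"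
      using conv by (metis insert_subset)
    have "t n (restr (insert a F) f) = (\<lambda>x. t n (restr F f) x + f a * t n (delta a) x)" for n
      using insert bop_add_scale[OF t(1) restr_ell2[OF f] delta_ell2] by (simp add: restr_insert)
    then show ?case using converges2_add[OF k converges2_scale[OF l, of "f a"]] by auto
  qed
  have C: "0 \<le> C" using t by (simp add: op_le_def)
  have "Cauchy2 (\<lambda>n. t n f)"
    unfolding Cauchy2_def
  proof (intro conjI allI impI)
    show "t n f \<in> \<H>" for n using t by simp
    fix e :: real assume "e > 0"
    \<comment> \<open>The summand 1 covers \<open>C = 0\<close> and makes
      \<open>C * d < e / 3\<close> strict.\<close>
    define d where "d = e / (3 * (C + 1))"
    have d: "d > 0" "C * d < e / 3" using \<open>e > 0\<close> C by (auto simp: d_def field_simps)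
    obtain F where F: "finite F" "F \<subseteq> carrier G" "nrm (\<lambda>x. f x - restr F f x) < d"
      using restr_approx[OF f d(1)] by (metis order_refl)
    let ?g = "restr F f"
    have gH: "?g \<in> \<H>" using f by simp
    have tg: "nrm (\<lambda>x. t n f x - t n ?g x) < e / 3" for n
    proof -
      have "nrm (\<lambda>x. t n f x - t n ?g x) = nrm (t n (\<lambda>x. f x - ?g x))"
        using bop_diff[OF t(1) f gH] by simp
      also have "\<dots> \<le> C * nrm (\<lambda>x. f x - ?g x)" using f gH by (intro op_leD t(2)) simp
      also have "\<dots> \<le> C * d" using F C by (intro mult_left_mono) auto
      finally show ?thesis using d by simp
    qed
    have "Cauchy2 (\<lambda>n. t n ?g)" using fin[OF F(1,2)] converges2_Cauchy2 by blast
    then obtain N where N: "\<And>m n. m \<ge> N \<Longrightarrow> n \<ge> N \<Longrightarrow> nrm (\<lambda>x. t m ?g x - t n ?g x) < e / 3"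
      unfolding Cauchy2_def using \<open>e > 0\<close> by (meson zero_less_divide_iff zero_less_numeral)
    have "nrm (\<lambda>x. t m f x - t n f x) < e" if mn: "m \<ge> N" "n \<ge> N" for m n
    proof -
      have "nrm (\<lambda>x. t m f x - t n f x) \<le> nrm (\<lambda>x. t m f x - t m ?g x) + nrm (\<lambda>x. t m ?g x - t n f x)"
        using t by (intro nrm_triangle_diff) auto
      also have "nrm (\<lambda>x. t m ?g x - t n f x) \<le> nrm (\<lambda>x. t m ?g x - t n ?g x) + nrm (\<lambda>x. t n ?g x - t n f x)"
        using t by (intro nrm_triangle_diff) auto
      finally show ?thesis using tg[of m] tg[of n] N[OF mn] nrm_minus_commute[of "t n ?g" "t n f"] by linarith
    qed
    then show "\<exists>N. \<forall>m\<ge>N. \<forall>n\<ge>N. nrm (\<lambda>x. t m f x - t n f x) < e" by blast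
  qed
  then show ?thesis by (metis Cauchy2_converges2)
qed

section \<open>Von Neumann algebras and unitaries\<close>

lemma commutantI:
  assumes "T \<in> \<B>" "M \<subseteq> \<B>" "\<And>S f. S \<in> M \<Longrightarrow> f \<in> \<H> \<Longrightarrow> T (S f) = S (T f)"
  shows "T \<in> commutant G M"
proof -
  have "T \<circ> S = S \<circ> T" if "S \<in> M" for S
    by (rule bop_eqI) (use assms that in auto)
  then show ?thesis using assms(1) by (simp add: commutant_def)
qed

lemma commutantD: "T \<in> commutant G M \<Longrightarrow> S \<in> M \<Longrightarrow> T (S f) = S (T f)"
  unfolding commutant_def by (metis (mono_tags, lifting) comp_apply mem_Collect_eq)

lemma commutant_bop: "T \<in> commutant G M \<Longrightarrow> T \<in> \<B>"
  by (simp add: commutant_def)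

abbreviation "vna \<equiv> von_neumann_algebra G"

lemma vna_bop: "vna M \<Longrightarrow> T \<in> M \<Longrightarrow> T \<in> \<B>"
  by (auto simp: von_neumann_algebra_def)

lemma vna_adj: "vna M \<Longrightarrow> T \<in> M \<Longrightarrow> adj T \<in> M"
  by (simp add: von_neumann_algebra_def)

text \<open>The bicommutant condition as a membership test. The closure properties below, algebraic
  and topological, reduce to commuting with the commutant.\<close>

lemma vnaI_commuting:
  assumes "vna M" "T \<in> \<B>" "\<And>S f. S \<in> commutant G M \<Longrightarrow> f \<in> \<H> \<Longrightarrow> T (S f) = S (T f)"
  shows "T \<in> M"
proof -
  have "T \<in> commutant G (commutant G M)"
    by (rule commutantI) (use assms in \<open>auto simp: commutant_bop\<close>)
  then show ?thesis using assms(1) by (simp add: von_neumann_algebra_def)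
qed

lemma commutant_adj:
  assumes "M \<subseteq> \<B>" "\<And>T. T \<in> M \<Longrightarrow> adj T \<in> M" "T \<in> commutant G M"
  shows "adj T \<in> commutant G M"
proof -
  have T: "T \<in> \<B>" using assms(3) by (rule commutant_bop)
  have "adj T \<circ> S = S \<circ> adj T" if "S \<in> M" for S
  proof -
    have S: "S \<in> \<B>" "adj S \<in> M" using assms that by auto
    then have "adj S \<circ> T = T \<circ> adj S" using assms(3) by (simp add: commutant_def)
    then have "adj (adj S \<circ> T) = adj (T \<circ> adj S)" by simp
    then show ?thesis using S T by (simp add: adj_comp)
  qed
  then show ?thesis using T by (simp add: commutant_def)
qed

text \<open>Taking commutants reverses inclusions, so a commutant is its own bicommutant; its
  self-adjointness comes from that of \<open>M\<close>.\<close>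

lemma commutant_vna:
  assumes "M \<subseteq> \<B>" "\<And>T. T \<in> M \<Longrightarrow> adj T \<in> M"
  shows "vna (commutant G M)"
  unfolding von_neumann_algebra_def
proof (intro conjI ballI)
  show "commutant G M \<subseteq> \<B>" by (auto simp: commutant_bop)
  show "adj T \<in> commutant G M" if "T \<in> commutant G M" for T using commutant_adj[OF assms that] .
  have "M \<subseteq> commutant G (commutant G M)" using assms by (auto simp: commutant_def)
  then show "commutant G (commutant G (commutant G M)) = commutant G M"
    by (auto simp: commutant_def)
qed

lemma vna_commutant: "vna M \<Longrightarrow> vna (commutant G M)"
  by (rule commutant_vna) (auto simp: vna_bop vna_adj)

lemma vna_plus:
  assumes "vna M" "S \<in> M" "T \<in> M" shows "(\<lambda>f x. S f x + T f x) \<in> M"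
proof (rule vnaI_commuting[OF assms(1)])
  fix R f assume "R \<in> commutant G M" "f \<in> \<H>"
  then show "(\<lambda>x. S (R f) x + T (R f) x) = R (\<lambda>x. S f x + T f x)"
    using assms commutantD[of R M] commutant_bop[of R M] by (simp add: bop_add vna_bop)
qed (use assms in \<open>simp add: vna_bop\<close>)

lemma vna_smult:
  assumes "vna M" "T \<in> M" shows "(\<lambda>f x. c * T f x) \<in> M"
proof (rule vnaI_commuting[OF assms(1)])
  fix R f assume "R \<in> commutant G M" "f \<in> \<H>"
  then show "(\<lambda>x. c * T (R f) x) = R (\<lambda>x. c * T f x)"
    using assms commutantD[of R M] commutant_bop[of R M] by (simp add: bop_scale vna_bop)
qed (use assms in \<open>simp add: vna_bop\<close>)

lemma vna_lin:
  assumes "vna M" "S \<in> M" "T \<in> M" shows "(\<lambda>f x. a * S f x + b * T f x) \<in> M"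
  using vna_plus[OF assms(1) vna_smult[OF assms(1,2)] vna_smult[OF assms(1,3)]] .

lemma vna_comp:
  assumes "vna M" "S \<in> M" "T \<in> M" shows "S \<circ> T \<in> M"
proof (rule vnaI_commuting[OF assms(1)])
  fix R f assume "R \<in> commutant G M" "f \<in> \<H>"
  then show "(S \<circ> T) (R f) = R ((S \<circ> T) f)"
    using assms commutantD[of R M] by simp
qed (use assms in \<open>simp add: vna_bop\<close>)

lemma vna_scalar:
  assumes "vna M" shows "scalar_op G c \<in> M"
proof (rule vnaI_commuting[OF assms(1)])
  fix R f assume "R \<in> commutant G M" "f \<in> \<H>"
  then show "scalar_op G c (R f) = R (scalar_op G c f)"
    using commutant_bop[of R M] by (simp add: scalar_op_apply bop_scale)
qed simp

lemma vna_limit: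
  assumes "vna M" "T \<in> \<B>" "\<And>n. t n \<in> M" "\<And>f. f \<in> \<H> \<Longrightarrow> converges2 (\<lambda>n. t n f) (T f)"
  shows "T \<in> M"
proof (rule vnaI_commuting[OF assms(1,2)])
  fix R f assume R: "R \<in> commutant G M" and f: "f \<in> \<H>"
  have RB: "R \<in> \<B>" using R by (rule commutant_bop)
  have "converges2 (\<lambda>n. R (t n f)) (R (T f))" by (rule bop_converges2[OF RB assms(4)[OF f]])
  moreover have "R (t n f) = t n (R f)" for n using commutantD[OF R assms(3)] .
  ultimately show "T (R f) = R (T f)"
    using converges2_unique[OF assms(4)[of "R f"]] RB by simp
qed

text \<open>The center is itself a commutant, namely that of
  \<open>commutant G M \<union> M\<close>, because \<open>M\<close> equals its bicommutant.\<close>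

lemma vna_center:
  assumes "vna M" shows "vna (M \<inter> commutant G M)"
proof -
  have "M \<inter> commutant G M = commutant G (commutant G M \<union> M)"
    using assms by (auto simp: von_neumann_algebra_def commutant_def)
  moreover have "vna (commutant G (commutant G M \<union> M))"
    using assms vna_commutant[OF assms] by (intro commutant_vna) (auto simp: vna_bop vna_adj)
  ultimately show ?thesis by simp
qed

section \<open>Unitary operators and the Cayley transform\<close>

definition unitary_op :: "'a operator \<Rightarrow> bool" where
  "unitary_op u \<longleftrightarrow> u \<in> \<B> \<and> adj u \<circ> u = idop \<and> u \<circ> adj u = idop"

lemma unitary_bop: "unitary_op u \<Longrightarrow> u \<in> \<B>"
  by (simp add: unitary_op_def)

lemma unitary_adj: "unitary_op u \<Longrightarrow> unitary_op (adj u)"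
  by (simp add: unitary_op_def)

lemma unitary_cancel [simp]:
  assumes "unitary_op u" "f \<in> \<H>"
  shows "adj u (u f) = f" "u (adj u f) = f"
  using assms unfolding unitary_op_def by (metis comp_apply idop_apply)+

lemma unitary_ip:
  assumes "unitary_op u" "f \<in> \<H>" "g \<in> \<H>" shows "ip (u f) (u g) = ip f g"
  using assms adj_right[of u f "u g"] unitary_bop[of u] by simp

lemma unitary_nrm:
  assumes "unitary_op u" "f \<in> \<H>" shows "nrm (u f) = nrm f"
proof -
  have "complex_of_real ((nrm (u f))\<^sup>2) = of_real ((nrm f)\<^sup>2)"
    using unitary_ip[OF assms assms(2)] assms unitary_bop[of u] by (simp only: ip_self bop_ell2)
  then have "(nrm (u f))\<^sup>2 = (nrm f)\<^sup>2" by (simp only: of_real_eq_iff)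
  then show ?thesis by simp
qed

lemma unitary_op_le: "unitary_op u \<Longrightarrow> op_le u 1"
  by (simp add: op_le_def unitary_nrm)

lemma unitary_comp:
  assumes "unitary_op u" "unitary_op v" shows "unitary_op (u \<circ> v)"
proof -
  have B: "u \<in> \<B>" "v \<in> \<B>" using assms by (auto simp: unitary_bop)
  have "adj v \<circ> adj u \<circ> (u \<circ> v) = idop" "u \<circ> v \<circ> (adj v \<circ> adj u) = idop"
    using assms B by (auto intro!: bop_eqI simp flip: comp_assoc)
  then show ?thesis using B by (simp add: unitary_op_def adj_comp)
qed

lemma unitaryI:
  assumes "u \<in> \<B>" "\<And>f g. f \<in> \<H> \<Longrightarrow> g \<in> \<H> \<Longrightarrow> ip (u f) (u g) = ip f g"
    "\<And>k. k \<in> \<H> \<Longrightarrow> \<exists>f\<in>\<H>. u f = k"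
  shows "unitary_op u"
proof -
  have 1: "adj u (u f) = f" if f: "f \<in> \<H>" for f
    by (rule ell2_ip_eqI) (use assms(1,2) f in \<open>simp_all add: adj_right\<close>)
  have 2: "u (adj u k) = k" if "k \<in> \<H>" for k
    using assms(3)[OF that] 1 by metis
  show ?thesis
    unfolding unitary_op_def using assms(1) 1 2 by (auto intro!: bop_eqI)
qed

text \<open>Expanding the square gives a quadratic in \<open>c\<close> without constant term that is
  never negative, which forces the linear coefficient to vanish.\<close>

lemma minimal_orthogonal:
  assumes "r \<in> \<H>" "v \<in> \<H>" "\<And>c. nrm r \<le> nrm (\<lambda>x. r x + c * v x)"
  shows "ip r v = 0"
proof -
  have "0 \<le> 0 + 2 * Re (c * ip r v) + (cmod c)\<^sup>2 * (nrm v)\<^sup>2" for c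
  proof -
    have "(nrm r)\<^sup>2 \<le> (nrm (\<lambda>x. r x + c * v x))\<^sup>2" using assms(3) by (intro power_mono) auto
    then show ?thesis
      using nrm_add_power2[OF assms(1) scale_ell2[OF assms(2), of c]]
      by (simp add: ip_scale_right nrm_scale power_mult_distrib)
  qed
  then have "(cmod (ip r v))\<^sup>2 \<le> 0 * (nrm v)\<^sup>2" by (rule nonneg_quadratic_imp)
  then show ?thesis by simp
qed

text \<open>For skew-adjoint \<open>b\<close> the values \<open>ip f (b f)\<close> are imaginary, so
  \<open>1 - b\<close> does not decrease norms. It is thus injective with closed range, and a
  nearest point argument shows that the range is everything.\<close>

lemma skew_resolvent:
  assumes b: "b \<in> \<B>" "adj b = (\<lambda>f x. - b f x)"
  shows "\<exists>c\<in>\<B>. (\<forall>f\<in>\<H>. (\<lambda>x. c f x - b (c f) x) = f) \<and> (\<forall>f\<in>\<H>. c (\<lambda>x. f x - b f x) = f)"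
proof -
  define S where "S f = (\<lambda>x. f x - b f x)" for f
  have SH: "S f \<in> \<H>" if "f \<in> \<H>" for f using that b by (simp add: S_def)
  have Sdiff: "S (\<lambda>x. f x - g x) = (\<lambda>x. S f x - S g x)" if "f \<in> \<H>" "g \<in> \<H>" for f g
    using that b by (auto simp: S_def bop_diff)
  have Sadd: "S (\<lambda>x. f x + g x) = (\<lambda>x. S f x + S g x)" if "f \<in> \<H>" "g \<in> \<H>" for f g
    using that b by (auto simp: S_def bop_add)
  have Sscale: "S (\<lambda>x. a * f x) = (\<lambda>x. a * S f x)" if "f \<in> \<H>" for f a
    using that b by (auto simp: S_def bop_scale algebra_simps)
  have re: "Re (ip f (b f)) = 0" if "f \<in> \<H>" for f
  proof -
    have "ip f (b f) = ip (adj b f) f" using that b(1) by (simp add: adj_left)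
    also have "\<dots> = - ip (b f) f" using b ip_scale_left[of "-1" "b f" f] by simp
    also have "\<dots> = - cnj (ip f (b f))" by (simp add: ip_commute)
    finally have "Re (ip f (b f)) = Re (- cnj (ip f (b f)))" by simp
    then show ?thesis by simp
  qed
  have le: "nrm f \<le> nrm (S f)" if "f \<in> \<H>" for f
  proof (rule power2_le_imp_le)
    show "(nrm f)\<^sup>2 \<le> (nrm (S f))\<^sup>2"
      using nrm_diff_power2[of f "b f"] re[OF that] that b by (simp add: S_def)
  qed simp
  have inj: "f = g" if "f \<in> \<H>" "g \<in> \<H>" "S f = S g" for f g
  proof -
    have "nrm (\<lambda>x. f x - g x) = 0"
      using le[of "\<lambda>x. f x - g x"] that by (simp add: Sdiff order_antisym)
    then have "(\<lambda>x. f x - g x) = (\<lambda>_. 0)" using that nrm_eq_0_iff[of "\<lambda>x. f x - g x"] by simp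
    then show ?thesis by (metis eq_iff_diff_eq_0 ext)
  qed
  have surj: "\<exists>l\<in>\<H>. S l = g" if g: "g \<in> \<H>" for g
  proof -
    have mid: "(\<lambda>x. (f x + h x) / 2) \<in> S ` \<H>" if "f \<in> S ` \<H>" "h \<in> S ` \<H>" for f h
    proof -
      obtain f' h' where fh: "f' \<in> \<H>" "h' \<in> \<H>" "f = S f'" "h = S h'" using \<open>f \<in> S ` \<H>\<close> \<open>h \<in> S ` \<H>\<close> by blast
      have "(\<lambda>x. (f x + h x) / 2) = S (\<lambda>x. (1/2) * (f' x + h' x))"
        unfolding Sscale[OF add_ell2[OF fh(1,2)]] Sadd[OF fh(1,2)] fh(3,4) by auto
      then show ?thesis using fh scale_ell2[OF add_ell2[OF fh(1,2)]] by blast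
    qed
    have sub: "S ` \<H> \<subseteq> \<H>" and ne: "S ` \<H> \<noteq> {}" using SH zero_ell2 by blast+
    define C where "C = S ` \<H>"
    obtain s k where sC: "\<forall>n. s n \<in> C" and s: "converges2 s k"
      and mnC: "\<forall>f\<in>C. nrm (\<lambda>x. k x - g x) \<le> nrm (\<lambda>x. f x - g x)"
      using minimizing_sequence[OF sub ne g mid] unfolding C_def[symmetric] by blast
    have mn: "nrm (\<lambda>x. k x - g x) \<le> nrm (\<lambda>x. S f x - g x)" if "f \<in> \<H>" for f
      using mnC that unfolding C_def by blast
    have "\<exists>l. l \<in> \<H> \<and> s n = S l" for n using sC unfolding C_def by blast
    then obtain h where h: "\<And>n. h n \<in> \<H>" "\<And>n. s n = S (h n)" by metis
    \<comment> \<open>\<open>1 - b\<close> is bounded below, so the preimages of a Cauchy sequence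
      are Cauchy; this places the nearest point in the range.\<close>
    have "nrm (\<lambda>x. h m x - h n x) \<le> nrm (\<lambda>x. s m x - s n x)" for m n
      using le[OF diff_ell2[OF h(1) h(1)], of m n] by (simp add: h Sdiff)
    then have "Cauchy2 h"
      using converges2_Cauchy2[OF s] h(1) unfolding Cauchy2_def by (meson order_le_less_trans)
    then obtain l where l: "converges2 h l" by (rule Cauchy2_converges2)
    have "converges2 (\<lambda>n x. h n x + (- 1) * b (h n) x) (\<lambda>x. l x + (- 1) * b l x)"
      by (rule converges2_add[OF l converges2_scale[OF bop_converges2[OF b(1) l]]])
    moreover have "s = (\<lambda>n x. h n x + (- 1) * b (h n) x)" by (simp add: fun_eq_iff h(2) S_def)
    ultimately have "converges2 s (S l)" by (simp add: S_def)
    then have k: "k = S l" using s converges2_unique by blast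
    have lH: "l \<in> \<H>" using l by (simp add: converges2_def)
    define r where "r = (\<lambda>x. k x - g x)"
    have rH: "r \<in> \<H>" using SH[OF lH] g by (simp add: r_def k)
    have "ip r (S r) = 0"
    proof (rule minimal_orthogonal[OF rH SH[OF rH]])
      fix c
      have "S (\<lambda>x. l x + c * r x) = (\<lambda>x. k x + c * S r x)"
        using Sadd[OF lH scale_ell2[OF rH]] Sscale[OF rH] k by simp
      then have "(\<lambda>x. S (\<lambda>x. l x + c * r x) x - g x) = (\<lambda>x. r x + c * S r x)"
        by (simp add: r_def algebra_simps)
      then show "nrm r \<le> nrm (\<lambda>x. r x + c * S r x)"
        using mn[OF add_ell2[OF lH scale_ell2[OF rH, of c]]] by (simp only: r_def)
    qed
    \<comment> \<open>\<open>ip r r\<close> is real and \<open>ip r (b r)\<close> is imaginary, so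
      the residual vanishes.\<close>
    then have "ip r r = ip r (b r)" using rH b by (simp add: S_def ip_diff_right)
    then have "(nrm r)\<^sup>2 = 0" using re[OF rH] ip_self[OF rH] by (metis Re_complex_of_real)
    then have "r = (\<lambda>_. 0)" using rH by (simp add: nrm_eq_0_iff)
    then have "k = g" unfolding r_def by (metis eq_iff_diff_eq_0 ext)
    then show ?thesis using k lH by blast
  qed
  define c where "c g = (if g \<in> \<H> then SOME l. l \<in> \<H> \<and> S l = g else (\<lambda>_. 0))" for g
  have c: "c g \<in> \<H>" "S (c g) = g" if "g \<in> \<H>" for g
  proof -
    have "\<exists>l. l \<in> \<H> \<and> S l = g" using surj[OF that] by blast
    then show "c g \<in> \<H>" "S (c g) = g" using someI_ex[of "\<lambda>l. l \<in> \<H> \<and> S l = g"] that by (auto simp: c_def)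
  qed
  have cS: "c (S f) = f" if "f \<in> \<H>" for f using c[OF SH[OF that]] inj that by blast
  have ole: "op_le c 1" using le c by (metis op_le_def mult_1 zero_le_one)
  have "c \<in> \<B>"
  proof (rule bopI[OF _ _ _ _ ole])
    fix f g a assume f: "f \<in> \<H>"
    show "c f \<in> \<H>" by (rule c[OF f])
    show "c (\<lambda>x. a * f x) = (\<lambda>x. a * c f x)"
      using cS[OF scale_ell2[OF c(1)[OF f], of a]] Sscale[OF c(1)[OF f]] c(2)[OF f] by simp
    assume g: "g \<in> \<H>"
    show "c (\<lambda>x. f x + g x) = (\<lambda>x. c f x + c g x)"
      using cS[OF add_ell2[OF c(1)[OF f] c(1)[OF g]]] Sadd[OF c(1)[OF f] c(1)[OF g]] c(2)[OF f] c(2)[OF g] by simp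
  qed (simp add: c_def)
  moreover have "(\<lambda>x. c f x - b (c f) x) = f" "c (\<lambda>x. f x - b f x) = f" if "f \<in> \<H>" for f
    using c(2)[OF that] cS[OF that] by (simp_all add: S_def)
  ultimately show ?thesis by (intro bexI[where x=c]) auto
qed

text \<open>The Cayley transform writes a skew-adjoint \<open>b\<close> through the unitary \<open>2 (1 - b)\<^sup>-\<^sup>1 - 1\<close>.\<close>

lemma vna_cayley:
  assumes M: "vna M" and b: "b \<in> M" "adj b = (\<lambda>f x. - b f x)"
  shows "\<exists>c\<in>M. (\<forall>f\<in>\<H>. (\<lambda>x. c f x - b (c f) x) = f) \<and> (\<forall>f\<in>\<H>. c (\<lambda>x. f x - b f x) = f) \<and>
    unitary_op (\<lambda>f x. 2 * c f x + (- 1) * idop f x)"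
proof -
  have bB: "b \<in> \<B>" using M b by (simp add: vna_bop)
  obtain c where c1: "c \<in> \<B>" and c2: "\<forall>f\<in>\<H>. (\<lambda>x. c f x - b (c f) x) = f"
    and c3: "\<forall>f\<in>\<H>. c (\<lambda>x. f x - b f x) = f"
    using skew_resolvent[OF bB b(2)] by (elim bexE conjE)
  note c = c1 bspec[OF c2] bspec[OF c3]
  \<comment> \<open>Whatever commutes with \<open>1 - b\<close> commutes with its inverse.\<close>
  have cM: "c \<in> M"
  proof (rule vnaI_commuting[OF M c(1)])
    fix S f assume S: "S \<in> commutant G M" and f: "f \<in> \<H>"
    have SB: "S \<in> \<B>" using S by (rule commutant_bop)
    have "S f = S (\<lambda>x. c f x - b (c f) x)" using c(2)[OF f] by simp
    also have "\<dots> = (\<lambda>x. S (c f) x - b (S (c f)) x)"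
      using SB c bB commutantD[OF S b(1)] by (simp add: bop_diff)
    finally have "S f = (\<lambda>x. S (c f) x - b (S (c f)) x)" .
    then show "c (S f) = S (c f)" using c(3)[of "S (c f)"] SB c(1) by simp
  qed
  have adjb: "ip f (b g) = - ip (b f) g" if "f \<in> \<H>" "g \<in> \<H>" for f g
    using adj_left[OF bB that] b(2) ip_scale_left[of "-1" "b f" g] by simp
  \<comment> \<open>The resolvent of \<open>- b\<close> inverts \<open>1 + b\<close>; it supplies
    the surjectivity of \<open>u\<close>, which maps \<open>(1 - b) h\<close> to
    \<open>(1 + b) h\<close>.\<close>
  have "adj (\<lambda>f x. - 1 * b f x) = (\<lambda>f x. - 1 * adj b f x)" using adj_smult[OF bB, of "-1"] by simp
  then have "adj (\<lambda>f x. - b f x) = (\<lambda>f x. - (- b f x))" using b(2) by simp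
  moreover have "(\<lambda>f x. - b f x) \<in> \<B>" using bop_smult[OF bB, of "-1"] by simp
  ultimately have "\<exists>d\<in>\<B>. \<forall>f\<in>\<H>. (\<lambda>x. d f x - - b (d f) x) = f"
    using skew_resolvent[of "\<lambda>f x. - b f x"] by blast
  then obtain d where d1: "d \<in> \<B>" and d2: "\<forall>f\<in>\<H>. (\<lambda>x. d f x - - b (d f) x) = f"
    by (elim bexE)
  note d = d1 bspec[OF d2]
  define u where "u = (\<lambda>f x. 2 * c f x + (- 1) * idop f x)"
  have uB: "u \<in> \<B>" unfolding u_def using c(1) by (intro bop_plus bop_smult) auto
  have u: "u (\<lambda>x. h x - b h x) = (\<lambda>x. h x + b h x)" if "h \<in> \<H>" for h
    using that bB by (auto simp: u_def c(3) algebra_simps)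
  have "unitary_op u"
  proof (rule unitaryI[OF uB])
    fix f g assume fg: "f \<in> \<H>" "g \<in> \<H>"
    let ?h = "c f" and ?k = "c g"
    have H: "?h \<in> \<H>" "?k \<in> \<H>" "b ?h \<in> \<H>" "b ?k \<in> \<H>" using c bB by auto
    have "ip (u f) (u g) = ip (\<lambda>x. ?h x + b ?h x) (\<lambda>x. ?k x + b ?k x)"
      using u[OF H(1)] u[OF H(2)] fg by (simp add: c(2))
    also have "\<dots> = ip (\<lambda>x. ?h x - b ?h x) (\<lambda>x. ?k x - b ?k x)"
      using H adjb[OF H(1,2)] by (simp add: ip_add_left ip_add_right ip_diff_left ip_diff_right)
    finally show "ip (u f) (u g) = ip f g" using fg by (simp add: c(2))
  next
    fix k assume k: "k \<in> \<H>"
    have "u (\<lambda>x. d k x - b (d k) x) = k" using u[of "d k"] d(1) d(2)[OF k] by simp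
    then show "\<exists>f\<in>\<H>. u f = k" using d(1) bB by (metis bop_ell2 diff_ell2)
  qed
  then show ?thesis unfolding u_def using cM c2 c3 by (intro bexI[where x=c] conjI)
qed

lemma adj_lin:
  assumes "S \<in> \<B>" "T \<in> \<B>"
  shows "adj (\<lambda>f x. s * S f x + t * T f x) = (\<lambda>f x. cnj s * adj S f x + cnj t * adj T f x)"
  using adj_plus[OF bop_smult[OF assms(1)] bop_smult[OF assms(2)]]
    adj_smult[OF assms(1)] adj_smult[OF assms(2)] by simp

lemma unitary_idop: "unitary_op idop"
  by (auto simp: unitary_op_def adj_scalar intro!: bop_eqI)

text \<open>Stands in for the decomposition of an operator into four unitaries: the Cayley transform
  gives \<open>c = (u + 1) / 2\<close> with \<open>u\<close> unitary, and \<open>1 - b\<close> is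
  the inverse of \<open>c\<close>. Hence linear combinations and inverses reach every skew-adjoint
  element.\<close>

lemma vna_unitary_induct [consumes 2, case_names unitary lin inverse]:
  assumes M: "vna M" and "a \<in> M"
    and unitary: "\<And>u. u \<in> M \<Longrightarrow> unitary_op u \<Longrightarrow> Q u"
    and lin: "\<And>S T s t. S \<in> M \<Longrightarrow> T \<in> M \<Longrightarrow> Q S \<Longrightarrow> Q T \<Longrightarrow> Q (\<lambda>f x. s * S f x + t * T f x)"
    and inverse: "\<And>S T. S \<in> M \<Longrightarrow> T \<in> M \<Longrightarrow> Q S \<Longrightarrow> S \<circ> T = idop \<Longrightarrow> T \<circ> S = idop \<Longrightarrow> Q T"
  shows "Q a"
proof -
  have idM: "idop \<in> M" using M by (rule vna_scalar)
  have Qid: "Q idop" using unitary[OF idM unitary_idop] .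
  have skew: "Q b" if b: "b \<in> M" "adj b = (\<lambda>f x. - b f x)" for b
  proof -
    obtain c where c1: "c \<in> M" and c2: "\<forall>f\<in>\<H>. (\<lambda>x. c f x - b (c f) x) = f"
      and c3: "\<forall>f\<in>\<H>. c (\<lambda>x. f x - b f x) = f"
      and c4: "unitary_op (\<lambda>f x. 2 * c f x + (- 1) * idop f x)"
      using vna_cayley[OF M b] by (elim bexE conjE)
    note c = c1 bspec[OF c2] bspec[OF c3] c4
    have B: "c \<in> \<B>" "b \<in> \<B>" using M c b by (auto simp: vna_bop)
    let ?u = "\<lambda>f x. 2 * c f x + (- 1) * idop f x"
    have uM: "?u \<in> M" by (rule vna_lin[OF M c(1) idM])
    have "Q (\<lambda>f x. (1/2) * ?u f x + (1/2) * idop f x)"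
      by (rule lin[OF uM idM unitary[OF uM c(4)] Qid])
    then have Qc: "Q c" by (simp add: algebra_simps)
    let ?s = "\<lambda>f x. 1 * idop f x + (- 1) * b f x"
    have sM: "?s \<in> M" by (rule vna_lin[OF M idM b(1)])
    have "c \<circ> ?s = idop" "?s \<circ> c = idop"
      using B c vna_bop[OF M sM] by (auto intro!: bop_eqI simp del: mult_1)
    then have "Q ?s" using inverse[OF c(1) sM Qc] by simp
    then have "Q (\<lambda>f x. 1 * idop f x + (- 1) * ?s f x)" by (rule lin[OF idM sM Qid])
    then show ?thesis by simp
  qed
  have aB: "a \<in> \<B>" and a': "adj a \<in> M" using M \<open>a \<in> M\<close> by (auto simp: vna_bop vna_adj)
  \<comment> \<open>Both \<open>?b\<close> and \<open>?d\<close> are skew-adjoint, and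
    \<open>a\<close> is \<open>?b\<close> minus \<open>\<i>\<close> times \<open>?d\<close>.\<close>
  let ?b = "\<lambda>f x. (1/2) * a f x + (-1/2) * adj a f x"
  let ?d = "\<lambda>f x. (\<i>/2) * a f x + (\<i>/2) * adj a f x"
  have bd: "?b \<in> M" "?d \<in> M" by (rule vna_lin[OF M \<open>a \<in> M\<close> a'])+
  have "adj ?b = (\<lambda>f x. - ?b f x)"
    unfolding adj_lin[OF aB adj_bop[OF aB]] adj_adj[OF aB] by (simp add: algebra_simps)
  then have Qb: "Q ?b" by (rule skew[OF bd(1)])
  have "adj ?d = (\<lambda>f x. - ?d f x)"
    unfolding adj_lin[OF aB adj_bop[OF aB]] adj_adj[OF aB] by (simp add: algebra_simps)
  then have Qd: "Q ?d" by (rule skew[OF bd(2)])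
  have "Q (\<lambda>f x. 1 * ?b f x + (- \<i>) * ?d f x)" by (rule lin[OF bd Qb Qd])
  moreover have "(\<lambda>f x. 1 * ?b f x + (- \<i>) * ?d f x) = a" by (auto simp: algebra_simps)
  ultimately show ?thesis by simp
qed

section \<open>Translations and the trace\<close>

text \<open>A common frame for left and right translations: both are composition with a permutation
  of the carrier.\<close>

definition comp_op :: "('a \<Rightarrow> 'a) \<Rightarrow> 'a operator" where
  "comp_op \<pi> = (\<lambda>f. if f \<in> \<H> then (\<lambda>x. if x \<in> carrier G then f (\<pi> x) else 0) else (\<lambda>_. 0))"

lemma comp_op_apply: "f \<in> \<H> \<Longrightarrow> x \<in> carrier G \<Longrightarrow> comp_op \<pi> f x = f (\<pi> x)"
  by (simp add: comp_op_def)

lemma comp_op_unitary: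
  assumes \<pi>: "\<And>x. x \<in> carrier G \<Longrightarrow> \<pi> x \<in> carrier G" "\<And>x. x \<in> carrier G \<Longrightarrow> \<pi>' x \<in> carrier G"
    and inv: "\<And>x. x \<in> carrier G \<Longrightarrow> \<pi> (\<pi>' x) = x" "\<And>x. x \<in> carrier G \<Longrightarrow> \<pi>' (\<pi> x) = x"
  shows "unitary_op (comp_op \<pi>)" and "adj (comp_op \<pi>) = comp_op \<pi>'"
    and "x \<in> carrier G \<Longrightarrow> comp_op \<pi> (delta x) = delta (\<pi>' x)"
proof -
  \<comment> \<open>Stated for arbitrary pairs so that it can be applied again with the two
    bijections exchanged.\<close>
  have main: "comp_op \<pi> \<in> \<B> \<and> (\<forall>f\<in>\<H>. \<forall>g\<in>\<H>. ip (comp_op \<pi> f) (comp_op \<pi> g) = ip f g)"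
    if \<pi>: "\<And>x. x \<in> carrier G \<Longrightarrow> \<pi> x \<in> carrier G" "\<And>x. x \<in> carrier G \<Longrightarrow> \<pi>' x \<in> carrier G"
    and inv: "\<And>x. x \<in> carrier G \<Longrightarrow> \<pi> (\<pi>' x) = x" "\<And>x. x \<in> carrier G \<Longrightarrow> \<pi>' (\<pi> x) = x" for \<pi> \<pi>'
  proof -
    have bij: "bij_betw \<pi> (carrier G) (carrier G)"
      by (rule bij_betw_byWitness[where f'=\<pi>']) (use \<pi> inv in auto)
    have H: "comp_op \<pi> f \<in> \<H>" if "f \<in> \<H>" for f
    proof -
      have "(\<lambda>x. (cmod (comp_op \<pi> f x))\<^sup>2) summable_on carrier G \<longleftrightarrow> (\<lambda>x. (cmod (f (\<pi> x)))\<^sup>2) summable_on carrier G"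
        using that by (intro summable_on_cong) (simp add: comp_op_def)
      also have "\<dots> \<longleftrightarrow> (\<lambda>x. (cmod (f x))\<^sup>2) summable_on carrier G"
        by (rule summable_on_reindex_bij_betw[OF bij])
      finally show ?thesis using that by (auto simp: ell2_def comp_op_def)
    qed
    have ipc: "ip (comp_op \<pi> f) (comp_op \<pi> g) = ip f g" if "f \<in> \<H>" "g \<in> \<H>" for f g
    proof -
      have "ip (comp_op \<pi> f) (comp_op \<pi> g) = (\<Sum>\<^sub>\<infinity>x\<in>carrier G. cnj (f (\<pi> x)) * g (\<pi> x))"
        unfolding ell2_inner_def using that by (intro infsum_cong) (simp add: comp_op_def)
      also have "\<dots> = ip f g"
        unfolding ell2_inner_def by (rule infsum_reindex_bij_betw[OF bij])
      finally show ?thesis .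
    qed
    have "op_le (comp_op \<pi>) 1"
      unfolding op_le_def
    proof (intro conjI ballI)
      fix f assume f: "f \<in> \<H>"
      have "complex_of_real ((nrm (comp_op \<pi> f))\<^sup>2) = of_real ((nrm f)\<^sup>2)"
        using ipc[OF f f] by (simp only: ip_self H f)
      then show "nrm (comp_op \<pi> f) \<le> 1 * nrm f" by (simp only: of_real_eq_iff) simp
    qed simp
    then have "comp_op \<pi> \<in> \<B>"
      by (rule bopI[rotated -1]) (use H in \<open>auto simp: comp_op_def fun_eq_iff\<close>)
    then show ?thesis using ipc by blast
  qed
  note m = main[of \<pi> \<pi>', OF assms]
  note m' = main[of \<pi>' \<pi>, OF assms(2,1,4,3)]
  have comp: "comp_op \<pi> (comp_op \<pi>' f) = f" if "f \<in> \<H>" for f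
    by (rule ell2_eqI) (use m m' that inv \<pi> in \<open>simp_all add: comp_op_apply\<close>)
  show u: "unitary_op (comp_op \<pi>)"
    using m m' comp by (intro unitaryI) (auto, metis bop_ell2)
  show "adj (comp_op \<pi>) = comp_op \<pi>'"
  proof (rule adj_unique)
    show "comp_op \<pi>' \<in> \<B>" using m' by blast
    fix f g assume fg: "f \<in> \<H>" "g \<in> \<H>"
    have "ip (comp_op \<pi> (comp_op \<pi>' f)) (comp_op \<pi> g) = ip (comp_op \<pi>' f) g"
      using m m' fg by simp
    then show "ip (comp_op \<pi>' f) g = ip f (comp_op \<pi> g)" using comp fg by simp
  qed
  assume x: "x \<in> carrier G"
  show "comp_op \<pi> (delta x) = delta (\<pi>' x)"
  proof (rule ell2_eqI)
    show "comp_op \<pi> (delta x) \<in> \<H>" using m by simp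
    fix y assume "y \<in> carrier G"
    then show "comp_op \<pi> (delta x) y = delta (\<pi>' x) y"
      using x \<pi> inv by (auto simp: comp_op_apply) (auto simp: delta_def)
  qed simp
qed

abbreviation "\<L> \<equiv> left_translation G"

definition "\<rho> g = comp_op (\<lambda>x. x \<otimes> g)"

lemma left_translation_comp_op: "\<L> g = comp_op (\<lambda>x. inv g \<otimes> x)"
  by (simp add: left_translation_def comp_op_def)

lemma
  assumes g: "g \<in> carrier G"
  shows lam_unitary [simp]: "unitary_op (\<L> g)"
    and lam_adj: "adj (\<L> g) = \<L> (inv g)"
    and lam_delta: "x \<in> carrier G \<Longrightarrow> \<L> g (delta x) = delta (g \<otimes> x)"
proof -
  note c = comp_op_unitary[of "\<lambda>x. inv g \<otimes> x" "\<lambda>x. g \<otimes> x"]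
  have "inv g \<otimes> (g \<otimes> x) = x" "g \<otimes> (inv g \<otimes> x) = x" if "x \<in> carrier G" for x
    using g that by (simp_all flip: m_assoc)
  then show "unitary_op (\<L> g)" "adj (\<L> g) = \<L> (inv g)"
    "x \<in> carrier G \<Longrightarrow> \<L> g (delta x) = delta (g \<otimes> x)"
    unfolding left_translation_comp_op using c g by simp_all
qed

lemma
  assumes g: "g \<in> carrier G"
  shows rho_unitary: "unitary_op (\<rho> g)"
    and rho_adj: "adj (\<rho> g) = \<rho> (inv g)"
    and rho_delta: "x \<in> carrier G \<Longrightarrow> \<rho> g (delta x) = delta (x \<otimes> inv g)"
proof -
  note c = comp_op_unitary[of "\<lambda>x. x \<otimes> g" "\<lambda>x. x \<otimes> inv g"]
  have "x \<otimes> g \<otimes> inv g = x" "x \<otimes> inv g \<otimes> g = x" if "x \<in> carrier G" for x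
    using g that by (simp_all add: m_assoc)
  then show "unitary_op (\<rho> g)" "adj (\<rho> g) = \<rho> (inv g)"
    "x \<in> carrier G \<Longrightarrow> \<rho> g (delta x) = delta (x \<otimes> inv g)"
    unfolding \<rho>_def using c g by simp_all
qed

lemma lam_bop [simp]: "g \<in> carrier G \<Longrightarrow> \<L> g \<in> \<B>"
  by (simp add: unitary_bop)

lemma rho_bop [simp]: "g \<in> carrier G \<Longrightarrow> \<rho> g \<in> \<B>"
  using rho_unitary by (rule unitary_bop)

lemma lam_apply: "f \<in> \<H> \<Longrightarrow> x \<in> carrier G \<Longrightarrow> \<L> g f x = f (inv g \<otimes> x)"
  by (simp add: left_translation_def)

lemma rho_apply: "f \<in> \<H> \<Longrightarrow> x \<in> carrier G \<Longrightarrow> \<rho> g f x = f (x \<otimes> g)"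
  by (simp add: \<rho>_def comp_op_def)

lemma lam_comp:
  assumes "g \<in> carrier G" "h \<in> carrier G" shows "\<L> g \<circ> \<L> h = \<L> (g \<otimes> h)"
  by (rule bop_eqI_delta) (use assms in \<open>auto simp: lam_delta m_assoc\<close>)

lemma lam_mult: "g \<in> carrier G \<Longrightarrow> h \<in> carrier G \<Longrightarrow> \<L> g (\<L> h f) = \<L> (g \<otimes> h) f"
  using lam_comp[of g h] by (metis comp_apply)

lemma lam_one: "\<L> \<one> = idop"
  by (rule bop_eqI_delta) (auto simp: lam_delta)

lemma lam_inv_cancel [simp]:
  assumes "g \<in> carrier G" "f \<in> \<H>"
  shows "\<L> g (\<L> (inv g) f) = f" "\<L> (inv g) (\<L> g f) = f"
  using assms by (simp_all add: lam_mult lam_one)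

text \<open>\<open>\<R>\<close> contains \<open>L(G)\<close>, which is all that is needed of the equality between the two.\<close>

definition "\<R> = commutant G (\<rho> ` carrier G)"

lemma R_vna: "vna \<R>"
  unfolding \<R>_def by (rule commutant_vna) (auto simp: rho_adj)

lemma R_bop [simp]: "x \<in> \<R> \<Longrightarrow> x \<in> \<B>"
  using R_vna by (rule vna_bop)

lemma lam_R [simp]:
  assumes g: "g \<in> carrier G" shows "\<L> g \<in> \<R>"
  unfolding \<R>_def
proof (rule commutantI)
  fix S f assume "S \<in> \<rho> ` carrier G" and f: "f \<in> \<H>"
  then obtain h where h: "h \<in> carrier G" "S = \<rho> h" by blast
  show "\<L> g (S f) = S (\<L> g f)"
    by (rule ell2_eqI) (use g h f in \<open>simp_all add: lam_apply rho_apply m_assoc\<close>)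
qed (use g in auto)

lemma group_vna_subset:
  assumes "vna M" "\<L> ` H \<subseteq> M" shows "group_vna G H \<subseteq> M"
  using assms by (auto simp: group_vna_def vna_generated_def)

lemma group_vna_R: "group_vna G (carrier G) \<subseteq> \<R>"
  by (rule group_vna_subset) (auto simp: R_vna)

text \<open>The Fourier coefficients of an element of \<R>: \<open>hat x g\<close> is the
  coefficient at \<open>\<L> g\<close>.\<close>

abbreviation "hat x \<equiv> x (delta \<one>)"

definition \<tau> :: "'a operator \<Rightarrow> complex" where "\<tau> x = hat x \<one>"

text \<open>Commuting with right translations makes a matrix entry depend only on
  \<open>y \<otimes> inv z\<close>, so elements of \<R> act by convolution with their
  coefficients.\<close>

lemma R_delta:
  assumes "x \<in> \<R>" "z \<in> carrier G" "y \<in> carrier G"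
  shows "x (delta z) y = hat x (y \<otimes> inv z)"
proof -
  have "x (delta z) = x (\<rho> (inv z) (delta \<one>))" using assms by (simp add: rho_delta)
  also have "\<dots> = \<rho> (inv z) (hat x)"
    using assms commutantD[of x "\<rho> ` carrier G"] by (simp add: \<R>_def)
  finally show ?thesis using assms by (simp add: rho_apply)
qed

lemma R_apply:
  assumes "x \<in> \<R>" "f \<in> \<H>" "y \<in> carrier G"
  shows "x f y = (\<Sum>\<^sub>\<infinity>z\<in>carrier G. hat x (y \<otimes> inv z) * f z)"
  unfolding bop_apply[OF R_bop[OF assms(1)] assms(2,3)]
  by (rule infsum_cong) (simp only: R_delta[OF assms(1) _ assms(3)])

lemma R_eqI:
  assumes "x \<in> \<R>" "y \<in> \<R>" "\<And>g. g \<in> carrier G \<Longrightarrow> hat x g = hat y g" shows "x = y"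
proof (rule bop_eqI_delta)
  fix z g assume "z \<in> carrier G" "g \<in> carrier G"
  then show "x (delta z) g = y (delta z) g"
    using R_delta[OF assms(1), of z g] R_delta[OF assms(2), of z g] assms(3)[of "g \<otimes> inv z"] by simp
qed (use assms in auto)

lemma hat_adj:
  assumes "x \<in> \<R>" "y \<in> carrier G" shows "hat (adj x) y = cnj (hat x (inv y))"
proof -
  have "hat (adj x) y = ip (delta y) (hat (adj x))" using assms by simp
  also have "\<dots> = ip (x (delta y)) (delta \<one>)"
    using assms by (simp only: adj_right[OF R_bop[OF assms(1)]] delta_ell2)
  also have "\<dots> = cnj (hat x (inv y))" using assms R_delta[OF assms(1), of y \<one>] by simp
  finally show ?thesis .
qed

lemma R_adj [simp]: "x \<in> \<R> \<Longrightarrow> adj x \<in> \<R>"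
  using R_vna by (rule vna_adj)

lemma R_comp [simp]: "x \<in> \<R> \<Longrightarrow> y \<in> \<R> \<Longrightarrow> x \<circ> y \<in> \<R>"
  using R_vna by (rule vna_comp)

text \<open>Adjoints conjugate and invert the coefficients; reindexing the sum by inversion gives
  this identity, which is the trace property in disguise.\<close>

lemma ip_hat_adj:
  assumes "x \<in> \<R>" "y \<in> \<R>"
  shows "ip (hat (adj x)) (hat (adj y)) = ip (hat y) (hat x)"
proof -
  have bij: "bij_betw (\<lambda>g. inv g) (carrier G) (carrier G)"
    by (rule bij_betw_byWitness[where f'="\<lambda>g. inv g"]) auto
  have "ip (hat (adj x)) (hat (adj y)) = (\<Sum>\<^sub>\<infinity>g\<in>carrier G. cnj (hat y (inv g)) * hat x (inv g))"
    unfolding ell2_inner_def using assms by (intro infsum_cong) (simp add: hat_adj)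
  also have "\<dots> = ip (hat y) (hat x)"
    unfolding ell2_inner_def by (rule infsum_reindex_bij_betw[OF bij])
  finally show ?thesis .
qed

lemma nrm_hat_adj:
  assumes "x \<in> \<R>" shows "nrm (hat (adj x)) = nrm (hat x)"
proof -
  have "complex_of_real ((nrm (hat (adj x)))\<^sup>2) = of_real ((nrm (hat x))\<^sup>2)"
    using ip_hat_adj[OF assms assms] assms by (simp only: ip_self bop_ell2 R_bop R_adj)
  then show ?thesis by (simp only: of_real_eq_iff) simp
qed

lemma tau_ip: "\<tau> x = ip (delta \<one>) (hat x)"
  by (simp add: \<tau>_def)

lemma tau_comp: "x \<in> \<R> \<Longrightarrow> \<tau> (x \<circ> y) = ip (hat (adj x)) (hat y)" if "y \<in> \<R>"
  using that by (simp add: tau_ip adj_left del: ip_delta_left)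

lemma tau_commute:
  assumes "x \<in> \<R>" "y \<in> \<R>" shows "\<tau> (x \<circ> y) = \<tau> (y \<circ> x)"
  using ip_hat_adj[of x "adj y"] assms by (simp add: tau_comp)

lemma tau_lam: "g \<in> carrier G \<Longrightarrow> \<tau> (\<L> g) = (if g = \<one> then 1 else 0)"
  by (simp add: \<tau>_def lam_delta) (simp add: delta_def)

text \<open>An element with coefficients supported in \<open>H\<close> commutes with everything that
  commutes with the translations by \<open>H\<close>. This is checked on matrix entries, where only
  scalar sums have to be reindexed.\<close>

lemma group_vna_eqI:
  assumes H: "H \<subseteq> carrier G" and P: "vna P" "P \<subseteq> \<R>" "\<And>h. h \<in> H \<Longrightarrow> \<L> h \<in> P"
    and supp: "\<And>x g. x \<in> P \<Longrightarrow> g \<in> carrier G \<Longrightarrow> hat x g \<noteq> 0 \<Longrightarrow> g \<in> H"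
  shows "P = group_vna G H"
proof
  show "group_vna G H \<subseteq> P" by (rule group_vna_subset) (use P in auto)
  show "P \<subseteq> group_vna G H"
    unfolding group_vna_def vna_generated_def
  proof (intro subsetI InterI, safe)
    fix x M assume x: "x \<in> P" and M: "vna M" "\<L> ` H \<subseteq> M"
    have xR: "x \<in> \<R>" using x P by blast
    show "x \<in> M"
    proof (rule vnaI_commuting[OF M(1)])
      show xB: "x \<in> \<B>" using xR by simp
      fix S f assume S: "S \<in> commutant G M"
      have SB: "S \<in> \<B>" using S by (rule commutant_bop)
      have "x \<circ> S = S \<circ> x"
      proof (rule bop_eqI_delta)
        fix a y assume a: "a \<in> carrier G" and y: "y \<in> carrier G"
        \<comment> \<open>The contribution of the coefficient at \<open>h\<close> to a matrix entry;
          for both products the entry is the sum of these over the group.\<close>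
        let ?t = "\<lambda>h. hat x h * S (delta a) (inv h \<otimes> y)"
        have bij1: "bij_betw (\<lambda>z. y \<otimes> inv z) (carrier G) (carrier G)"
          by (rule bij_betw_byWitness[where f'="\<lambda>h. inv h \<otimes> y"])
             (use y in \<open>auto simp: inv_mult_group m_assoc\<close>, auto simp flip: m_assoc)
        have bij2: "bij_betw (\<lambda>z. z \<otimes> inv a) (carrier G) (carrier G)"
          by (rule bij_betw_byWitness[where f'="\<lambda>h. h \<otimes> a"]) (use a in \<open>auto simp: m_assoc\<close>)
        have "x (S (delta a)) y = (\<Sum>\<^sub>\<infinity>z\<in>carrier G. ?t (y \<otimes> inv z))"
          unfolding R_apply[OF xR bop_ell2[OF SB] y]
          by (rule infsum_cong) (simp add: y inv_mult_group m_assoc)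
        also have "\<dots> = infsum ?t (carrier G)" by (rule infsum_reindex_bij_betw[OF bij1])
        also have "\<dots> = (\<Sum>\<^sub>\<infinity>z\<in>carrier G. ?t (z \<otimes> inv a))"
          by (rule infsum_reindex_bij_betw[OF bij2, symmetric])
        also have "\<dots> = S (x (delta a)) y"
          unfolding bop_apply[OF SB bop_ell2[OF xB] y]
        proof (rule infsum_cong)
          fix z assume z: "z \<in> carrier G"
          define h where "h = z \<otimes> inv a"
          have h: "h \<in> carrier G" "z = h \<otimes> a" using z a by (auto simp: h_def m_assoc)
          have xz: "x (delta a) z = hat x h" using R_delta[OF xR a z] by (simp add: h_def)
          show "?t (z \<otimes> inv a) = S (delta z) y * x (delta a) z"
          proof (cases "hat x h = 0")
            case False
            then have "\<L> h \<in> M" using supp[OF x h(1)] M by blast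
            then have "S (\<L> h (delta a)) = \<L> h (S (delta a))" by (rule commutantD[OF S])
            then have "S (delta z) y = S (delta a) (inv h \<otimes> y)"
              using h a y SB by (simp add: lam_delta lam_apply)
            then show ?thesis unfolding xz by (simp add: h_def)
          qed (simp add: xz flip: h_def)
        qed
        finally show "(x \<circ> S) (delta a) y = (S \<circ> x) (delta a) y" by simp
      qed (use SB xB in auto)
      then show "x (S f) = S (x f)" by (metis comp_apply)
    qed
  qed
qed

section \<open>The conditional expectation onto an invariant subfactor\<close>

lemma op_le_mono: "op_le T C \<Longrightarrow> C \<le> D \<Longrightarrow> op_le T D"
  unfolding op_le_def by (meson mult_right_mono nrm_nonneg order_trans)

text \<open>Convexity of the norm passes from small to all perturbations. In an operator-norm ball
  only small perturbations of an interior point are admissible.\<close>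

lemma minimal_orthogonal_local:
  assumes r: "r \<in> \<H>" and v: "v \<in> \<H>" and "e > 0"
    and min: "\<And>c. cmod c \<le> e \<Longrightarrow> nrm r \<le> nrm (\<lambda>x. r x + c * v x)"
  shows "ip r v = 0"
proof (rule minimal_orthogonal[OF r v])
  fix c
  \<comment> \<open>With this \<open>t\<close> the perturbation by \<open>t * c\<close> is small
    enough, and it yields a convex combination of \<open>r\<close> and the vector perturbed by
    \<open>c\<close>.\<close>
  define t where "t = e / (cmod c + e)"
  have t: "0 < t" "t \<le> 1" "t * cmod c \<le> e"
    using \<open>e > 0\<close> by (auto simp: t_def field_simps add_pos_nonneg add_nonneg_pos)
  let ?s = "\<lambda>x. r x + c * v x"
  have "nrm r \<le> nrm (\<lambda>x. r x + (of_real t * c) * v x)"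
    using t by (intro min) (simp add: norm_mult)
  also have "(\<lambda>x. r x + (of_real t * c) * v x) = (\<lambda>x. of_real (1 - t) * r x + of_real t * ?s x)"
    by (auto simp: algebra_simps)
  also have "nrm \<dots> \<le> (1 - t) * nrm r + t * nrm ?s"
    using t r v nrm_triangle[of "\<lambda>x. of_real (1 - t) * r x" "\<lambda>x. of_real t * ?s x"]
    by (simp add: nrm_scale del: of_real_diff)
  finally have "t * nrm r \<le> t * nrm ?s" by (simp add: algebra_simps)
  then show "nrm r \<le> nrm ?s" using t by simp
qed

text \<open>Right translations carry \<open>delta \<one>\<close> to every basis vector and commute
  with \<open>t n\<close>, so under a common bound convergence at one vector spreads to the whole
  space.\<close>

lemma R_strong_limit:
  assumes t: "\<And>n. t n \<in> \<R>" "\<And>n. op_le (t n) C" and k: "converges2 (\<lambda>n. hat (t n)) k"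
  shows "\<exists>T\<in>\<B>. op_le T C \<and> hat T = k \<and> (\<forall>f\<in>\<H>. converges2 (\<lambda>n. t n f) (T f))"
proof -
  have tB: "t n \<in> \<B>" for n using t by simp
  have "\<exists>k. converges2 (\<lambda>n. t n (delta x)) k" if x: "x \<in> carrier G" for x
  proof -
    have "t n (delta x) = \<rho> (inv x) (hat (t n))" for n
      using t(1)[of n] x commutantD[of "t n" "\<rho> ` carrier G" "\<rho> (inv x)" "delta \<one>"]
      by (simp add: \<R>_def rho_delta)
    moreover have "converges2 (\<lambda>n. \<rho> (inv x) (hat (t n))) (\<rho> (inv x) k)"
      using x by (intro bop_converges2[OF _ k]) simp
    ultimately show ?thesis by auto
  qed
  then have conv: "\<exists>k. converges2 (\<lambda>n. t n f) k" if "f \<in> \<H>" for f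
    by (rule converges2_from_delta[OF tB t(2) _ that])
  obtain T where T: "T \<in> \<B>" "op_le T C" "\<forall>f\<in>\<H>. converges2 (\<lambda>n. t n f) (T f)"
    using strong_limit[OF tB t(2) conv] by blast
  then show ?thesis using converges2_unique[OF bspec[OF T(3) delta_ell2] k] by blast
qed

lemma midpoint_vna:
  assumes "vna P" "p \<in> P" "q \<in> P" "op_le p C" "op_le q C"
  shows "(\<lambda>f x. (1/2) * p f x + (1/2) * q f x) \<in> P"
    "op_le (\<lambda>f x. (1/2) * p f x + (1/2) * q f x) C"
proof -
  show "(\<lambda>f x. (1/2) * p f x + (1/2) * q f x) \<in> P" by (rule vna_lin[OF assms(1-3)])
  have B: "p \<in> \<B>" "q \<in> \<B>" using assms by (auto simp: vna_bop)
  have "op_le (\<lambda>f x. (1/2) * p f x + (1/2) * q f x) (cmod (1/2) * C + cmod (1/2) * C)"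
    by (intro op_le_add op_le_scale bop_smult B assms)
  then show "op_le (\<lambda>f x. (1/2) * p f x + (1/2) * q f x) C" by simp
qed

text \<open>The common norm bound is what lifts the limit of the minimizing vectors back to an
  operator, which lies in \<open>P\<close> by strong closedness.\<close>

lemma ball_minimizer:
  assumes P: "vna P" "P \<subseteq> \<R>" and v: "v \<in> \<H>" and "0 \<le> C"
  shows "\<exists>p\<in>P. op_le p C \<and> (\<forall>q\<in>P. op_le q C \<longrightarrow> nrm (\<lambda>x. hat p x - v x) \<le> nrm (\<lambda>x. hat q x - v x))"
proof -
  define K where "K = (\<lambda>p. hat p) ` {p \<in> P. op_le p C}"
  have "scalar_op G 0 \<in> P" "op_le (scalar_op G 0) C"
    using vna_scalar[OF P(1)] op_le_mono[OF op_le_scalar_op, of 0 C] \<open>0 \<le> C\<close> by auto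
  then have ne: "K \<noteq> {}" by (auto simp: K_def)
  have sub: "K \<subseteq> \<H>" using P by (auto simp: K_def)
  have mid: "(\<lambda>x. (f x + h x) / 2) \<in> K" if fh: "f \<in> K" "h \<in> K" for f h
  proof -
    obtain p q where pq: "p \<in> P" "q \<in> P" "op_le p C" "op_le q C" "f = hat p" "h = hat q"
      using fh by (auto simp: K_def)
    have "(\<lambda>f x. (1/2) * p f x + (1/2) * q f x) \<in> {p \<in> P. op_le p C}"
      using midpoint_vna[OF P(1) pq(1-4)] by blast
    from imageI[OF this, of "\<lambda>p. hat p"] show ?thesis by (simp add: K_def pq add_divide_distrib)
  qed
  obtain s k where s: "\<forall>n. s n \<in> K" and k: "converges2 s k"
    and min: "\<forall>f\<in>K. nrm (\<lambda>x. k x - v x) \<le> nrm (\<lambda>x. f x - v x)"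
    using minimizing_sequence[OF sub ne v mid] by blast
  have "\<exists>p. p \<in> P \<and> op_le p C \<and> s n = hat p" for n using s unfolding K_def by blast
  then obtain t where t: "\<And>n. t n \<in> P" "\<And>n. op_le (t n) C" "\<And>n. s n = hat (t n)" by metis
  have tR: "t n \<in> \<R>" for n using t P by blast
  have sk: "converges2 (\<lambda>n. hat (t n)) k" using k t(3) by (simp add: fun_eq_iff[of s, symmetric] flip: t(3))
  obtain T where T: "T \<in> \<B>" "op_le T C" "hat T = k" "\<forall>f\<in>\<H>. converges2 (\<lambda>n. t n f) (T f)"
    using R_strong_limit[OF tR t(2) sk] by blast
  have "T \<in> P" by (rule vna_limit[where t=t, OF P(1) T(1) t(1)]) (use T(4) in blast)
  moreover have "nrm (\<lambda>x. hat T x - v x) \<le> nrm (\<lambda>x. hat q x - v x)" if "q \<in> P" "op_le q C" for q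
    using min that unfolding T(3) K_def by blast
  ultimately show ?thesis using T(2) by blast
qed

text \<open>Distinct minimizers would have a strictly closer midpoint in the ball, and elements of
  \<R> are determined by their coefficients.\<close>

lemma ball_minimizer_unique:
  assumes P: "vna P" "P \<subseteq> \<R>" and v: "v \<in> \<H>"
    and pq: "p \<in> P" "op_le p C" "q \<in> P" "op_le q C"
    and min: "\<forall>q\<in>P. op_le q C \<longrightarrow> nrm (\<lambda>x. hat p x - v x) \<le> nrm (\<lambda>x. hat q x - v x)"
    and eq: "nrm (\<lambda>x. hat q x - v x) = nrm (\<lambda>x. hat p x - v x)"
  shows "q = p"
proof -
  have R: "p \<in> \<R>" "q \<in> \<R>" using P pq by auto
  let ?a = "\<lambda>x. hat p x - v x" and ?b = "\<lambda>x. hat q x - v x"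
  let ?m = "\<lambda>f x. (1/2) * p f x + (1/2) * q f x"
  have "nrm ?a \<le> nrm (\<lambda>x. hat ?m x - v x)"
    using min midpoint_vna[OF P(1) pq(1,3,2,4)] by blast
  then have "4 * (nrm ?a)\<^sup>2 \<le> 4 * (nrm (\<lambda>x. hat ?m x - v x))\<^sup>2"
    by (simp add: power_mono)
  also have "\<dots> = (nrm (\<lambda>x. 2 * (hat ?m x - v x)))\<^sup>2"
    by (simp only: nrm_scale power_mult_distrib) simp
  also have "(\<lambda>x. 2 * (hat ?m x - v x)) = (\<lambda>x. ?a x + ?b x)" by (auto simp: algebra_simps)
  finally have "4 * (nrm ?a)\<^sup>2 \<le> (nrm (\<lambda>x. ?a x + ?b x))\<^sup>2" .
  moreover have "(nrm (\<lambda>x. ?a x - ?b x))\<^sup>2 + (nrm (\<lambda>x. ?a x + ?b x))\<^sup>2 = 2 * (nrm ?a)\<^sup>2 + 2 * (nrm ?b)\<^sup>2"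
    using R v by (intro parallelogram) auto
  ultimately have "(nrm (\<lambda>x. ?a x - ?b x))\<^sup>2 \<le> 0" unfolding eq by linarith
  then have "nrm (\<lambda>x. hat p x - hat q x) = 0" by simp
  then have "(\<lambda>x. hat p x - hat q x) = (\<lambda>_. 0)" using R nrm_eq_0_iff[of "\<lambda>x. hat p x - hat q x"] by simp
  then have "hat p x = hat q x" for x by (metis eq_iff_diff_eq_0)
  then show ?thesis using R_eqI[OF R] by simp
qed

section \<open>Conjugation by unitaries\<close>

definition Ad :: "'a operator \<Rightarrow> 'a operator \<Rightarrow> 'a operator" where
  "Ad u x = u \<circ> x \<circ> adj u"

lemma Ad_apply: "Ad u x f = u (x (adj u f))"
  by (simp add: Ad_def)

lemma Ad_bop [simp]: "u \<in> \<B> \<Longrightarrow> x \<in> \<B> \<Longrightarrow> Ad u x \<in> \<B>"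
  by (simp add: Ad_def)

lemma Ad_lin:
  assumes "u \<in> \<B>" "S \<in> \<B>" "T \<in> \<B>"
  shows "Ad u (\<lambda>f x. s * S f x + t * T f x) = (\<lambda>f x. s * Ad u S f x + t * Ad u T f x)"
proof (rule ext)
  fix f
  have "Ad u (\<lambda>f x. s * S f x + t * T f x) f = u (\<lambda>x. s * S (adj u f) x + t * T (adj u f) x)"
    by (simp add: Ad_apply)
  also have "\<dots> = (\<lambda>x. s * Ad u S f x + t * Ad u T f x)"
    using bop_add[OF assms(1), of "\<lambda>x. s * S (adj u f) x" "\<lambda>x. t * T (adj u f) x"] assms
    by (simp add: bop_scale Ad_apply)
  finally show "Ad u (\<lambda>f x. s * S f x + t * T f x) f = (\<lambda>x. s * Ad u S f x + t * Ad u T f x)" .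
qed

lemma Ad_comp:
  assumes "unitary_op u" "S \<in> \<B>" "T \<in> \<B>" shows "Ad u (S \<circ> T) = Ad u S \<circ> Ad u T"
  by (rule bop_eqI) (use assms unitary_bop[of u] in \<open>auto simp: Ad_apply\<close>)

lemma Ad_idop: "unitary_op u \<Longrightarrow> Ad u idop = idop"
  by (rule bop_eqI) (auto simp: Ad_apply unitary_bop)

lemma adj_Ad: "u \<in> \<B> \<Longrightarrow> x \<in> \<B> \<Longrightarrow> adj (Ad u x) = Ad u (adj x)"
  by (simp add: Ad_def adj_comp comp_assoc)

lemma Ad_unitary:
  assumes "unitary_op u" "unitary_op x" shows "unitary_op (Ad u x)"
  unfolding Ad_def by (intro unitary_comp unitary_adj assms)

lemma Ad_lam_apply: "g \<in> carrier G \<Longrightarrow> Ad (\<L> g) x f = \<L> g (x (\<L> (inv g) f))"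
  by (simp add: Ad_apply lam_adj)

lemma Ad_lam_lam:
  assumes "g \<in> carrier G" "h \<in> carrier G" "x \<in> \<B>"
  shows "Ad (\<L> g) (Ad (\<L> h) x) = Ad (\<L> (g \<otimes> h)) x"
  by (rule bop_eqI) (use assms in \<open>auto simp: Ad_lam_apply lam_mult inv_mult_group\<close>)

lemma Ad_lam_one: "x \<in> \<B> \<Longrightarrow> Ad (\<L> \<one>) x = x"
  by (rule bop_eqI) (auto simp: Ad_apply lam_one adj_scalar)

lemma Ad_lam_of_lam:
  assumes "g \<in> carrier G" "h \<in> carrier G" shows "Ad (\<L> g) (\<L> h) = \<L> (g \<otimes> h \<otimes> inv g)"
  by (rule bop_eqI) (use assms in \<open>auto simp: Ad_lam_apply lam_mult m_assoc\<close>)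

lemma Ad_R: "u \<in> \<R> \<Longrightarrow> x \<in> \<R> \<Longrightarrow> Ad u x \<in> \<R>"
  by (simp add: Ad_def)

lemma tau_Ad:
  assumes "unitary_op u" "u \<in> \<R>" "x \<in> \<R>" shows "\<tau> (Ad u x) = \<tau> x"
proof -
  have "\<tau> (Ad u x) = \<tau> (adj u \<circ> (u \<circ> x))"
    unfolding Ad_def using assms by (intro tau_commute) auto
  also have "adj u \<circ> (u \<circ> x) = x" by (rule bop_eqI) (use assms in auto)
  finally show ?thesis .
qed

lemma tau_idop: "\<tau> idop = 1"
  by (simp add: \<tau>_def) (simp add: delta_def)

lemma tau_adj: "x \<in> \<R> \<Longrightarrow> \<tau> (adj x) = cnj (\<tau> x)"
  by (simp add: \<tau>_def hat_adj)

lemma tau_smult: "\<tau> (\<lambda>f x. c * T f x) = c * \<tau> T"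
  by (simp add: \<tau>_def)

lemma invariant_subalgebraD:
  assumes "invariant_subalgebra G P"
  shows "vna P" "P \<subseteq> \<R>" "g \<in> carrier G \<Longrightarrow> x \<in> P \<Longrightarrow> Ad (\<L> g) x \<in> P"
  using assms group_vna_R unfolding invariant_subalgebra_def Ad_def by blast+

end

text \<open>Triviality of the center is stated as an inclusion so that subfactors and subalgebras
  whose center is computed later are both instances.\<close>

locale invariant_factor = group +
  fixes P
  assumes inv: "invariant_subalgebra G P"
    and scalar_center: "P \<inter> commutant G P \<subseteq> range (scalar_op G)"
begin

lemmas P_vna = invariant_subalgebraD(1)[OF inv]
  and P_R = invariant_subalgebraD(2)[OF inv]
  and P_Ad [simp] = invariant_subalgebraD(3)[OF inv]

lemma P_in_R [simp]: "x \<in> P \<Longrightarrow> x \<in> \<R>"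
  using P_R by blast

lemma P_bop [simp]: "x \<in> P \<Longrightarrow> x \<in> \<B>"
  using P_vna by (rule vna_bop)

lemma P_adj [simp]: "x \<in> P \<Longrightarrow> adj x \<in> P"
  using P_vna by (rule vna_adj)

lemma P_comp [simp]: "x \<in> P \<Longrightarrow> y \<in> P \<Longrightarrow> x \<circ> y \<in> P"
  using P_vna by (rule vna_comp)

text \<open>The relation that the expectation of \<open>\<L> g\<close> inherits from
  \<open>\<L> g\<close> itself.\<close>

definition twisted :: "'a \<Rightarrow> 'a operator \<Rightarrow> bool" where
  "twisted g p \<longleftrightarrow> p \<in> P \<and> (\<forall>x\<in>P. p \<circ> x = Ad (\<L> g) x \<circ> p)"

lemma twistedD: "twisted g p \<Longrightarrow> x \<in> P \<Longrightarrow> p (x f) = Ad (\<L> g) x (p f)"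
  unfolding twisted_def by (metis comp_apply)

lemma twisted_P [simp]: "twisted g p \<Longrightarrow> p \<in> P"
  by (simp add: twisted_def)

lemma twistedI:
  assumes "p \<in> P" "g \<in> carrier G" "\<And>x f. x \<in> P \<Longrightarrow> f \<in> \<H> \<Longrightarrow> p (x f) = Ad (\<L> g) x (p f)"
  shows "twisted g p"
  unfolding twisted_def using assms by (auto intro!: bop_eqI)

lemma twisted_adj:
  assumes "g \<in> carrier G" "twisted g p" "x \<in> P"
  shows "adj p (Ad (\<L> g) x f) = x (adj p f)"
proof -
  have p: "p \<in> P" using assms by simp
  have "p \<circ> adj x = Ad (\<L> g) (adj x) \<circ> p"
    using assms(2) P_adj[OF assms(3)] unfolding twisted_def by blast
  then have "adj (p \<circ> adj x) = adj (Ad (\<L> g) (adj x) \<circ> p)" by (rule arg_cong)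
  then have "x \<circ> adj p = adj p \<circ> Ad (\<L> g) x"
    using p assms by (simp add: adj_comp adj_Ad)
  then show ?thesis by (metis comp_apply)
qed

text \<open>The two twists cancel: \<open>adj p \<circ> q\<close> commutes with \<open>P\<close> and
  lies in it, so it is central.\<close>

lemma scalar_of_twisted:
  assumes g: "g \<in> carrier G" and p: "twisted g p" "twisted g q"
  shows "\<exists>c. adj p \<circ> q = scalar_op G c"
proof -
  have "adj p \<circ> q \<in> commutant G P"
    by (rule commutantI) (use g p in \<open>auto simp: twistedD twisted_adj\<close>)
  moreover have "adj p \<circ> q \<in> P" using p by simp
  ultimately show ?thesis using scalar_center by blast
qed

lemma scalar_of_twisted':
  assumes g: "g \<in> carrier G" and p: "twisted g p" "twisted g q"
  shows "\<exists>c. p \<circ> adj q = scalar_op G c"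
proof -
  have "p \<circ> adj q \<in> commutant G P"
  proof (rule commutantI)
    fix S f assume S: "S \<in> P" and f: "f \<in> \<H>"
    define x where "x = Ad (\<L> (inv g)) S"
    have x: "x \<in> P" "Ad (\<L> g) x = S"
      using S g by (simp_all add: x_def Ad_lam_lam Ad_lam_one)
    show "(p \<circ> adj q) (S f) = S ((p \<circ> adj q) f)"
      using twisted_adj[OF g p(2) x(1), of f] twistedD[OF p(1) x(1), of "adj q f"] by (simp add: x(2))
  qed (use p in auto)
  moreover have "p \<circ> adj q \<in> P" using p by simp
  ultimately show ?thesis using scalar_center by blast
qed

text \<open>The two scalars agree because the trace does not see the order of the factors; thus
  \<open>p\<close> is a multiple of a unitary.\<close>

lemma twisted_scalar:
  assumes g: "g \<in> carrier G" and p: "twisted g p"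
  shows "adj p \<circ> p = scalar_op G (of_real ((nrm (hat p))\<^sup>2))"
    and "p \<circ> adj p = scalar_op G (of_real ((nrm (hat p))\<^sup>2))"
proof -
  have tau_scalar: "\<tau> (scalar_op G c) = c" for c
    by (simp add: \<tau>_def scalar_op_apply) (simp add: delta_def)
  obtain a b where ab: "adj p \<circ> p = scalar_op G a" "p \<circ> adj p = scalar_op G b"
    using scalar_of_twisted[OF g p p] scalar_of_twisted'[OF g p p] by blast
  have "a = \<tau> (adj p \<circ> p)" by (simp add: ab tau_scalar)
  also have "\<dots> = of_real ((nrm (hat p))\<^sup>2)"
    using p by (simp only: tau_comp R_adj P_in_R twisted_P adj_adj R_bop bop_ell2 ip_self)
  finally have a: "a = of_real ((nrm (hat p))\<^sup>2)" .
  have "b = \<tau> (p \<circ> adj p)" by (simp add: ab tau_scalar)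
  also have "\<dots> = \<tau> (adj p \<circ> p)" using p by (intro tau_commute) auto
  finally have b: "b = a" by (simp add: ab tau_scalar)
  show "adj p \<circ> p = scalar_op G (of_real ((nrm (hat p))\<^sup>2))"
    "p \<circ> adj p = scalar_op G (of_real ((nrm (hat p))\<^sup>2))"
    unfolding ab b a by simp_all
qed

text \<open>For twisted elements the operator norm is the 2-norm, so 2-norm estimates become
  operator bounds.\<close>

lemma twisted_nrm:
  assumes g: "g \<in> carrier G" and p: "twisted g p" and f: "f \<in> \<H>"
  shows "nrm (p f) = nrm (hat p) * nrm f"
proof -
  have "complex_of_real ((nrm (p f))\<^sup>2) = ip (p f) (p f)" using p by (simp only: ip_self bop_ell2 P_bop twisted_P)
  also have "\<dots> = ip f (adj p (p f))" using p f by (simp add: adj_right)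
  also have "adj p (p f) = (\<lambda>x. of_real ((nrm (hat p))\<^sup>2) * f x)"
    using fun_cong[OF twisted_scalar(1)[OF g p], of f] f by (simp add: scalar_op_apply)
  also have "ip f \<dots> = of_real ((nrm (hat p))\<^sup>2 * (nrm f)\<^sup>2)"
    using f by (simp only: ip_scale_right ip_self of_real_mult)
  finally have "(nrm (p f))\<^sup>2 = (nrm (hat p) * nrm f)\<^sup>2"
    by (simp only: of_real_eq_iff power_mult_distrib)
  then show ?thesis by (simp add: power2_eq_iff_nonneg)
qed

text \<open>
  The minimizer of the distance to \<open>\<delta>\<^sub>g\<close> in an operator-norm ball of \<open>P\<close> is unique, hence
  intertwines. The radius 2 is large enough to put it in the interior, so that it is the
  image of the unitary of \<open>g\<close> under the conditional expectation onto \<open>P\<close>.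
\<close>

lemma expectation_exists:
  assumes g: "g \<in> carrier G"
  shows "\<exists>p. twisted g p \<and> (\<forall>y\<in>P. ip (hat p) (hat y) = hat y g)"
proof -
  let ?v = "delta g"
  obtain p where p: "p \<in> P" "op_le p 2"
    and minall: "\<forall>q\<in>P. op_le q 2 \<longrightarrow> nrm (\<lambda>x. hat p x - ?v x) \<le> nrm (\<lambda>x. hat q x - ?v x)"
    using ball_minimizer[OF P_vna P_R delta_ell2, of 2 g] by auto
  have min: "nrm (\<lambda>x. hat p x - ?v x) \<le> nrm (\<lambda>x. hat q x - ?v x)" if "q \<in> P" "op_le q 2" for q
    using minall that by blast
  have unitary_case: "Ad (\<L> g) u (p f) = p (u f)" if u: "u \<in> P" "unitary_op u" and f: "f \<in> \<H>" for u f
  proof -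
    \<comment> \<open>Since \<open>\<L> g = Ad (\<L> g) u \<circ> \<L> g \<circ> adj u\<close>, the
      competitor \<open>q\<close> is as far from \<open>\<L> g\<close> as \<open>p\<close>
      is.\<close>
    define q where "q = Ad (\<L> g) u \<circ> p \<circ> adj u"
    have qP: "q \<in> P" using u p g by (simp add: q_def)
    have Adu: "unitary_op (Ad (\<L> g) u)" using g u by (simp add: Ad_unitary)
    have "op_le q (1 * 2 * 1)"
      unfolding q_def using u p g Adu
      by (intro op_le_comp unitary_op_le unitary_adj) auto
    then have ql: "op_le q 2" by simp
    define x where "x = (\<lambda>f y. 1 * p f y + (- 1) * \<L> g f y)"
    have xR: "x \<in> \<R>" unfolding x_def using p g by (intro vna_lin[OF R_vna]) auto
    have qx: "(\<lambda>y. hat q y - ?v y) = Ad (\<L> g) u (x (hat (adj u)))"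
    proof -
      have w: "Ad (\<L> g) u (\<L> g (hat (adj u))) = ?v"
        using g u by (simp add: Ad_lam_apply lam_delta)
      have "Ad (\<L> g) u (x (hat (adj u))) = (\<lambda>y. Ad (\<L> g) u (p (hat (adj u))) y - Ad (\<L> g) u (\<L> g (hat (adj u))) y)"
        using g u p bop_diff[of "Ad (\<L> g) u" "p (hat (adj u))" "\<L> g (hat (adj u))"] by (simp add: x_def)
      then show ?thesis unfolding w by (simp add: q_def)
    qed
    then have "nrm (\<lambda>y. hat q y - ?v y) = nrm (hat (x \<circ> adj u))"
      using xR u by (simp add: unitary_nrm[OF Adu])
    \<comment> \<open>Passing to adjoints preserves the 2-norm and turns right multiplication by a
      unitary into left multiplication.\<close>
    also have "\<dots> = nrm (hat (adj (x \<circ> adj u)))" by (rule nrm_hat_adj[OF R_comp[OF xR R_adj[OF P_in_R[OF u(1)]]], symmetric])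
    also have "\<dots> = nrm (u (hat (adj x)))" using xR u by (simp add: adj_comp)
    also have "\<dots> = nrm (hat x)" using xR u by (simp add: unitary_nrm nrm_hat_adj)
    also have "hat x = (\<lambda>y. hat p y - ?v y)" using g by (simp add: x_def lam_delta)
    finally have "nrm (\<lambda>y. hat q y - ?v y) = nrm (\<lambda>y. hat p y - ?v y)" .
    then have "q = p"
      by (rule ball_minimizer_unique[where p=p and q=q and v="?v" and C=2, OF P_vna P_R delta_ell2 p qP ql minall])
    then have "q (u f) = p (u f)" by simp
    then show ?thesis using u f by (simp add: q_def)
  qed
  have "\<forall>f\<in>\<H>. Ad (\<L> g) x (p f) = p (x f)" if "x \<in> P" for x
    using P_vna that
  proof (induction rule: vna_unitary_induct)
    case (unitary u)
    then show ?case using unitary_case by blast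
  next
    case (lin S T s t)
    show ?case
    proof
      fix f assume f: "f \<in> \<H>"
      have "Ad (\<L> g) (\<lambda>f x. s * S f x + t * T f x) (p f) = (\<lambda>x. s * p (S f) x + t * p (T f) x)"
        using lin g f by (simp add: Ad_lin)
      also have "\<dots> = p (\<lambda>x. s * S f x + t * T f x)"
        using lin p bop_add[of p "\<lambda>x. s * S f x" "\<lambda>x. t * T f x"] by (simp add: bop_scale)
      finally show "Ad (\<L> g) (\<lambda>f x. s * S f x + t * T f x) (p f) = p (\<lambda>x. s * S f x + t * T f x)" .
    qed
  next
    case (inverse S T)
    show ?case
    proof
      fix f assume f: "f \<in> \<H>"
      have "S (T f) = f" using inverse f by (metis comp_apply idop_apply)
      then have "p f = Ad (\<L> g) S (p (T f))" using inverse by simp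
      moreover have "Ad (\<L> g) T \<circ> Ad (\<L> g) S = idop"
        using inverse g by (simp flip: Ad_comp add: Ad_idop)
      ultimately show "Ad (\<L> g) T (p f) = p (T f)"
        using p inverse by (metis P_bop bop_ell2 comp_apply idop_apply)
    qed
  qed
  then have tw: "twisted g p" using p g by (intro twistedI) auto
  define n where "n = nrm (hat p)"
  \<comment> \<open>Comparison with \<open>p / 2\<close>, which is also in the ball: three quarters
    of \<open>n\<^sup>2\<close> is at most the real part of \<open>ip (hat p) ?v\<close>, hence at
    most \<open>n\<close>.\<close>
  have n: "n \<le> 4/3"
  proof -
    let ?q = "\<lambda>f x. (1/2) * p f x"
    have "op_le ?q (cmod (1/2) * 2)" by (rule op_le_scale[OF p(2)])
    then have "op_le ?q 2" by (rule op_le_mono) simp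
    then have "nrm (\<lambda>x. hat p x - ?v x) \<le> nrm (\<lambda>x. (1/2) * hat p x - ?v x)"
      using min[OF vna_smult[OF P_vna p(1)], of "1/2"] by simp
    then have "(nrm (\<lambda>x. hat p x - ?v x))\<^sup>2 \<le> (nrm (\<lambda>x. (1/2) * hat p x - ?v x))\<^sup>2"
      by (intro power_mono) auto
    moreover have pH: "hat p \<in> \<H>" using p(1) by simp
    note e1 = nrm_diff_power2[OF pH delta_ell2[of g]]
    note e2 = nrm_diff_power2[OF scale_ell2[OF pH, of "1/2"] delta_ell2[of g]]
    have "cnj (1/2) * ip (hat p) ?v = of_real (1/2) * ip (hat p) ?v" by simp
    then have "Re (cnj (1/2) * ip (hat p) ?v) = (1/2) * Re (ip (hat p) ?v)"
      by (simp only: Re_complex_of_real times_complex.simps Im_complex_of_real)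
    moreover have "(cmod (1/2) * n)\<^sup>2 = n\<^sup>2 / 4" by (simp add: power_mult_distrib power_divide)
    ultimately have "n\<^sup>2 - 2 * Re (ip (hat p) ?v) \<le> n\<^sup>2 / 4 - Re (ip (hat p) ?v)"
      using e1 e2 unfolding nrm_scale ip_scale_left n_def by linarith
    moreover have "Re (ip (hat p) ?v) \<le> n"
      using cauchy_schwarz[of "hat p" ?v] p(1) nrm_delta[OF g] complex_Re_le_cmod[of "ip (hat p) ?v"]
      by (simp add: n_def del: ip_delta_right)
    ultimately have "n * n * 3 \<le> n * 4" by (simp add: power2_eq_square)
    then show ?thesis using nrm_nonneg[of "hat p"] by (cases "n = 0") (auto simp: n_def less_le)
  qed
  have "ip (\<lambda>x. hat p x - ?v x) (hat y) = 0" if y: "y \<in> P" for y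
  proof -
    obtain D where D: "op_le y D" using y by (metis bop_op_le P_bop)
    then have "0 \<le> D" by (simp add: op_le_def)
    \<comment> \<open>As \<open>4/3 + 2/3 = 2\<close>, perturbations by \<open>c * y\<close> with
      \<open>cmod c \<le> e\<close> stay in the ball.\<close>
    define e where "e = (2/3) / (D + 1)"
    have e: "e > 0" "e * D \<le> 2/3" using \<open>0 \<le> D\<close> by (auto simp: e_def field_simps)
    show ?thesis
    proof (rule minimal_orthogonal_local[OF _ _ e(1)])
      fix c assume c: "cmod c \<le> e"
      let ?q = "\<lambda>f x. 1 * p f x + c * y f x"
      have qP: "?q \<in> P" using vna_lin[OF P_vna p(1) y] .
      have "op_le p (4/3)"
        unfolding op_le_def
      proof (intro conjI ballI)
        fix f assume f: "f \<in> \<H>"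
        show "nrm (p f) \<le> 4 / 3 * nrm f"
          using twisted_nrm[OF g tw f] n mult_right_mono[OF n, of "nrm f"] by (simp add: n_def)
      qed simp
      then have "op_le ?q (cmod 1 * (4/3) + cmod c * D)"
        using p y D by (intro op_le_add op_le_scale bop_smult) auto
      moreover have "cmod c * D \<le> 2/3" using mult_right_mono[OF c \<open>0 \<le> D\<close>] e by simp
      ultimately have "op_le ?q 2" by (elim op_le_mono) simp
      from min[OF qP this]
      show "nrm (\<lambda>x. hat p x - ?v x) \<le> nrm (\<lambda>x. hat p x - ?v x + c * hat y x)"
        by (simp add: algebra_simps)
    qed (use p y in auto)
  qed
  then have "ip (hat p) (hat y) = hat y g" if "y \<in> P" for y
    using p g that by (simp add: ip_diff_left)
  then show ?thesis using tw by blast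
qed

end

section \<open>Characters attached to an invariant subfactor\<close>

context group
begin

lemma has_sum_finite_sum:
  fixes f :: "'c \<Rightarrow> 'd \<Rightarrow> complex"
  assumes "finite F" "\<And>x. x \<in> F \<Longrightarrow> (f x has_sum s x) A"
  shows "((\<lambda>u. \<Sum>x\<in>F. f x u) has_sum (\<Sum>x\<in>F. s x)) A"
  using assms by (induction F) (auto intro: has_sum_add)

lemma linear_combination_ell2:
  assumes "finite F" "\<And>x. x \<in> F \<Longrightarrow> b x \<in> \<H>"
  shows "(\<lambda>u. \<Sum>x\<in>F. c x * b x u) \<in> \<H>"
    and "f \<in> \<H> \<Longrightarrow> ip f (\<lambda>u. \<Sum>x\<in>F. c x * b x u) = (\<Sum>x\<in>F. c x * ip f (b x))"
proof -
  have "(\<lambda>u. \<Sum>x\<in>F. c x * b x u) \<in> \<H> \<and> (f \<in> \<H> \<longrightarrow> ip f (\<lambda>u. \<Sum>x\<in>F. c x * b x u) = (\<Sum>x\<in>F. c x * ip f (b x)))"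
    using assms
  proof (induction F)
    case (insert a F)
    then have H: "(\<lambda>u. \<Sum>x\<in>F. c x * b x u) \<in> \<H>" "(\<lambda>u. c a * b a u) \<in> \<H>" by auto
    then show ?case
      using insert add_ell2[OF H(2,1)] ip_add_right[OF _ H(2,1), of f] by (simp add: ip_scale_right)
  qed simp
  then show "(\<lambda>u. \<Sum>x\<in>F. c x * b x u) \<in> \<H>"
    "f \<in> \<H> \<Longrightarrow> ip f (\<lambda>u. \<Sum>x\<in>F. c x * b x u) = (\<Sum>x\<in>F. c x * ip f (b x))" by auto
qed

lemma gram_nonneg:
  assumes F: "finite F" "\<And>x. x \<in> F \<Longrightarrow> b x \<in> \<H>"
  shows "(\<Sum>x\<in>F. \<Sum>y\<in>F. cnj (c x) * c y * ip (b x) (b y)) = of_real ((nrm (\<lambda>u. \<Sum>x\<in>F. c x * b x u))\<^sup>2)"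
proof -
  let ?v = "\<lambda>u. \<Sum>x\<in>F. c x * b x u"
  have v: "?v \<in> \<H>" using linear_combination_ell2(1)[OF F] .
  have "ip ?v (b y) = (\<Sum>x\<in>F. cnj (c x) * ip (b x) (b y))" if "y \<in> F" for y
  proof -
    have "ip ?v (b y) = cnj (ip (b y) ?v)" by (simp add: ip_commute)
    also have "\<dots> = (\<Sum>x\<in>F. cnj (c x) * ip (b x) (b y))"
      using F that by (simp add: linear_combination_ell2(2) ip_commute)
    finally show ?thesis .
  qed
  then have "ip ?v ?v = (\<Sum>y\<in>F. c y * (\<Sum>x\<in>F. cnj (c x) * ip (b x) (b y)))"
    using linear_combination_ell2(2)[OF F v] by simp
  also have "\<dots> = (\<Sum>x\<in>F. \<Sum>y\<in>F. cnj (c x) * c y * ip (b x) (b y))"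
    unfolding sum_distrib_left by (subst sum.swap) (simp add: ac_simps)
  finally show ?thesis using ip_self[OF v] by simp
qed

text \<open>The Schur product theorem: expanding one of the two inner products as a sum over
  \<open>u\<close> writes the form as a sum of Gram forms with coefficients
  \<open>c x * cnj (b x u)\<close>.\<close>

lemma schur_square_nonneg:
  assumes F: "finite F" "\<And>x. x \<in> F \<Longrightarrow> b x \<in> \<H>"
  shows "(\<Sum>x\<in>F. \<Sum>y\<in>F. cnj (c x) * c y * of_real ((cmod (ip (b x) (b y)))\<^sup>2)) \<in> \<real>\<^sub>\<ge>\<^sub>0"
proof -
  let ?t = "\<lambda>u. \<Sum>x\<in>F. \<Sum>y\<in>F. cnj (c x * cnj (b x u)) * (c y * cnj (b y u)) * ip (b x) (b y)"
  have "((\<lambda>u. cnj (c x * cnj (b x u)) * (c y * cnj (b y u)) * ip (b x) (b y)) has_sum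
      cnj (c x) * c y * of_real ((cmod (ip (b x) (b y)))\<^sup>2)) (carrier G)" if "x \<in> F" "y \<in> F" for x y
  proof -
    have "((\<lambda>u. cnj (b y u) * b x u) has_sum ip (b y) (b x)) (carrier G)"
      unfolding ell2_inner_def using ip_summable F that by (intro has_sum_infsum) auto
    then have "((\<lambda>u. cnj (c x) * c y * ip (b x) (b y) * (cnj (b y u) * b x u)) has_sum
        cnj (c x) * c y * ip (b x) (b y) * ip (b y) (b x)) (carrier G)"
      by (rule has_sum_cmult_right)
    moreover have "of_real ((cmod (ip (b x) (b y)))\<^sup>2) = ip (b x) (b y) * ip (b y) (b x)"
      by (simp only: complex_norm_square ip_commute)
    ultimately show ?thesis by (simp add: ac_simps)
  qed
  then have hs: "(?t has_sum (\<Sum>x\<in>F. \<Sum>y\<in>F. cnj (c x) * c y * of_real ((cmod (ip (b x) (b y)))\<^sup>2))) (carrier G)"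
    by (intro has_sum_finite_sum F(1))
  have "0 \<le> ?t u" for u
  proof -
    have "?t u = of_real ((nrm (\<lambda>v. \<Sum>x\<in>F. c x * cnj (b x u) * b x v))\<^sup>2)"
      by (rule gram_nonneg[OF F])
    then show ?thesis by (simp only: less_eq_complex_def) simp
  qed
  then have "0 \<le> (\<Sum>x\<in>F. \<Sum>y\<in>F. cnj (c x) * c y * of_real ((cmod (ip (b x) (b y)))\<^sup>2))"
    using infsum_nonneg_complex[of ?t "carrier G"] infsumI[OF hs] has_sum_imp_summable[OF hs] by simp
  then show ?thesis by (simp add: complex_nonneg_Reals_iff less_eq_complex_def)
qed

lemma nonneg_Reals_sum: "(\<And>x. x \<in> F \<Longrightarrow> f x \<in> \<real>\<^sub>\<ge>\<^sub>0) \<Longrightarrow> (\<Sum>x\<in>F. f x) \<in> \<real>\<^sub>\<ge>\<^sub>0"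
  for f :: "'c \<Rightarrow> complex"
  by (simp add: complex_nonneg_Reals_iff sum_nonneg)

text \<open>A function supported on a subgroup \<open>K\<close> has a kernel that is block diagonal
  for the left cosets of \<open>K\<close>. After translation by a representative each block is a
  Schur square.\<close>

lemma positive_definite_schur_square:
  assumes K: "subgroup K G" and a: "\<And>h. h \<in> K \<Longrightarrow> a h \<in> \<H>"
    and off: "\<And>g. g \<in> carrier G \<Longrightarrow> g \<notin> K \<Longrightarrow> \<theta> g = 0"
    and on: "\<And>h k. h \<in> K \<Longrightarrow> k \<in> K \<Longrightarrow> \<theta> (inv h \<otimes> k) = of_real ((cmod (ip (a h) (a k)))\<^sup>2)"
  shows "positive_definite G \<theta>"
  unfolding positive_definite_def
proof (intro allI impI, elim conjE)
  fix F and c :: "'a \<Rightarrow> complex" assume F: "finite F" "F \<subseteq> carrier G"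
  \<comment> \<open>A representative of the left coset of \<open>x\<close>; it depends only on the
    coset, because the predicate does.\<close>
  define t where "t x = (SOME y. y \<in> carrier G \<and> inv x \<otimes> y \<in> K)" for x
  have t: "t x \<in> carrier G" "inv x \<otimes> t x \<in> K" if "x \<in> carrier G" for x
    using someI[of "\<lambda>y. y \<in> carrier G \<and> inv x \<otimes> y \<in> K" x] that subgroup.one_closed[OF K]
    by (auto simp: t_def)
  have tr: "inv x \<otimes> z \<in> K" if "inv x \<otimes> y \<in> K" "inv y \<otimes> z \<in> K" "x \<in> carrier G" "y \<in> carrier G" "z \<in> carrier G" for x y z
  proof -
    have "inv x \<otimes> z = (inv x \<otimes> y) \<otimes> (inv y \<otimes> z)"
      using that by (simp add: m_assoc) (simp flip: m_assoc)
    then show ?thesis using subgroup.m_closed[OF K that(1,2)] by simp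
  qed
  have sy: "inv y \<otimes> x \<in> K" if "inv x \<otimes> y \<in> K" "x \<in> carrier G" "y \<in> carrier G" for x y
    using subgroup.m_inv_closed[OF K that(1)] that by (simp add: inv_mult_group)
  have teq: "t x = t y \<longleftrightarrow> inv x \<otimes> y \<in> K" if "x \<in> carrier G" "y \<in> carrier G" for x y
  proof
    assume "t x = t y"
    then show "inv x \<otimes> y \<in> K" using t[OF that(1)] t[OF that(2)] tr sy that by metis
  next
    assume "inv x \<otimes> y \<in> K"
    then have "(\<lambda>z. z \<in> carrier G \<and> inv x \<otimes> z \<in> K) = (\<lambda>z. z \<in> carrier G \<and> inv y \<otimes> z \<in> K)"
      using tr sy that by blast
    then show "t x = t y" by (simp add: t_def)
  qed
  define h where "h x = inv (t x) \<otimes> x" for x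
  have hK: "h x \<in> K" if "x \<in> carrier G" for x using t[OF that] sy that by (auto simp: h_def)
  have val: "\<theta> (inv x \<otimes> y) = (if t y = t x then of_real ((cmod (ip (a (h x)) (a (h y))))\<^sup>2) else 0)"
    if "x \<in> carrier G" "y \<in> carrier G" for x y
  proof (cases "t y = t x")
    case True
    then have "inv (h x) \<otimes> h y = inv x \<otimes> y"
      using that t(1)[OF that(1)] by (simp add: h_def inv_mult_group m_assoc) (simp flip: m_assoc)
    then show ?thesis using on[OF hK hK, OF that] True by simp
  next
    case False
    then show ?thesis using teq[OF that] off that by auto
  qed
  let ?f = "\<lambda>x y. cnj (c x) * c y * of_real ((cmod (ip (a (h x)) (a (h y))))\<^sup>2)"
  have "(\<Sum>x\<in>F. \<Sum>y\<in>F. cnj (c x) * c y * \<theta> (inv x \<otimes> y)) = (\<Sum>x\<in>F. \<Sum>y\<in>{y \<in> F. t y = t x}. ?f x y)"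
  proof (rule sum.cong[OF refl])
    fix x assume x: "x \<in> F"
    have "(\<Sum>y\<in>F. cnj (c x) * c y * \<theta> (inv x \<otimes> y)) = (\<Sum>y\<in>F. if t y = t x then ?f x y else 0)"
    proof (rule sum.cong[OF refl])
      fix y assume "y \<in> F"
      then have "\<theta> (inv x \<otimes> y) = (if t y = t x then of_real ((cmod (ip (a (h x)) (a (h y))))\<^sup>2) else 0)"
        using x F by (intro val) auto
      then show "cnj (c x) * c y * \<theta> (inv x \<otimes> y) = (if t y = t x then ?f x y else 0)" by simp
    qed
    then show "(\<Sum>y\<in>F. cnj (c x) * c y * \<theta> (inv x \<otimes> y)) = (\<Sum>y\<in>{y \<in> F. t y = t x}. ?f x y)"
      by (simp only: sum.inter_filter[OF F(1)])
  qed
  also have "\<dots> = (\<Sum>s\<in>t ` F. \<Sum>x\<in>{x \<in> F. t x = s}. \<Sum>y\<in>{y \<in> F. t y = t x}. ?f x y)"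
    by (rule sum.image_gen[OF F(1)])
  also have "\<dots> = (\<Sum>s\<in>t ` F. \<Sum>x\<in>{x \<in> F. t x = s}. \<Sum>y\<in>{x \<in> F. t x = s}. ?f x y)"
    by (intro sum.cong refl) auto
  also have "\<dots> \<in> \<real>\<^sub>\<ge>\<^sub>0"
    using F hK a by (intro nonneg_Reals_sum schur_square_nonneg) auto
  finally show "(\<Sum>x\<in>F. \<Sum>y\<in>F. cnj (c x) * c y * \<theta> (inv x \<otimes> y)) \<in> \<real>\<^sub>\<ge>\<^sub>0" .
qed

end

context invariant_factor
begin

definition intertwiner :: "'a \<Rightarrow> 'a operator \<Rightarrow> bool" where
  "intertwiner g v \<longleftrightarrow> twisted g v \<and> unitary_op v"

text \<open>The elements whose conjugation restricts to an inner automorphism of \<open>P\<close>.\<close>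

definition inner_elements :: "'a set" where
  "inner_elements = {g \<in> carrier G. \<exists>v. intertwiner g v}"

text \<open>The conditional expectation of \<open>\<L> g\<close> onto \<open>P\<close>: the second
  clause makes \<open>hat (E g)\<close> the orthogonal projection of \<open>delta g\<close> onto the
  closure of the vectors \<open>hat y\<close>.\<close>

definition E :: "'a \<Rightarrow> 'a operator" where
  "E g = (SOME p. twisted g p \<and> (\<forall>y\<in>P. ip (hat p) (hat y) = hat y g))"

lemma
  assumes "g \<in> carrier G"
  shows E_twisted: "twisted g (E g)" and E_ip: "y \<in> P \<Longrightarrow> ip (hat (E g)) (hat y) = hat y g"
  using someI_ex[OF expectation_exists[OF assms]] by (simp_all add: E_def)

lemma intertwiner_P [simp]: "intertwiner g v \<Longrightarrow> v \<in> P"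
  and intertwiner_unitary [simp]: "intertwiner g v \<Longrightarrow> unitary_op v"
  and intertwiner_twisted [simp]: "intertwiner g v \<Longrightarrow> twisted g v"
  by (auto simp: intertwiner_def intro: twisted_P)

text \<open>\<open>adj v \<circ> p\<close> is a scalar, and the unitary \<open>v\<close> can be
  moved to the other side.\<close>

lemma twisted_multiple:
  assumes g: "g \<in> carrier G" and v: "intertwiner g v" and p: "twisted g p"
  shows "\<exists>c. p = (\<lambda>f x. c * v f x)"
proof -
  obtain c where c: "adj v \<circ> p = scalar_op G c" using scalar_of_twisted[OF g _ p] v by force
  have "p = (\<lambda>f x. c * v f x)"
  proof (rule bop_eqI)
    fix f assume f: "f \<in> \<H>"
    have "p f = v (adj v (p f))" using v p by simp
    also have "adj v (p f) = (\<lambda>x. c * f x)"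
      using fun_cong[OF c, of f] f by (simp add: scalar_op_apply)
    also have "v \<dots> = (\<lambda>x. c * v f x)" using v f by (simp add: bop_scale)
    finally show "p f = (\<lambda>x. c * v f x)" .
  qed (use v p in auto)
  then show ?thesis by blast
qed

lemma intertwiner_phase:
  assumes g: "g \<in> carrier G" and v: "intertwiner g v" and w: "intertwiner g w"
  shows "\<exists>c. cmod c = 1 \<and> w = (\<lambda>f x. c * v f x)"
proof -
  obtain c where c: "w = (\<lambda>f x. c * v f x)" using twisted_multiple[OF g v] w by force
  have "nrm (hat w) = cmod c * nrm (hat v)" by (simp add: c nrm_scale)
  then have "cmod c = 1" using v w by (simp add: unitary_nrm nrm_delta)
  then show ?thesis using c by blast
qed

text \<open>A nonzero expectation, once normalized, would be a unitary intertwiner.\<close>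

lemma E_eq_0:
  assumes g: "g \<in> carrier G" and "g \<notin> inner_elements"
  shows "nrm (hat (E g)) = 0"
proof (rule ccontr)
  let ?n = "nrm (hat (E g))"
  assume n: "?n \<noteq> 0"
  define v where "v = (\<lambda>f x. of_real (1 / ?n) * E g f x)"
  have tw: "twisted g (E g)" by (rule E_twisted[OF g])
  have vP: "v \<in> P" unfolding v_def using tw by (intro vna_smult[OF P_vna]) simp
  have tv: "twisted g v"
  proof (rule twistedI[OF vP g])
    fix x f assume x: "x \<in> P" and f: "f \<in> \<H>"
    show "v (x f) = Ad (\<L> g) x (v f)"
      using twistedD[OF tw x, of f] tw x g by (simp add: v_def bop_scale del: of_real_divide)
  qed
  have sc: "adj v (v f) = f" "v (adj v f) = f" if f: "f \<in> \<H>" for f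
  proof -
    have "hat v = (\<lambda>x. of_real (1 / ?n) * hat (E g) x)" by (simp add: v_def)
    then have "nrm (hat v) = cmod (of_real (1 / ?n)) * ?n" by (simp only: nrm_scale)
    then have "nrm (hat v) = 1" using n by (simp add: norm_divide)
    then show "adj v (v f) = f" "v (adj v f) = f"
      using fun_cong[OF twisted_scalar(1)[OF g tv], of f] fun_cong[OF twisted_scalar(2)[OF g tv], of f] f
      by (simp_all add: scalar_op_apply)
  qed
  have "unitary_op v" unfolding unitary_op_def using vP sc by (auto intro!: bop_eqI)
  then have "g \<in> inner_elements" unfolding inner_elements_def intertwiner_def using tv g by blast
  then show False using assms(2) by simp
qed

lemma intertwiner_idop: "intertwiner \<one> idop"
  unfolding intertwiner_def
  by (intro conjI twistedI) (auto simp: Ad_lam_one unitary_idop vna_scalar[OF P_vna])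

lemma intertwiner_comp:
  assumes "g \<in> carrier G" "h \<in> carrier G" "intertwiner g v" "intertwiner h w"
  shows "intertwiner (g \<otimes> h) (v \<circ> w)"
  unfolding intertwiner_def
proof (intro conjI twistedI)
  fix x f assume x: "x \<in> P" and f: "f \<in> \<H>"
  have "v (w (x f)) = v (Ad (\<L> h) x (w f))" using assms x twistedD[of h w x f] by simp
  also have "\<dots> = Ad (\<L> g) (Ad (\<L> h) x) (v (w f))"
    using assms x twistedD[of g v "Ad (\<L> h) x" "w f"] by simp
  finally show "(v \<circ> w) (x f) = Ad (\<L> (g \<otimes> h)) x ((v \<circ> w) f)"
    using assms x by (simp add: Ad_lam_lam)
qed (use assms in \<open>auto intro: unitary_comp\<close>)

lemma intertwiner_adj:
  assumes "g \<in> carrier G" "intertwiner g v"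
  shows "intertwiner (inv g) (adj v)"
  unfolding intertwiner_def
proof (intro conjI twistedI)
  fix x f assume x: "x \<in> P" and f: "f \<in> \<H>"
  have "adj v (Ad (\<L> g) (Ad (\<L> (inv g)) x) f) = Ad (\<L> (inv g)) x (adj v f)"
    using assms x by (intro twisted_adj) auto
  then show "adj v (x f) = Ad (\<L> (inv g)) x (adj v f)"
    using assms x by (simp add: Ad_lam_lam Ad_lam_one)
qed (use assms in \<open>auto intro: unitary_adj\<close>)

lemma intertwiner_conj:
  assumes "g \<in> carrier G" "h \<in> carrier G" "intertwiner g v"
  shows "intertwiner (h \<otimes> g \<otimes> inv h) (Ad (\<L> h) v)"
  unfolding intertwiner_def
proof (intro conjI twistedI)
  fix x f assume x: "x \<in> P" and f: "f \<in> \<H>"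
  define y where "y = Ad (\<L> (inv h)) x"
  have y: "y \<in> P" "x = Ad (\<L> h) y" using x assms by (simp_all add: y_def Ad_lam_lam Ad_lam_one)
  have "Ad (\<L> h) v (x f) = \<L> h (v (y (\<L> (inv h) f)))"
    using assms y f by (simp add: Ad_lam_apply)
  also have "v (y (\<L> (inv h) f)) = Ad (\<L> g) y (v (\<L> (inv h) f))"
    using assms y twistedD[of g v y] by simp
  also have "\<L> h \<dots> = Ad (\<L> h) (Ad (\<L> g) y) (Ad (\<L> h) v f)"
    using assms y f by (simp add: Ad_lam_apply)
  also have "Ad (\<L> h) (Ad (\<L> g) y) = Ad (\<L> (h \<otimes> g \<otimes> inv h)) x"
    using assms y by (simp add: Ad_lam_lam m_assoc)
  finally show "Ad (\<L> h) v (x f) = Ad (\<L> (h \<otimes> g \<otimes> inv h)) x (Ad (\<L> h) v f)" .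
qed (use assms in \<open>auto intro: Ad_unitary\<close>)

lemma inner_elements_subgroup: "subgroup inner_elements G"
proof
  show "inner_elements \<subseteq> carrier G" by (auto simp: inner_elements_def)
  show "\<one> \<in> inner_elements" using intertwiner_idop by (auto simp: inner_elements_def)
qed (auto simp: inner_elements_def intro: intertwiner_comp intertwiner_adj)

lemma inner_elements_conj:
  assumes "g \<in> carrier G" "h \<in> carrier G"
  shows "h \<otimes> g \<otimes> inv h \<in> inner_elements \<longleftrightarrow> g \<in> inner_elements"
proof
  show "g \<in> inner_elements \<Longrightarrow> h \<otimes> g \<otimes> inv h \<in> inner_elements"
    using assms intertwiner_conj by (auto simp: inner_elements_def)
  have "inv h \<otimes> (h \<otimes> g \<otimes> inv h) \<otimes> inv (inv h) = g"
    using assms by (simp add: m_assoc) (simp flip: m_assoc)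
  then show "h \<otimes> g \<otimes> inv h \<in> inner_elements \<Longrightarrow> g \<in> inner_elements"
    using assms intertwiner_conj[of "h \<otimes> g \<otimes> inv h" "inv h"] by (auto simp: inner_elements_def)
qed

text \<open>An arbitrary choice, multiplicative only up to phases. This is why the characters are
  built from squared absolute values.\<close>

definition V :: "'a \<Rightarrow> 'a operator" where "V g = (SOME v. intertwiner g v)"

lemma V: "g \<in> inner_elements \<Longrightarrow> intertwiner g (V g)"
  by (simp add: V_def inner_elements_def someI_ex)

lemma V_P [simp]: "g \<in> inner_elements \<Longrightarrow> V g \<in> P"
  using V intertwiner_P by blast

text \<open>On inner elements \<open>\<L> g\<close> is the product of \<open>V g \<in> P\<close> and \<open>W g\<close> in the relative commutant of \<open>P\<close>.\<close>

definition W :: "'a \<Rightarrow> 'a operator" where "W g = adj (V g) \<circ> \<L> g"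

definition \<phi> :: "'a \<Rightarrow> complex" where
  "\<phi> g = (if g \<in> inner_elements then of_real ((cmod (\<tau> (W g)))\<^sup>2) else 0)"

definition \<psi> :: "'a \<Rightarrow> complex" where
  "\<psi> g = (if g \<in> inner_elements then of_real ((cmod (\<tau> (V g)))\<^sup>2) else 0)"

lemma inner_elementsI: "g \<in> carrier G \<Longrightarrow> intertwiner g v \<Longrightarrow> g \<in> inner_elements"
  by (auto simp: inner_elements_def)

lemma inner_elements_carrier [simp]: "g \<in> inner_elements \<Longrightarrow> g \<in> carrier G"
  by (simp add: inner_elements_def)

lemma \<psi>_eq:
  assumes "g \<in> carrier G" "intertwiner g v"
  shows "\<psi> g = of_real ((cmod (\<tau> v))\<^sup>2)"
proof -
  have g: "g \<in> inner_elements" using assms by (rule inner_elementsI)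
  obtain c where "cmod c = 1" "v = (\<lambda>f x. c * V g f x)" using intertwiner_phase[OF assms(1) V[OF g] assms(2)] by blast
  then show ?thesis using g by (simp add: \<psi>_def tau_smult norm_mult)
qed

lemma \<phi>_eq:
  assumes "g \<in> carrier G" "intertwiner g v"
  shows "\<phi> g = of_real ((cmod (\<tau> (adj v \<circ> \<L> g)))\<^sup>2)"
proof -
  have g: "g \<in> inner_elements" using assms by (rule inner_elementsI)
  obtain c where c: "cmod c = 1" "v = (\<lambda>f x. c * V g f x)" using intertwiner_phase[OF assms(1) V[OF g] assms(2)] by blast
  have "adj v = (\<lambda>f x. cnj c * adj (V g) f x)" using c V[OF g] by (simp add: adj_smult)
  then have "adj v \<circ> \<L> g = (\<lambda>f x. cnj c * W g f x)" by (auto simp: W_def)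
  then show ?thesis using g c(1) by (simp add: \<phi>_def tau_smult norm_mult)
qed

lemma \<psi>_conj:
  assumes "g \<in> carrier G" "h \<in> carrier G" shows "\<psi> (h \<otimes> g \<otimes> inv h) = \<psi> g"
proof (cases "g \<in> inner_elements")
  case True
  have "\<psi> (h \<otimes> g \<otimes> inv h) = of_real ((cmod (\<tau> (Ad (\<L> h) (V g))))\<^sup>2)"
    using assms V[OF True] by (intro \<psi>_eq intertwiner_conj) auto
  then show ?thesis using True assms V[OF True] by (simp add: tau_Ad \<psi>_def)
next
  case False
  then show ?thesis using inner_elements_conj[OF assms] by (simp add: \<psi>_def)
qed

lemma \<phi>_conj:
  assumes "g \<in> carrier G" "h \<in> carrier G" shows "\<phi> (h \<otimes> g \<otimes> inv h) = \<phi> g"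
proof (cases "g \<in> inner_elements")
  case True
  have R: "adj (V g) \<in> \<R>" "\<L> g \<in> \<R>" using assms V[OF True] by auto
  have "\<phi> (h \<otimes> g \<otimes> inv h) = of_real ((cmod (\<tau> (adj (Ad (\<L> h) (V g)) \<circ> \<L> (h \<otimes> g \<otimes> inv h))))\<^sup>2)"
    using assms V[OF True] by (intro \<phi>_eq intertwiner_conj) auto
  also have "adj (Ad (\<L> h) (V g)) \<circ> \<L> (h \<otimes> g \<otimes> inv h) = Ad (\<L> h) (W g)"
    using assms V[OF True] R by (simp add: W_def adj_Ad Ad_comp Ad_lam_of_lam)
  also have "\<tau> \<dots> = \<tau> (W g)" using assms R by (intro tau_Ad) (auto simp: W_def)
  finally show ?thesis using True by (simp add: \<phi>_def)
next
  case False
  then show ?thesis using inner_elements_conj[OF assms] by (simp add: \<phi>_def)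
qed

lemma \<psi>_character: "group_character G \<psi>"
  unfolding group_character_def
proof (intro conjI ballI)
  show "\<psi> \<one> = 1" using \<psi>_eq[OF one_closed intertwiner_idop] by (simp add: tau_idop)
  show "positive_definite G \<psi>"
  proof (rule positive_definite_schur_square[OF inner_elements_subgroup])
    fix h k assume hk: "h \<in> inner_elements" "k \<in> inner_elements"
    have "\<psi> (inv h \<otimes> k) = of_real ((cmod (\<tau> (adj (V h) \<circ> V k)))\<^sup>2)"
      using hk V by (intro \<psi>_eq intertwiner_comp intertwiner_adj) auto
    then show "\<psi> (inv h \<otimes> k) = of_real ((cmod (ip (hat (V h)) (hat (V k))))\<^sup>2)"
      using hk V[of h] V[of k] by (simp add: tau_comp)
  qed (auto simp: \<psi>_def)
qed (simp add: \<psi>_conj)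

text \<open>Conjugation invariance replaces \<open>inv h \<otimes> k\<close> by
  \<open>k \<otimes> inv h\<close>, for which the trace property produces the Gram kernel of the
  vectors \<open>hat (W h)\<close>.\<close>

lemma \<phi>_character: "group_character G \<phi>"
  unfolding group_character_def
proof (intro conjI ballI)
  show "\<phi> \<one> = 1" using \<phi>_eq[OF one_closed intertwiner_idop] tau_idop by (simp add: lam_one adj_scalar \<tau>_def)
  have W_R: "W h \<in> \<R>" if "h \<in> inner_elements" for h using V[OF that] that by (simp add: W_def)
  show "positive_definite G \<phi>"
  proof (rule positive_definite_schur_square[OF inner_elements_subgroup])
    fix h k assume hk: "h \<in> inner_elements" "k \<in> inner_elements"
    note Vh = V[OF hk(1)] and Vk = V[OF hk(2)]
    let ?v = "V k \<circ> adj (V h)"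
    have c: "h \<in> carrier G" "k \<in> carrier G" using hk by auto
    have "inv h \<otimes> (k \<otimes> inv h) \<otimes> inv (inv h) = inv h \<otimes> k" using c by (simp add: m_assoc)
    then have "\<phi> (inv h \<otimes> k) = \<phi> (k \<otimes> inv h)" using \<phi>_conj[of "k \<otimes> inv h" "inv h"] c by simp
    also have "\<dots> = of_real ((cmod (\<tau> (adj ?v \<circ> \<L> (k \<otimes> inv h))))\<^sup>2)"
      using c Vh Vk by (intro \<phi>_eq intertwiner_comp intertwiner_adj) auto
    also have "adj ?v \<circ> \<L> (k \<otimes> inv h) = V h \<circ> (adj (V k) \<circ> \<L> k \<circ> \<L> (inv h))"
      using c Vh Vk by (simp add: adj_comp lam_comp[symmetric] comp_assoc)
    also have "\<tau> \<dots> = \<tau> ((adj (V k) \<circ> \<L> k \<circ> \<L> (inv h)) \<circ> V h)"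
      using c Vh Vk by (intro tau_commute) auto
    also have "\<dots> = \<tau> (W k \<circ> adj (W h))"
      using c Vh Vk by (simp add: W_def adj_comp lam_adj comp_assoc)
    also have "\<dots> = \<tau> (adj (W h) \<circ> W k)" using W_R hk by (intro tau_commute) auto
    also have "\<dots> = ip (hat (W h)) (hat (W k))" using W_R hk by (simp add: tau_comp)
    finally show "\<phi> (inv h \<otimes> k) = of_real ((cmod (ip (hat (W h)) (hat (W k))))\<^sup>2)" .
  qed (use W_R in \<open>auto simp: \<phi>_def\<close>)
qed (simp add: \<phi>_conj)

text \<open>Testing against \<open>x\<close> in \<open>P\<close> computes the factor, and
  \<open>x = idop\<close> identifies it as \<open>\<tau> (W g)\<close>. The second part says that
  \<open>W g\<close> is independent of \<open>P\<close> for the trace; this makes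
  \<open>\<phi>\<close> and \<open>\<psi>\<close> multiply to zero.\<close>

lemma E_eq_tau_W:
  assumes g: "g \<in> inner_elements"
  shows "E g = (\<lambda>f x. \<tau> (W g) * V g f x)"
    and "x \<in> P \<Longrightarrow> \<tau> (x \<circ> W g) = \<tau> (W g) * \<tau> x"
proof -
  have gc: "g \<in> carrier G" using g by simp
  note v = V[OF g]
  obtain c where c: "E g = (\<lambda>f x. c * V g f x)" using twisted_multiple[OF gc v E_twisted[OF gc]] by blast
  have x: "\<tau> (x \<circ> W g) = c * \<tau> x" if x: "x \<in> P" for x
  proof -
    have "\<tau> (x \<circ> W g) = \<tau> ((x \<circ> adj (V g)) \<circ> \<L> g)" by (simp add: W_def comp_assoc)
    also have "\<dots> = ip (hat (V g \<circ> adj x)) (delta g)"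
      using x v gc by (subst tau_comp) (simp_all add: adj_comp lam_delta del: ip_delta_right)
    also have "\<dots> = cnj (ip (hat (E g)) (hat (V g \<circ> adj x)))"
      using E_ip[OF gc, of "V g \<circ> adj x"] x v gc by simp
    also have "ip (hat (E g)) (hat (V g \<circ> adj x)) = cnj c * ip (V g (delta \<one>)) (V g (hat (adj x)))"
      by (simp add: c ip_scale_left)
    also have "\<dots> = cnj c * \<tau> (adj x)"
      using v x by (simp only: unitary_ip intertwiner_unitary delta_ell2 bop_ell2 adj_bop P_bop tau_ip)
    also have "cnj (cnj c * \<tau> (adj x)) = c * \<tau> x" using tau_adj[OF P_in_R[OF x]] by simp
    finally show ?thesis .
  qed
  have "idop \<circ> W g = W g" by (rule bop_eqI) (use v gc in \<open>auto simp: W_def\<close>)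
  then have tc: "\<tau> (W g) = c" using x[OF vna_scalar[OF P_vna, of 1]] tau_idop by simp
  show "E g = (\<lambda>f x. \<tau> (W g) * V g f x)" unfolding tc by (rule c)
  show "\<tau> (x \<circ> W g) = \<tau> (W g) * \<tau> x" if "x \<in> P" unfolding tc using that by (rule x)
qed

lemma \<phi>_\<psi>_product:
  assumes "g \<in> carrier G" "g \<noteq> \<one>" shows "\<phi> g * \<psi> g = 0"
proof (cases "g \<in> inner_elements")
  case True
  have "V g \<circ> W g = \<L> g"
    by (rule bop_eqI) (use V[OF True] assms in \<open>auto simp: W_def\<close>)
  then have "\<tau> (W g) * \<tau> (V g) = 0"
    using E_eq_tau_W(2)[OF True, of "V g"] V[OF True] assms by (simp add: tau_lam)
  then show ?thesis by (auto simp: \<phi>_def \<psi>_def)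
qed (simp add: \<phi>_def)

text \<open>A nonzero coefficient of some \<open>y\<close> at \<open>g\<close> means that
  \<open>E g\<close> is nonzero, so \<open>g\<close> is inner and
  \<open>\<phi> g \<noteq> 0\<close>. If \<open>\<phi>\<close> is the Dirac function then
  \<open>g = \<one>\<close>; if \<open>\<psi>\<close> is, the vectors \<open>hat (V h)\<close> of
  distinct elements are orthogonal, so \<open>V g\<close> has no coefficient except at
  \<open>g\<close>.\<close>

lemma lam_in_P:
  assumes nf: "nonfactorizable_regular_character G"
    and y: "y \<in> P" and g: "g \<in> carrier G" and nz: "hat y g \<noteq> 0"
  shows "\<L> g \<in> P"
proof -
  have E0: "ip (hat (E h)) (hat x) = 0" if "h \<in> carrier G" "h \<notin> inner_elements" "x \<in> P" for h x
  proof -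
    have "hat (E h) \<in> \<H>" using E_twisted[OF that(1)] by simp
    then have "hat (E h) = (\<lambda>_. 0)" using E_eq_0[OF that(1,2)] by (simp add: nrm_eq_0_iff)
    then show ?thesis by simp
  qed
  have gi: "g \<in> inner_elements" using E0[OF g _ y] E_ip[OF g y] nz by auto
  have "\<tau> (W g) \<noteq> 0"
  proof
    assume "\<tau> (W g) = 0"
    then have "hat (E g) = (\<lambda>_. 0)" by (simp add: E_eq_tau_W(1)[OF gi])
    then show False using E_ip[OF g y] nz by simp
  qed
  then have \<phi>g: "\<phi> g \<noteq> 0" using gi by (simp add: \<phi>_def)
  have "is_dirac_at_one G \<phi> \<or> is_dirac_at_one G \<psi>"
    using nf \<phi>_character \<psi>_character \<phi>_\<psi>_product unfolding nonfactorizable_regular_character_def by blast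
  then show ?thesis
  proof
    assume "is_dirac_at_one G \<phi>"
    then have "g = \<one>" using \<phi>g g unfolding is_dirac_at_one_def by metis
    then show ?thesis by (simp add: lam_one vna_scalar[OF P_vna])
  next
    assume d: "is_dirac_at_one G \<psi>"
    note v = V[OF gi]
    have z: "hat (V g) h = 0" if h: "h \<in> carrier G" "h \<noteq> g" for h
    proof (cases "h \<in> inner_elements")
      case True
      have "inv h \<otimes> g \<noteq> \<one>"
      proof
        assume "inv h \<otimes> g = \<one>"
        then have "h \<otimes> (inv h \<otimes> g) = h" using h by simp
        then show False using h g by (simp flip: m_assoc)
      qed
      then have "\<psi> (inv h \<otimes> g) = 0" using d h g by (simp add: is_dirac_at_one_def)
      moreover have "\<psi> (inv h \<otimes> g) = of_real ((cmod (\<tau> (adj (V h) \<circ> V g)))\<^sup>2)"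
        using h g v V[OF True] by (intro \<psi>_eq intertwiner_comp intertwiner_adj) auto
      ultimately have "ip (hat (V h)) (hat (V g)) = 0"
        using v V[OF True] by (simp add: tau_comp)
      then have "ip (hat (E h)) (hat (V g)) = 0"
        by (simp add: E_eq_tau_W(1)[OF True] ip_scale_left)
      then show ?thesis using E_ip[OF h(1), of "V g"] v by simp
    next
      case False
      then show ?thesis using E0[OF h(1)] E_ip[OF h(1), of "V g"] v by simp
    qed
    define c where "c = hat (V g) g"
    have cR: "(\<lambda>f x. c * \<L> g f x) \<in> \<R>" using g by (intro vna_smult[OF R_vna]) simp
    have Veq: "V g = (\<lambda>f x. c * \<L> g f x)"
    proof (rule R_eqI[OF _ cR])
      fix h assume "h \<in> carrier G"
      then show "hat (V g) h = c * hat (\<L> g) h"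
        using z[of h] g by (cases "h = g") (simp_all add: lam_delta, simp_all add: delta_def c_def)
    qed (use v in simp)
    have "c \<noteq> 0"
    proof
      assume "c = 0"
      then have "nrm (hat (V g)) = 0" by (simp add: Veq)
      then show False using v by (simp add: unitary_nrm nrm_delta)
    qed
    then have "\<L> g = (\<lambda>f x. (1 / c) * V g f x)" by (simp add: Veq)
    then show ?thesis using vna_smult[OF P_vna, of "V g" "1 / c"] v by simp
  qed
qed

lemma eq_group_vna:
  assumes nf: "nonfactorizable_regular_character G"
  shows "\<exists>H. H \<lhd> G \<and> P = group_vna G H"
proof -
  define H where "H = {g \<in> carrier G. \<L> g \<in> P}"
  have sub: "subgroup H G"
  proof
    show "H \<subseteq> carrier G" by (auto simp: H_def)
    show "\<one> \<in> H" by (simp add: H_def lam_one vna_scalar[OF P_vna])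
    show "x \<otimes> y \<in> H" if "x \<in> H" "y \<in> H" for x y
      using that P_comp[of "\<L> x" "\<L> y"] by (simp add: H_def lam_comp)
    show "inv x \<in> H" if "x \<in> H" for x
      using that P_adj[of "\<L> x"] by (simp add: H_def lam_adj)
  qed
  have "x \<otimes> h \<otimes> inv x \<in> H" if "x \<in> carrier G" "h \<in> H" for x h
    using that P_Ad[of x "\<L> h"] by (simp add: H_def Ad_lam_of_lam)
  then have "H \<lhd> G" using sub by (simp add: normal_inv_iff)
  moreover have "P = group_vna G H"
    by (rule group_vna_eqI) (use lam_in_P[OF nf] P_vna P_R in \<open>auto simp: H_def\<close>)
  ultimately show ?thesis by blast
qed

end

section \<open>Means and minimal left ideals\<close>

text \<open>Tychonoff's theorem for functionals that are confined pointwise to compact sets.\<close>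

lemma compact_functionals:
  fixes K :: "('i \<Rightarrow> 'b::t2_space) set"
  assumes "closed K" "\<And>m i. m \<in> K \<Longrightarrow> m i \<in> S i" "\<And>i. compact (S i)"
  shows "compact K"
proof -
  have "compactin (product_topology (\<lambda>i. euclidean) UNIV) (PiE UNIV S)"
    unfolding compactin_PiE using assms(3) by simp
  then have "compact (PiE UNIV S)" by (simp add: euclidean_product_topology)
  moreover have "K = PiE UNIV S \<inter> K" using assms(2) by auto
  ultimately show ?thesis using assms(1) by (metis compact_Int_closed)
qed

text \<open>The index type may be uncountable, so the product need not be metrizable; it is still
  Hausdorff.\<close>

lemma compact_imp_closed_functionals:
  fixes K :: "('i \<Rightarrow> 'b::metric_space) set"
  assumes "compact K" shows "closed K"
proof -
  have "Hausdorff_space (product_topology (\<lambda>i::'i. euclidean :: 'b topology) UNIV)"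
    by (metis Hausdorff_space_euclidean Hausdorff_space_product_topology)
  then have "Hausdorff_space (euclidean :: ('i \<Rightarrow> 'b) topology)"
    by (simp add: euclidean_product_topology)
  then show ?thesis using assms compactin_imp_closedin by (metis closed_closedin compactin_euclidean_iff)
qed

lemma continuous_on_eval: "continuous_on S (\<lambda>x. x i)"
  using continuous_on_subset[OF continuous_on_product_coordinates subset_UNIV] .

lemma closed_Collect_ball:
  assumes "\<And>T. T \<in> A \<Longrightarrow> closed {\<omega>. Q T \<omega>}" shows "closed {\<omega>. \<forall>T\<in>A. Q T \<omega>}"
  unfolding Collect_ball_eq using assms by (intro closed_INT) auto

definition bdd_on :: "'i set \<Rightarrow> ('i \<Rightarrow> real) set" where
  "bdd_on I = {f. \<exists>C. \<forall>i\<in>I. \<bar>f i\<bar> \<le> C}"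

text \<open>The index set is a parameter because the same notion serves for means on the group and
  for finite averages. Apart from the clauses, values on unbounded functions are left free.\<close>

definition is_mean :: "'i set \<Rightarrow> (('i \<Rightarrow> real) \<Rightarrow> real) \<Rightarrow> bool" where
  "is_mean I M \<longleftrightarrow>
     (\<forall>f\<in>bdd_on I. \<forall>g\<in>bdd_on I. M (\<lambda>i. f i + g i) = M f + M g) \<and>
     (\<forall>f\<in>bdd_on I. \<forall>c. M (\<lambda>i. c * f i) = c * M f) \<and>
     (\<forall>f\<in>bdd_on I. (\<forall>i\<in>I. 0 \<le> f i) \<longrightarrow> 0 \<le> M f) \<and>
     M (\<lambda>_. 1) = 1"

lemma bdd_onI: "(\<And>i. i \<in> I \<Longrightarrow> \<bar>f i\<bar> \<le> C) \<Longrightarrow> f \<in> bdd_on I"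
  by (auto simp: bdd_on_def)

lemma bdd_on_const [simp]: "(\<lambda>_. c) \<in> bdd_on I"
  by (rule bdd_onI[where C="\<bar>c\<bar>"]) simp

lemma bdd_on_add [simp]: "f \<in> bdd_on I \<Longrightarrow> g \<in> bdd_on I \<Longrightarrow> (\<lambda>i. f i + g i) \<in> bdd_on I"
  unfolding bdd_on_def by (auto intro: order_trans[OF abs_triangle_ineq add_mono])

lemma bdd_on_mult [simp]: "f \<in> bdd_on I \<Longrightarrow> g \<in> bdd_on I \<Longrightarrow> (\<lambda>i. f i * g i) \<in> bdd_on I"
  unfolding bdd_on_def
proof safe
  fix C D assume C: "\<forall>i\<in>I. \<bar>f i\<bar> \<le> C" and D: "\<forall>i\<in>I. \<bar>g i\<bar> \<le> D"
  have "\<bar>f i * g i\<bar> \<le> \<bar>C\<bar> * \<bar>D\<bar>" if "i \<in> I" for i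
    unfolding abs_mult using C D that by (intro mult_mono) force+
  then show "\<exists>C. \<forall>i\<in>I. \<bar>f i * g i\<bar> \<le> C" by blast
qed

lemma bdd_on_scale [simp]: "f \<in> bdd_on I \<Longrightarrow> (\<lambda>i. c * f i) \<in> bdd_on I"
  by (rule bdd_on_mult) simp_all

lemma bdd_on_diff [simp]: "f \<in> bdd_on I \<Longrightarrow> g \<in> bdd_on I \<Longrightarrow> (\<lambda>i. f i - g i) \<in> bdd_on I"
  using bdd_on_add[of f I "\<lambda>i. - 1 * g i"] bdd_on_scale[of g I "- 1"] by simp

lemma bdd_on_cong:
  assumes "f \<in> bdd_on I" "\<And>i. i \<in> I \<Longrightarrow> g i = f i" shows "g \<in> bdd_on I"
  using assms by (auto simp: bdd_on_def)

lemma
  assumes "is_mean I M"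
  shows mean_add: "f \<in> bdd_on I \<Longrightarrow> g \<in> bdd_on I \<Longrightarrow> M (\<lambda>i. f i + g i) = M f + M g"
    and mean_scale: "f \<in> bdd_on I \<Longrightarrow> M (\<lambda>i. c * f i) = c * M f"
    and mean_nonneg: "f \<in> bdd_on I \<Longrightarrow> (\<And>i. i \<in> I \<Longrightarrow> 0 \<le> f i) \<Longrightarrow> 0 \<le> M f"
    and mean_one: "M (\<lambda>_. 1) = 1"
  using assms by (auto simp: is_mean_def)

lemma mean_const: "is_mean I M \<Longrightarrow> M (\<lambda>_. c) = c"
  using mean_scale[of I M "\<lambda>_. 1" c] by (simp add: mean_one)

lemma mean_diff:
  assumes "is_mean I M" "f \<in> bdd_on I" "g \<in> bdd_on I"
  shows "M (\<lambda>i. f i - g i) = M f - M g"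
  using mean_add[OF assms(1,2) bdd_on_scale[OF assms(3), of "- 1"]] mean_scale[OF assms(1,3), of "- 1"] by simp

lemma mean_mono:
  assumes "is_mean I M" "f \<in> bdd_on I" "g \<in> bdd_on I" "\<And>i. i \<in> I \<Longrightarrow> f i \<le> g i"
  shows "M f \<le> M g"
  using mean_nonneg[OF assms(1) bdd_on_diff[OF assms(3,2)]] mean_diff[OF assms(1,3,2)] assms(4) by simp

text \<open>Positivity makes a mean blind to values outside \<open>I\<close>, which matters because
  functions are total.\<close>

lemma mean_cong:
  assumes "is_mean I M" "f \<in> bdd_on I" "\<And>i. i \<in> I \<Longrightarrow> g i = f i"
  shows "M g = M f"
  using mean_mono[OF assms(1) _ _, of f g] mean_mono[OF assms(1) _ _, of g f] bdd_on_cong[OF assms(2,3)] assms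
  by (auto intro: antisym)

lemma mean_le:
  assumes "is_mean I M" "f \<in> bdd_on I" "\<And>i. i \<in> I \<Longrightarrow> f i \<le> C"
  shows "M f \<le> C"
  using mean_mono[OF assms(1,2) bdd_on_const assms(3)] mean_const[OF assms(1)] by simp

lemma mean_abs_le:
  assumes "is_mean I M" "\<And>i. i \<in> I \<Longrightarrow> \<bar>f i\<bar> \<le> C"
  shows "\<bar>M f\<bar> \<le> C"
proof -
  have f: "f \<in> bdd_on I" using assms(2) by (rule bdd_onI)
  have "M f \<le> C" using assms(2) by (intro mean_le[OF assms(1) f]) fastforce
  moreover have "M (\<lambda>i. - 1 * f i) \<le> C"
    using assms(2) by (intro mean_le[OF assms(1) bdd_on_scale[OF f]]) fastforce
  ultimately show ?thesis using mean_scale[OF assms(1) f, of "- 1"] by simp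
qed

lemma is_mean_eval: "a \<in> I \<Longrightarrow> is_mean I (\<lambda>f. f a)"
  by (simp add: is_mean_def)

context group
begin

abbreviation "\<F> \<equiv> bdd_on (carrier G)"

text \<open>The default 0 on unbounded functions makes equality of means equality in HOL and puts
  the set inside a product of compact intervals.\<close>

definition means :: "(('a \<Rightarrow> real) \<Rightarrow> real) set" where
  "means = {m. is_mean (carrier G) m \<and> (\<forall>f. f \<notin> \<F> \<longrightarrow> m f = 0)}"

lemma means_mean: "m \<in> means \<Longrightarrow> is_mean (carrier G) m"
  by (simp add: means_def)

lemma is_mean_restrict: "is_mean (carrier G) m \<Longrightarrow> (\<lambda>f. if f \<in> \<F> then m f else 0) \<in> means"
  by (simp add: means_def is_mean_def)

definition shift :: "'a \<Rightarrow> ('a \<Rightarrow> real) \<Rightarrow> 'a \<Rightarrow> real" where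
  "shift g f = (\<lambda>x. f (g \<otimes> x))"

definition poisson :: "(('a \<Rightarrow> real) \<Rightarrow> real) \<Rightarrow> ('a \<Rightarrow> real) \<Rightarrow> 'a \<Rightarrow> real" where
  "poisson m f = (\<lambda>g. m (shift g f))"

text \<open>Convolution in the manner of the Arens product. For fixed \<open>m\<close> it is
  continuous in \<open>\<mu>\<close>, which makes principal left ideals compact.\<close>

definition convol :: "(('a \<Rightarrow> real) \<Rightarrow> real) \<Rightarrow> (('a \<Rightarrow> real) \<Rightarrow> real) \<Rightarrow> ('a \<Rightarrow> real) \<Rightarrow> real" where
  "convol \<mu> m = (\<lambda>f. if f \<in> \<F> then \<mu> (poisson m f) else 0)"

lemma shift_bdd [simp]: "g \<in> carrier G \<Longrightarrow> f \<in> \<F> \<Longrightarrow> shift g f \<in> \<F>"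
  by (auto simp: bdd_on_def shift_def)

lemma poisson_le:
  assumes "m \<in> means" "\<And>x. x \<in> carrier G \<Longrightarrow> \<bar>f x\<bar> \<le> C" "g \<in> carrier G"
  shows "\<bar>poisson m f g\<bar> \<le> C"
  unfolding poisson_def
  by (rule mean_abs_le[OF means_mean[OF assms(1)]]) (use assms in \<open>simp add: shift_def\<close>)

lemma poisson_bdd [simp]:
  assumes "m \<in> means" "f \<in> \<F>" shows "poisson m f \<in> \<F>"
proof -
  obtain C where C: "\<forall>x\<in>carrier G. \<bar>f x\<bar> \<le> C" using assms by (auto simp: bdd_on_def)
  show ?thesis by (rule bdd_onI[where C=C], rule poisson_le[OF assms(1)]) (use C in auto)
qed

lemma convol_means [simp]:
  assumes \<mu>: "\<mu> \<in> means" and m: "m \<in> means" shows "convol \<mu> m \<in> means"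
  unfolding convol_def
proof (rule is_mean_restrict)
  note \<mu>' = means_mean[OF \<mu>] and m' = means_mean[OF m]
  show "is_mean (carrier G) (\<lambda>f. \<mu> (poisson m f))"
    unfolding is_mean_def
  proof (intro conjI ballI allI impI)
    fix f g assume fg: "f \<in> \<F>" "g \<in> \<F>"
    have "\<mu> (poisson m (\<lambda>i. f i + g i)) = \<mu> (\<lambda>i. poisson m f i + poisson m g i)"
    proof (rule mean_cong[OF \<mu>'])
      show "(\<lambda>i. poisson m f i + poisson m g i) \<in> \<F>" using fg m by simp
      show "poisson m (\<lambda>i. f i + g i) i = poisson m f i + poisson m g i" if "i \<in> carrier G" for i
        using mean_add[OF m' shift_bdd[OF that fg(1)] shift_bdd[OF that fg(2)]]
        by (simp add: poisson_def shift_def)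
    qed
    then show "\<mu> (poisson m (\<lambda>i. f i + g i)) = \<mu> (poisson m f) + \<mu> (poisson m g)"
      using mean_add[OF \<mu>'] fg m by simp
  next
    fix f c assume f: "f \<in> \<F>"
    have "\<mu> (poisson m (\<lambda>i. c * f i)) = \<mu> (\<lambda>i. c * poisson m f i)"
    proof (rule mean_cong[OF \<mu>'])
      show "(\<lambda>i. c * poisson m f i) \<in> \<F>" using f m by simp
      show "poisson m (\<lambda>i. c * f i) i = c * poisson m f i" if "i \<in> carrier G" for i
        using mean_scale[OF m' shift_bdd[OF that f]] by (simp add: poisson_def shift_def)
    qed
    then show "\<mu> (poisson m (\<lambda>i. c * f i)) = c * \<mu> (poisson m f)"
      using mean_scale[OF \<mu>'] f m by simp
  next
    fix f assume f: "f \<in> \<F>" "\<forall>i\<in>carrier G. 0 \<le> f i"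
    show "0 \<le> \<mu> (poisson m f)"
    proof (rule mean_nonneg[OF \<mu>' poisson_bdd[OF m f(1)]])
      show "0 \<le> poisson m f g" if "g \<in> carrier G" for g
        unfolding poisson_def by (rule mean_nonneg[OF m' shift_bdd[OF that f(1)]]) (use f(2) that in \<open>simp add: shift_def\<close>)
    qed
  next
    show "\<mu> (poisson m (\<lambda>_. 1)) = 1"
      by (simp add: poisson_def shift_def mean_one[OF m'] mean_one[OF \<mu>'])
  qed
qed

lemma convol_apply: "f \<in> \<F> \<Longrightarrow> convol \<mu> m f = \<mu> (poisson m f)"
  by (simp add: convol_def)

lemma poisson_shift:
  assumes "m \<in> means" "f \<in> \<F>" "g \<in> carrier G" "h \<in> carrier G"
  shows "poisson m (shift g f) h = poisson m f (g \<otimes> h)"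
  unfolding poisson_def
  by (rule mean_cong[OF means_mean[OF assms(1)]]) (use assms in simp, use assms in \<open>simp add: shift_def m_assoc\<close>)

lemma convol_assoc:
  assumes "\<mu> \<in> means" "\<nu> \<in> means" "m \<in> means"
  shows "convol (convol \<mu> \<nu>) m = convol \<mu> (convol \<nu> m)"
proof
  fix f
  show "convol (convol \<mu> \<nu>) m f = convol \<mu> (convol \<nu> m) f"
  proof (cases "f \<in> \<F>")
    case True
    have "\<mu> (poisson (convol \<nu> m) f) = \<mu> (poisson \<nu> (poisson m f))"
    proof (rule mean_cong[OF means_mean[OF assms(1)]])
      fix g assume g: "g \<in> carrier G"
      have "poisson (convol \<nu> m) f g = \<nu> (poisson m (shift g f))"
        using g True by (simp add: poisson_def[of "convol \<nu> m"] convol_apply)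
      also have "\<dots> = \<nu> (shift g (poisson m f))"
      proof (rule mean_cong[OF means_mean[OF assms(2)]])
        show "shift g (poisson m f) \<in> \<F>" using g True assms by simp
        show "poisson m (shift g f) h = shift g (poisson m f) h" if "h \<in> carrier G" for h
          using poisson_shift[OF assms(3) True g that] by (simp add: shift_def[of g "poisson m f"])
      qed
      finally show "poisson (convol \<nu> m) f g = poisson \<nu> (poisson m f) g"
        by (simp add: poisson_def[of \<nu>])
    qed (use True assms in simp)
    then show ?thesis using True assms by (simp add: convol_apply)
  qed (simp add: convol_def)
qed

lemma closed_means: "closed means"
proof -
  have c: "closed {m :: ('a \<Rightarrow> real) \<Rightarrow> real. m f = a}" for f a
    by (intro closed_Collect_eq continuous_intros continuous_on_eval)
  have "means = {m. \<forall>f\<in>\<F>. \<forall>g\<in>\<F>. m (\<lambda>i. f i + g i) = m f + m g} \<inter>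
     {m. \<forall>f\<in>\<F>. \<forall>c. m (\<lambda>i. c * f i) = c * m f} \<inter>
     {m. \<forall>f\<in>{f \<in> \<F>. \<forall>i\<in>carrier G. 0 \<le> f i}. 0 \<le> m f} \<inter> {m. m (\<lambda>_. 1) = 1} \<inter> {m. \<forall>f\<in>- \<F>. m f = 0}"
    unfolding means_def is_mean_def by blast
  moreover have "closed \<dots>"
    by (intro closed_Int closed_Collect_ball closed_Collect_all closed_Collect_eq closed_Collect_le
        continuous_intros continuous_on_eval)
  ultimately show ?thesis by simp
qed

lemma compact_means: "compact means"
proof (rule compact_functionals[OF closed_means])
  define C where "C f = (SOME C. \<forall>x\<in>carrier G. \<bar>f x\<bar> \<le> C)" for f :: "'a \<Rightarrow> real"
  fix m f assume m: "m \<in> means"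
  show "m f \<in> (if f \<in> \<F> then {- C f..C f} else {0})"
  proof (cases "f \<in> \<F>")
    case True
    then have "\<forall>x\<in>carrier G. \<bar>f x\<bar> \<le> C f" unfolding bdd_on_def C_def mem_Collect_eq by (rule someI_ex)
    then have "\<bar>m f\<bar> \<le> C f" using mean_abs_le[OF means_mean[OF m], of f "C f"] by blast
    then show ?thesis using True by auto
  qed (use m in \<open>simp add: means_def\<close>)
qed auto

lemma eval_means: "a \<in> carrier G \<Longrightarrow> (\<lambda>f. if f \<in> \<F> then f a else 0) \<in> means"
  by (intro is_mean_restrict is_mean_eval)

definition left_ideal :: "(('a \<Rightarrow> real) \<Rightarrow> real) set \<Rightarrow> bool" where
  "left_ideal L \<longleftrightarrow> L \<noteq> {} \<and> L \<subseteq> means \<and> (\<forall>\<mu>\<in>means. \<forall>m\<in>L. convol \<mu> m \<in> L)"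

text \<open>Zorn's lemma for closed left ideals; compactness keeps the intersection of a chain
  nonempty. Principal left ideals are compact, hence closed, so by minimality each element of
  \<open>K\<close> generates all of \<open>K\<close>.\<close>

lemma minimal_left_ideal:
  obtains K where "left_ideal K" "\<And>m k. m \<in> K \<Longrightarrow> k \<in> K \<Longrightarrow> \<exists>\<mu>\<in>means. k = convol \<mu> m"
proof -
  define \<A> where "\<A> = {L. closed L \<and> left_ideal L}"
  \<comment> \<open>Complements reverse inclusions, so that a maximal element yields a minimal
    ideal.\<close>
  have "\<exists>M\<in>uminus ` \<A>. \<forall>X\<in>uminus ` \<A>. M \<subseteq> X \<longrightarrow> X = M"
  proof (rule subset_Zorn_nonempty)
    have "means \<in> \<A>" using eval_means[OF one_closed] by (auto simp: \<A>_def left_ideal_def closed_means)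
    then show "uminus ` \<A> \<noteq> {}" by blast
    fix \<C> assume \<C>: "\<C> \<noteq> {}" "subset.chain (uminus ` \<A>) \<C>"
    define \<D> where "\<D> = uminus ` \<C>"
    have \<D>A: "\<D> \<subseteq> \<A>" using \<C>(2) by (auto simp: \<D>_def subset.chain_def)
    have chain: "L \<subseteq> L' \<or> L' \<subseteq> L" if "L \<in> \<D>" "L' \<in> \<D>" for L L'
      using that \<C>(2) unfolding \<D>_def subset_chain_def by blast
    have "means \<inter> \<Inter>\<D> \<noteq> {}"
    proof (rule compact_imp_fip[OF compact_means])
      show "closed T" if "T \<in> \<D>" for T using that \<D>A by (auto simp: \<A>_def)
      fix F assume "finite F" "F \<subseteq> \<D>"
      \<comment> \<open>A nonempty finite subfamily of a chain contains its own
        intersection.\<close>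
      then have "F = {} \<or> \<Inter>F \<in> F"
      proof (induction F)
        case (insert a F)
        show ?case
        proof (cases "F = {}")
          case False
          then have "\<Inter>F \<in> F" using insert by blast
          then have "a \<subseteq> \<Inter>F \<or> \<Inter>F \<subseteq> a" using chain insert by blast
          then have "a \<inter> \<Inter>F = a \<or> a \<inter> \<Inter>F = \<Inter>F" by blast
          then show ?thesis using \<open>\<Inter>F \<in> F\<close> by auto
        qed simp
      qed simp
      then show "means \<inter> \<Inter>F \<noteq> {}"
      proof
        assume "\<Inter>F \<in> F"
        then have "left_ideal (\<Inter>F)" using \<open>F \<subseteq> \<D>\<close> \<D>A by (auto simp: \<A>_def)
        then show ?thesis by (auto simp: left_ideal_def)
      qed (use eval_means[OF one_closed] in auto)
    qed
    moreover obtain L where L: "L \<in> \<D>" using \<C>(1) unfolding \<D>_def by blast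
    moreover have id: "left_ideal L" "closed L" if "L \<in> \<D>" for L using that \<D>A unfolding \<A>_def by blast+
    ultimately have "left_ideal (\<Inter>\<D>)" unfolding left_ideal_def by blast
    moreover have "closed (\<Inter>\<D>)" using id by (intro closed_Inter) blast
    ultimately have "\<Inter>\<D> \<in> \<A>" unfolding \<A>_def by blast
    moreover have "\<Union>\<C> = - \<Inter>\<D>" by (auto simp: \<D>_def)
    ultimately show "\<Union>\<C> \<in> uminus ` \<A>" by blast
  qed
  then obtain K where K: "K \<in> \<A>" and min: "\<And>L. L \<in> \<A> \<Longrightarrow> L \<subseteq> K \<Longrightarrow> L = K"
    by (metis (no_types, lifting) Compl_subset_Compl_iff double_complement image_iff)
  have lK: "left_ideal K" using K by (simp add: \<A>_def)
  have "\<exists>\<mu>\<in>means. k = convol \<mu> m" if "m \<in> K" "k \<in> K" for m k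
  proof -
    let ?L = "(\<lambda>\<mu>. convol \<mu> m) ` means"
    have m: "m \<in> means" using lK that by (auto simp: left_ideal_def)
    have "continuous_on means (\<lambda>\<mu>. convol \<mu> m f)" for f
      by (cases "f \<in> \<F>") (auto simp: convol_def intro: continuous_on_eval)
    then have "compact ?L"
      by (intro compact_continuous_image[OF _ compact_means] continuous_on_coordinatewise_then_product)
    then have "closed ?L" by (rule compact_imp_closed_functionals)
    moreover have "left_ideal ?L"
      unfolding left_ideal_def
    proof (intro conjI ballI)
      show "?L \<noteq> {}" using m by blast
      show "?L \<subseteq> means" using m by auto
      fix \<nu> l assume "\<nu> \<in> means" "l \<in> ?L"
      then show "convol \<nu> l \<in> ?L" using m by (auto simp flip: convol_assoc)
    qed
    moreover have "?L \<subseteq> K" using lK that by (auto simp: left_ideal_def)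
    ultimately have "?L = K" by (intro min) (simp_all add: \<A>_def)
    then show ?thesis using that by blast
  qed
  then show ?thesis using that lK by blast
qed

text \<open>The translate is the convolution with the point evaluation at \<open>g\<close>, so it
  stays in the ideal.\<close>

lemma left_ideal_translate:
  assumes K: "left_ideal K" and m: "m \<in> K" and g: "g \<in> carrier G"
  obtains m' where "m' \<in> K" "\<And>f. f \<in> \<F> \<Longrightarrow> m' f = m (shift g f)"
proof
  let ?m = "convol (\<lambda>f. if f \<in> \<F> then f g else 0) m"
  show "?m \<in> K" using K m eval_means[OF g] by (auto simp: left_ideal_def)
  show "?m f = m (shift g f)" if "f \<in> \<F>" for f
  proof -
    have "m \<in> means" using K m by (auto simp: left_ideal_def)
    then show ?thesis using that by (simp add: convol_apply) (simp add: poisson_def)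
  qed
qed

section \<open>Elements fixing a left ideal pointwise, and amenability\<close>

definition fixator :: "(('a \<Rightarrow> real) \<Rightarrow> real) set \<Rightarrow> 'a set" where
  "fixator K = {h \<in> carrier G. \<forall>m\<in>K. \<forall>f\<in>\<F>. m (shift h f) = m f}"

lemma fixatorD: "h \<in> fixator K \<Longrightarrow> m \<in> K \<Longrightarrow> f \<in> \<F> \<Longrightarrow> m (shift h f) = m f"
  unfolding fixator_def by blast

lemma fixator_normal:
  assumes K: "left_ideal K" shows "fixator K \<lhd> G"
proof -
  have mean: "is_mean (carrier G) m" if "m \<in> K" for m
    using K that by (auto simp: left_ideal_def means_mean)
  have sh: "m (shift (g \<otimes> h) f) = m (shift h (shift g f))" if "m \<in> K" "f \<in> \<F>" "g \<in> carrier G" "h \<in> carrier G" for m f g h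
    by (rule mean_cong[OF mean[OF that(1)]]) (use that in simp, use that in \<open>simp add: shift_def m_assoc\<close>)
  have one: "m (shift \<one> f) = m f" if "m \<in> K" "f \<in> \<F>" for m f
    by (rule mean_cong[OF mean[OF that(1)] that(2)]) (simp add: shift_def)
  have "subgroup (fixator K) G"
  proof
    show "fixator K \<subseteq> carrier G" by (auto simp: fixator_def)
    show "\<one> \<in> fixator K" by (simp add: fixator_def one)
    show "x \<otimes> y \<in> fixator K" if xy: "x \<in> fixator K" "y \<in> fixator K" for x y
    proof -
      have c: "x \<in> carrier G" "y \<in> carrier G" using xy by (auto simp: fixator_def)
      have "m (shift (x \<otimes> y) f) = m f" if "m \<in> K" "f \<in> \<F>" for m f
        using sh[OF that c] fixatorD[OF xy(2) that(1), of "shift x f"] fixatorD[OF xy(1) that] c that by simp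
      then show ?thesis using c by (simp add: fixator_def)
    qed
    show "inv x \<in> fixator K" if x: "x \<in> fixator K" for x
    proof -
      have xc: "x \<in> carrier G" using x by (simp add: fixator_def)
      have "m (shift (inv x) f) = m f" if m: "m \<in> K" and f: "f \<in> \<F>" for m f
      proof -
        have "m (shift (inv x) f) = m (shift x (shift (inv x) f))"
          using fixatorD[OF x m shift_bdd[OF _ f], of "inv x"] xc by simp
        also have "\<dots> = m f" using sh[OF m f, of "inv x" x] one[OF m f] xc by simp
        finally show ?thesis .
      qed
      then show ?thesis using xc by (simp add: fixator_def)
    qed
  qed
  moreover have "g \<otimes> h \<otimes> inv g \<in> fixator K" if g: "g \<in> carrier G" and h: "h \<in> fixator K" for g h
  proof -
    have hc: "h \<in> carrier G" using h by (simp add: fixator_def)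
    have "m (shift (g \<otimes> h \<otimes> inv g) f) = m f" if m: "m \<in> K" and f: "f \<in> \<F>" for m f
    proof -
      \<comment> \<open>Conjugation by \<open>g\<close> moves the question to the translate
        \<open>m'\<close> of \<open>m\<close>, which is again in \<open>K\<close>.\<close>
      obtain m' where m': "m' \<in> K" "\<And>f. f \<in> \<F> \<Longrightarrow> m' f = m (shift (inv g) f)"
        using left_ideal_translate[OF K m, of "inv g"] g by blast
      have "m (shift (g \<otimes> h \<otimes> inv g) f) = m (shift (inv g) (shift (g \<otimes> h) f))"
        using sh[OF m f] g hc by simp
      also have "\<dots> = m' (shift h (shift g f))" using m' sh[OF m'(1) f] g hc f by simp
      also have "\<dots> = m' (shift g f)" by (rule fixatorD[OF h m'(1) shift_bdd[OF g f]])
      also have "\<dots> = m (shift (inv g) (shift g f))" using m' g f by simp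
      also have "\<dots> = m f" using sh[OF m f, of g "inv g"] one[OF m f] g by simp
      finally show ?thesis .
    qed
    then show ?thesis using g hc by (simp add: fixator_def)
  qed
  ultimately show ?thesis by (simp add: normal_inv_iff)
qed

text \<open>A transversal for the right cosets of \<open>N\<close> gives an
  \<open>N\<close>-equivariant map from \<open>G\<close> to \<open>N\<close>, along which the fixed
  mean is pushed forward.\<close>

lemma amenable_of_fixed_mean:
  assumes N: "subgroup N G" and m: "m \<in> means"
    and fixed: "\<And>h f. h \<in> N \<Longrightarrow> f \<in> \<F> \<Longrightarrow> m (shift h f) = m f"
  shows "amenable_group (G\<lparr>carrier := N\<rparr>)"
proof -
  \<comment> \<open>The representative depends only on the right coset of \<open>x\<close>, so left
    multiplication by \<open>N\<close> does not change it.\<close>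
  define r where "r x = (SOME y. y \<in> carrier G \<and> x \<otimes> inv y \<in> N)" for x
  have r: "r x \<in> carrier G" "x \<otimes> inv (r x) \<in> N" if "x \<in> carrier G" for x
    using someI[of "\<lambda>y. y \<in> carrier G \<and> x \<otimes> inv y \<in> N" x] that subgroup.one_closed[OF N]
    by (auto simp: r_def)
  have Nc: "s \<in> carrier G" if "s \<in> N" for s using N that by (rule subgroup.mem_carrier)
  have rN: "r (s \<otimes> x) = r x" if s: "s \<in> N" and x: "x \<in> carrier G" for s x
  proof -
    have "s \<otimes> x \<otimes> inv y \<in> N \<longleftrightarrow> x \<otimes> inv y \<in> N" if y: "y \<in> carrier G" for y
    proof
      assume "s \<otimes> x \<otimes> inv y \<in> N"
      then have "inv s \<otimes> (s \<otimes> x \<otimes> inv y) \<in> N"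
        by (rule subgroup.m_closed[OF N subgroup.m_inv_closed[OF N s]])
      then show "x \<otimes> inv y \<in> N" using Nc[OF s] x y by (simp flip: m_assoc)
    next
      assume "x \<otimes> inv y \<in> N"
      then have "s \<otimes> (x \<otimes> inv y) \<in> N" by (rule subgroup.m_closed[OF N s])
      then show "s \<otimes> x \<otimes> inv y \<in> N" using Nc[OF s] x y by (simp add: m_assoc)
    qed
    then have "(\<lambda>y. y \<in> carrier G \<and> s \<otimes> x \<otimes> inv y \<in> N) = (\<lambda>y. y \<in> carrier G \<and> x \<otimes> inv y \<in> N)" by blast
    then show ?thesis by (simp add: r_def)
  qed
  define ext where "ext f = (\<lambda>x. f (x \<otimes> inv (r x)) :: real)" for f
  have bf: "bounded_funs (G\<lparr>carrier := N\<rparr>) = bdd_on N"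
    by (auto simp: bounded_funs_def bdd_on_def bounded_iff)
  have ext: "ext f \<in> \<F>" if "f \<in> bdd_on N" for f
    using that r by (auto simp: bdd_on_def ext_def)
  note M = means_mean[OF m]
  have "left_invariant_mean (G\<lparr>carrier := N\<rparr>) (\<lambda>f. m (ext f))"
    unfolding left_invariant_mean_def bf
  proof (intro conjI ballI allI impI)
    fix f g assume fg: "f \<in> bdd_on N" "g \<in> bdd_on N"
    show "m (ext (\<lambda>x. f x + g x)) = m (ext f) + m (ext g)"
      using mean_add[OF M ext[OF fg(1)] ext[OF fg(2)]] by (simp add: ext_def)
  next
    fix f c assume f: "f \<in> bdd_on N"
    show "m (ext (\<lambda>x. c * f x)) = c * m (ext f)"
      using mean_scale[OF M ext[OF f]] by (simp add: ext_def)
  next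
    fix f assume f: "f \<in> bdd_on N" "\<forall>x\<in>carrier (G\<lparr>carrier := N\<rparr>). 0 \<le> f x"
    show "0 \<le> m (ext f)"
      by (rule mean_nonneg[OF M ext[OF f(1)]]) (use f(2) r in \<open>simp add: ext_def\<close>)
  next
    show "m (ext (\<lambda>_. 1)) = 1" using mean_one[OF M] by (simp add: ext_def)
  next
    fix f s assume f: "f \<in> bdd_on N" and "s \<in> carrier (G\<lparr>carrier := N\<rparr>)"
    then have s: "s \<in> N" by simp
    have "m (ext (\<lambda>x. f (s \<otimes> x))) = m (shift s (ext f))"
    proof (rule mean_cong[OF M shift_bdd[OF Nc[OF s] ext[OF f]]])
      show "ext (\<lambda>x. f (s \<otimes> x)) x = shift s (ext f) x" if "x \<in> carrier G" for x
        using that r[OF that] Nc[OF s] rN[OF s that] by (simp add: ext_def shift_def m_assoc)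
    qed
    also have "\<dots> = m (ext f)" by (rule fixed[OF s ext[OF f]])
    finally show "m (ext (\<lambda>x. f (s \<otimes>\<^bsub>G\<lparr>carrier := N\<rparr>\<^esub> x))) = m (ext f)" by simp
  qed
  then show ?thesis unfolding amenable_group_def by blast
qed

lemma fixator_trivial:
  assumes "is_amenable_radical G {\<one>}" "left_ideal K" shows "fixator K \<subseteq> {\<one>}"
proof -
  have n: "fixator K \<lhd> G" using assms(2) by (rule fixator_normal)
  obtain m where m: "m \<in> K" "m \<in> means" using assms(2) by (auto simp: left_ideal_def)
  have "amenable_group (G\<lparr>carrier := fixator K\<rparr>)"
    by (rule amenable_of_fixed_mean[OF normal_imp_subgroup[OF n] m(2)]) (rule fixatorD[OF _ m(1)])
  then show ?thesis using assms(1) n unfolding is_amenable_radical_def by blast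
qed

end

section \<open>States extending the trace\<close>

definition cmean :: "(('i \<Rightarrow> real) \<Rightarrow> real) \<Rightarrow> ('i \<Rightarrow> complex) \<Rightarrow> complex" where
  "cmean M f = Complex (M (\<lambda>i. Re (f i))) (M (\<lambda>i. Im (f i)))"

lemma bdd_on_Re_Im:
  assumes "\<And>i. i \<in> I \<Longrightarrow> cmod (f i) \<le> C"
  shows "(\<lambda>i. Re (f i)) \<in> bdd_on I" "(\<lambda>i. Im (f i)) \<in> bdd_on I"
  using assms abs_Re_le_cmod abs_Im_le_cmod by (blast intro: bdd_onI order_trans)+

lemma cmean_add:
  assumes "is_mean I M" "\<And>i. i \<in> I \<Longrightarrow> cmod (f i) \<le> C" "\<And>i. i \<in> I \<Longrightarrow> cmod (g i) \<le> D"
  shows "cmean M (\<lambda>i. f i + g i) = cmean M f + cmean M g"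
  using mean_add[OF assms(1) bdd_on_Re_Im(1)[OF assms(2)] bdd_on_Re_Im(1)[OF assms(3)]]
    mean_add[OF assms(1) bdd_on_Re_Im(2)[OF assms(2)] bdd_on_Re_Im(2)[OF assms(3)]]
  by (simp add: cmean_def complex_eq_iff)

lemma cmean_scale:
  assumes M: "is_mean I M" and f: "\<And>i. i \<in> I \<Longrightarrow> cmod (f i) \<le> C"
  shows "cmean M (\<lambda>i. c * f i) = c * cmean M f"
proof -
  note b = bdd_on_Re_Im[OF f]
  note s = bdd_on_scale[OF b(1)] bdd_on_scale[OF b(2)]
  show ?thesis
    using mean_diff[OF M s(1)[where c="Re c"] s(2)[where c="Im c"]] mean_add[OF M s(2)[where c="Re c"] s(1)[where c="Im c"]]
      mean_scale[OF M b(1)] mean_scale[OF M b(2)]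
    by (simp add: cmean_def complex_eq_iff)
qed

text \<open>Multiplication by a phase makes the value real and nonnegative, which reduces the bound
  to the real mean.\<close>

lemma cmean_norm_le:
  assumes M: "is_mean I M" and f: "\<And>i. i \<in> I \<Longrightarrow> cmod (f i) \<le> C" and "0 \<le> C"
  shows "cmod (cmean M f) \<le> C"
proof (cases "cmean M f = 0")
  case False
  define u where "u = cnj (cmean M f) / of_real (cmod (cmean M f))"
  have u: "cmod u = 1" using False by (simp add: u_def norm_divide)
  have "cnj (cmean M f) * cmean M f = of_real (cmod (cmean M f)) * of_real (cmod (cmean M f))"
    using complex_norm_square[of "cmean M f"] by (simp add: power2_eq_square mult.commute)
  then have "of_real (cmod (cmean M f)) = u * cmean M f" using False by (simp add: u_def)
  moreover have "cmean M (\<lambda>i. u * f i) = u * cmean M f" by (rule cmean_scale[OF M f])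
  ultimately have "Re (of_real (cmod (cmean M f))) = Re (cmean M (\<lambda>i. u * f i))" by simp
  then have "cmod (cmean M f) = Re (cmean M (\<lambda>i. u * f i))" by simp
  also have "\<dots> = M (\<lambda>i. Re (u * f i))" by (simp only: cmean_def complex.sel)
  also have "\<dots> \<le> C"
  proof (rule mean_le[OF M])
    have uf: "cmod (u * f i) \<le> C" if "i \<in> I" for i using f[OF that] u by (simp add: norm_mult)
    show "(\<lambda>i. Re (u * f i)) \<in> bdd_on I" by (rule bdd_on_Re_Im(1)) (rule uf)
    show "Re (u * f i) \<le> C" if "i \<in> I" for i
      using uf[OF that] complex_Re_le_cmod order_trans by blast
  qed
  finally show ?thesis .
qed (use assms in simp)

lemma cmean_cong:
  assumes "is_mean I M" "\<And>i. i \<in> I \<Longrightarrow> cmod (f i) \<le> C" "\<And>i. i \<in> I \<Longrightarrow> g i = f i"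
  shows "cmean M g = cmean M f"
  using mean_cong[OF assms(1) bdd_on_Re_Im(1)[OF assms(2)], where g="\<lambda>i. Re (g i)"]
    mean_cong[OF assms(1) bdd_on_Re_Im(2)[OF assms(2)], where g="\<lambda>i. Im (g i)"] assms(3)
  by (simp add: cmean_def)

lemma cmean_const: "is_mean I M \<Longrightarrow> cmean M (\<lambda>_. c) = c"
  by (simp add: cmean_def mean_const)

lemma cmean_nonneg:
  assumes "is_mean I M" "\<And>i. i \<in> I \<Longrightarrow> cmod (f i) \<le> C" "\<And>i. i \<in> I \<Longrightarrow> f i \<in> \<real>\<^sub>\<ge>\<^sub>0"
  shows "cmean M f \<in> \<real>\<^sub>\<ge>\<^sub>0"
proof -
  have "M (\<lambda>i. Im (f i)) = M (\<lambda>i. 0)"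
    by (rule mean_cong[OF assms(1) bdd_on_const]) (use assms(3) in \<open>simp add: complex_nonneg_Reals_iff\<close>)
  then show ?thesis
    using mean_nonneg[OF assms(1) bdd_on_Re_Im(1)[OF assms(2)]] assms(3) mean_const[OF assms(1), of 0]
    by (simp add: cmean_def complex_nonneg_Reals_iff)
qed

context group
begin

text \<open>
  These are the states on \<open>\<B>\<close> that extend the trace \<open>\<tau>\<close>. The norm bound is part of the definition because
  it confines \<open>states\<close> to a product of compact discs.
\<close>

definition states :: "('a operator \<Rightarrow> complex) set" where
  "states = {\<omega>. (\<forall>T\<in>- \<B>. \<omega> T = 0) \<and>
     (\<forall>S\<in>\<B>. \<forall>T\<in>\<B>. \<omega> (\<lambda>f x. S f x + T f x) = \<omega> S + \<omega> T) \<and>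
     (\<forall>T\<in>\<B>. \<forall>c. \<omega> (\<lambda>f x. c * T f x) = c * \<omega> T) \<and>
     (\<forall>T\<in>\<B>. \<omega> (adj T \<circ> T) \<in> \<real>\<^sub>\<ge>\<^sub>0) \<and>
     (\<forall>T\<in>\<B>. \<forall>C\<in>{C. op_le T C}. cmod (\<omega> T) \<le> C) \<and>
     (\<forall>x\<in>\<R>. \<omega> x = \<tau> x)}"

lemma
  assumes "\<omega> \<in> states"
  shows state_outside: "T \<notin> \<B> \<Longrightarrow> \<omega> T = 0"
    and state_add: "S \<in> \<B> \<Longrightarrow> T \<in> \<B> \<Longrightarrow> \<omega> (\<lambda>f x. S f x + T f x) = \<omega> S + \<omega> T"
    and state_scale: "T \<in> \<B> \<Longrightarrow> \<omega> (\<lambda>f x. c * T f x) = c * \<omega> T"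
    and state_nonneg: "T \<in> \<B> \<Longrightarrow> \<omega> (adj T \<circ> T) \<in> \<real>\<^sub>\<ge>\<^sub>0"
    and state_le: "T \<in> \<B> \<Longrightarrow> op_le T C \<Longrightarrow> cmod (\<omega> T) \<le> C"
    and state_tau: "x \<in> \<R> \<Longrightarrow> \<omega> x = \<tau> x"
  using assms unfolding states_def by blast+

lemma statesI:
  assumes "\<And>T. T \<notin> \<B> \<Longrightarrow> \<omega> T = 0"
    "\<And>S T. S \<in> \<B> \<Longrightarrow> T \<in> \<B> \<Longrightarrow> \<omega> (\<lambda>f x. S f x + T f x) = \<omega> S + \<omega> T"
    "\<And>T c. T \<in> \<B> \<Longrightarrow> \<omega> (\<lambda>f x. c * T f x) = c * \<omega> T"
    "\<And>T. T \<in> \<B> \<Longrightarrow> \<omega> (adj T \<circ> T) \<in> \<real>\<^sub>\<ge>\<^sub>0"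
    "\<And>T C. T \<in> \<B> \<Longrightarrow> op_le T C \<Longrightarrow> cmod (\<omega> T) \<le> C"
    "\<And>x. x \<in> \<R> \<Longrightarrow> \<omega> x = \<tau> x"
  shows "\<omega> \<in> states"
  using assms unfolding states_def by blast

lemma closed_states: "closed states"
proof -
  have pos: "closed {\<omega> :: 'a operator \<Rightarrow> complex. \<omega> X \<in> \<real>\<^sub>\<ge>\<^sub>0}" for X
    using closed_vimage[OF closed_nonneg_Reals_complex continuous_on_product_coordinates[of X]]
    by (simp add: vimage_def)
  show ?thesis
    unfolding states_def
    by (intro closed_Collect_conj closed_Collect_ball closed_Collect_all closed_Collect_eq closed_Collect_le
        pos continuous_intros continuous_on_eval)
qed

lemma compact_if_cball: "compact (if b then cball (0 :: complex) r else {0})"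
  by (cases b) simp_all

lemma compact_states: "compact states"
proof (rule compact_functionals[where S="\<lambda>T. if T \<in> \<B> then cball 0 (SOME C. op_le T C) else {0}", OF closed_states])
  fix \<omega> T assume \<omega>: "\<omega> \<in> states"
  show "\<omega> T \<in> (if T \<in> \<B> then cball 0 (SOME C. op_le T C) else {0})"
  proof (cases "T \<in> \<B>")
    case True
    then have "op_le T (SOME C. op_le T C)" by (metis bop_op_le someI_ex)
    then show ?thesis using True state_le[OF \<omega> True] by simp
  next
    case False
    then show ?thesis using state_outside[OF \<omega> False] by simp
  qed
qed (rule compact_if_cball)

lemma vector_state: "(\<lambda>T. if T \<in> \<B> then \<tau> T else 0) \<in> states"
proof (rule statesI)
  fix T assume T: "T \<in> \<B>"
  have "\<tau> (adj T \<circ> T) = ip (delta \<one>) (adj T (hat T))" by (simp add: tau_ip del: ip_delta_left)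
  also have "\<dots> = ip (hat T) (hat T)" using T by (simp only: adj_right delta_ell2 bop_ell2)
  also have "\<dots> = of_real ((nrm (hat T))\<^sup>2)" using T by (simp only: ip_self bop_ell2)
  finally have "\<tau> (adj T \<circ> T) = of_real ((nrm (hat T))\<^sup>2)" .
  then show "(if adj T \<circ> T \<in> \<B> then \<tau> (adj T \<circ> T) else 0) \<in> \<real>\<^sub>\<ge>\<^sub>0"
    using T by (simp only: bop_comp adj_bop if_True nonneg_Reals_of_real_iff zero_le_power2)
  fix C assume "op_le T C"
  then have "nrm (hat T) \<le> C" using op_leD[of T C "delta \<one>"] by (simp add: nrm_delta)
  then show "cmod (if T \<in> \<B> then \<tau> T else 0) \<le> C"
    using cmod_le_nrm[OF bop_ell2[OF T], of "delta \<one>" \<one>] T by (simp add: \<tau>_def)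
qed (simp_all add: \<tau>_def)

text \<open>The norm clause in \<open>states\<close> bounds the family at each operator, so the mean
  may be applied pointwise.\<close>

lemma averaged_state:
  assumes M: "is_mean I M" and \<omega>: "\<And>i. i \<in> I \<Longrightarrow> \<omega> i \<in> states"
  shows "(\<lambda>T. if T \<in> \<B> then cmean M (\<lambda>i. \<omega> i T) else 0) \<in> states"
proof (rule statesI)
  fix S T assume S: "S \<in> \<B>" and T: "T \<in> \<B>"
  obtain D where "op_le S D" using S by (metis bop_op_le)
  then have D: "cmod (\<omega> i S) \<le> D" if "i \<in> I" for i using state_le[OF \<omega>[OF that] S] by simp
  obtain E where "op_le T E" using T by (metis bop_op_le)
  then have E: "cmod (\<omega> i T) \<le> E" if "i \<in> I" for i using state_le[OF \<omega>[OF that] T] by simp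
  have "cmean M (\<lambda>i. \<omega> i (\<lambda>f x. S f x + T f x)) = cmean M (\<lambda>i. \<omega> i S + \<omega> i T)"
  proof (rule cmean_cong[OF M])
    show "cmod (\<omega> i S + \<omega> i T) \<le> D + E" if "i \<in> I" for i
      by (rule order_trans[OF norm_triangle_ineq add_mono[OF D[OF that] E[OF that]]])
  qed (simp add: state_add[OF \<omega> S T])
  then show "(if (\<lambda>f x. S f x + T f x) \<in> \<B> then cmean M (\<lambda>i. \<omega> i (\<lambda>f x. S f x + T f x)) else 0) =
    (if S \<in> \<B> then cmean M (\<lambda>i. \<omega> i S) else 0) + (if T \<in> \<B> then cmean M (\<lambda>i. \<omega> i T) else 0)"
    using S T cmean_add[OF M D E] by simp
next
  fix T c assume T: "T \<in> \<B>"
  obtain E where "op_le T E" using T by (metis bop_op_le)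
  then have E: "cmod (\<omega> i T) \<le> E" if "i \<in> I" for i using state_le[OF \<omega>[OF that] T] by simp
  have "cmean M (\<lambda>i. \<omega> i (\<lambda>f x. c * T f x)) = cmean M (\<lambda>i. c * \<omega> i T)"
  proof (rule cmean_cong[OF M])
    show "cmod (c * \<omega> i T) \<le> cmod c * E" if "i \<in> I" for i
      using E[OF that] by (simp add: norm_mult mult_left_mono)
  qed (simp add: state_scale[OF \<omega> T])
  then show "(if (\<lambda>f x. c * T f x) \<in> \<B> then cmean M (\<lambda>i. \<omega> i (\<lambda>f x. c * T f x)) else 0) =
    c * (if T \<in> \<B> then cmean M (\<lambda>i. \<omega> i T) else 0)"
    using T cmean_scale[OF M E] by simp
next
  fix T assume T: "T \<in> \<B>"
  obtain E where E: "op_le (adj T \<circ> T) E" using T by (metis bop_op_le bop_comp adj_bop)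
  have "cmean M (\<lambda>i. \<omega> i (adj T \<circ> T)) \<in> \<real>\<^sub>\<ge>\<^sub>0"
    using state_nonneg[OF \<omega> T] state_le[OF \<omega> _ E] T by (intro cmean_nonneg[OF M, where C=E]) auto
  then show "(if adj T \<circ> T \<in> \<B> then cmean M (\<lambda>i. \<omega> i (adj T \<circ> T)) else 0) \<in> \<real>\<^sub>\<ge>\<^sub>0"
    using T by simp
next
  fix T C assume T: "T \<in> \<B>" and C: "op_le T C"
  have "cmod (cmean M (\<lambda>i. \<omega> i T)) \<le> C"
    using C by (intro cmean_norm_le[OF M state_le[OF \<omega> T C]]) (auto simp: op_le_def)
  then show "cmod (if T \<in> \<B> then cmean M (\<lambda>i. \<omega> i T) else 0) \<le> C" using T by simp
next
  fix x assume x: "x \<in> \<R>"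
  have "cmean M (\<lambda>i. \<omega> i x) = cmean M (\<lambda>i. \<tau> x)"
    by (rule cmean_cong[OF M, where C="cmod (\<tau> x)"]) (simp_all add: state_tau[OF \<omega> x])
  then show "(if x \<in> \<B> then cmean M (\<lambda>i. \<omega> i x) else 0) = \<tau> x"
    using x by (simp add: cmean_const[OF M])
qed simp

section \<open>States invariant under commuting unitaries\<close>

definition act :: "'a operator \<Rightarrow> ('a operator \<Rightarrow> complex) \<Rightarrow> 'a operator \<Rightarrow> complex" where
  "act u \<omega> = (\<lambda>T. if T \<in> \<B> then \<omega> (Ad (adj u) T) else 0)"

lemma Ad_op_le:
  assumes "unitary_op u" "T \<in> \<B>" "op_le T C" shows "op_le (Ad u T) C"
proof -
  have "op_le (u \<circ> T \<circ> adj u) (1 * C * 1)"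
    using assms unitary_bop[of u] by (intro op_le_comp unitary_op_le unitary_adj) auto
  then show ?thesis by (simp add: Ad_def)
qed

lemma act_state:
  assumes u: "unitary_op u" "u \<in> \<R>" and \<omega>: "\<omega> \<in> states"
  shows "act u \<omega> \<in> states"
proof (rule statesI)
  have uB: "adj u \<in> \<B>" "unitary_op (adj u)" using u unitary_adj by auto
  fix S T c C
  show "act u \<omega> T = 0" if "T \<notin> \<B>" using that by (simp add: act_def)
  show "act u \<omega> (\<lambda>f x. S f x + T f x) = act u \<omega> S + act u \<omega> T" if "S \<in> \<B>" "T \<in> \<B>"
    using that uB Ad_lin[OF uB(1) that, of 1 1] state_add[OF \<omega>] by (simp add: act_def)
  show "act u \<omega> (\<lambda>f x. c * T f x) = c * act u \<omega> T" if "T \<in> \<B>"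
    using that uB Ad_lin[OF uB(1) that that, of c 0] state_scale[OF \<omega>] by (simp add: act_def)
  show "act u \<omega> (adj T \<circ> T) \<in> \<real>\<^sub>\<ge>\<^sub>0" if "T \<in> \<B>"
    using that uB state_nonneg[OF \<omega>, of "Ad (adj u) T"] by (simp add: act_def Ad_comp adj_Ad)
  show "cmod (act u \<omega> T) \<le> C" if "T \<in> \<B>" "op_le T C"
    using that uB state_le[OF \<omega> _ Ad_op_le[OF uB(2) that]] by (simp add: act_def)
  show "act u \<omega> T = \<tau> T" if "T \<in> \<R>"
    using that u uB state_tau[OF \<omega>] tau_Ad[OF uB(2)] by (simp add: act_def Ad_R)
qed

lemma act_act:
  assumes "unitary_op u" "unitary_op v"
  shows "act u (act v \<omega>) = act (u \<circ> v) \<omega>"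
proof
  fix T
  show "act u (act v \<omega>) T = act (u \<circ> v) \<omega> T"
    using assms unitary_bop[of u] unitary_bop[of v]
    by (simp add: act_def adj_comp Ad_def comp_assoc)
qed

text \<open>A bound \<open>e\<close> on the dual norm of the difference.\<close>

definition close :: "('a operator \<Rightarrow> complex) \<Rightarrow> ('a operator \<Rightarrow> complex) \<Rightarrow> real \<Rightarrow> bool" where
  "close \<alpha> \<beta> e \<longleftrightarrow> (\<forall>T\<in>\<B>. \<forall>C\<in>{C. op_le T C}. cmod (\<alpha> T - \<beta> T) \<le> e * C)"

lemma act_close:
  assumes "unitary_op u" "close \<alpha> \<beta> e" shows "close (act u \<alpha>) (act u \<beta>) e"
  unfolding close_def
proof (intro ballI, clarify)
  fix T C assume T: "T \<in> \<B>" "op_le T C"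
  have "op_le (Ad (adj u) T) C" using assms T by (intro Ad_op_le unitary_adj)
  then show "cmod (act u \<alpha> T - act u \<beta> T) \<le> e * C"
    using assms T unitary_bop[of u] by (simp add: act_def close_def)
qed

lemma continuous_act: "continuous_on S (\<lambda>\<omega>. act u \<omega> T)"
  by (cases "T \<in> \<B>") (auto simp: act_def intro: continuous_on_eval)

lemma is_mean_average: "is_mean {..<Suc n} (\<lambda>f. (\<Sum>k<Suc n. f k) / Suc n)"
  unfolding is_mean_def
  by (auto simp: sum.distrib add_divide_distrib simp flip: sum_distrib_left simp del: sum.lessThan_Suc
    intro!: sum_nonneg divide_nonneg_nonneg)

lemma cmean_average: "cmean (\<lambda>f. (\<Sum>k<Suc n. f k) / Suc n) f = (\<Sum>k<Suc n. f k) / of_nat (Suc n)"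
  by (simp only: cmean_def complex_eq_iff complex.sel Re_sum Im_sum Re_divide_of_nat Im_divide_of_nat)

lemma funpow_act_state:
  assumes "unitary_op u" "u \<in> \<R>" "\<omega> \<in> states"
  shows "(act u ^^ k) \<omega> \<in> states"
  by (induction k) (use assms act_state in auto)

text \<open>The argument of Markov and Kakutani, with finite averages along powers of one unitary.\<close>

lemma invariant_state_exists:
  assumes U: "\<And>u. u \<in> U \<Longrightarrow> unitary_op u" "\<And>u. u \<in> U \<Longrightarrow> u \<in> \<R>"
    and comm: "\<And>u v. u \<in> U \<Longrightarrow> v \<in> U \<Longrightarrow> u \<circ> v = v \<circ> u"
  shows "\<exists>\<omega>\<in>states. \<forall>u\<in>U. act u \<omega> = \<omega>"
proof -
  \<comment> \<open>A telescoping sum leaves two terms of size at most \<open>C\<close>, divided by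
    the number \<open>Suc n\<close> of averaged states.\<close>
  define e where "e n = 2 / real (Suc n)" for n
  define D where "D = (\<lambda>(u, n). {\<omega>. close (act u \<omega>) \<omega> (e n)})"
  have fin: "\<exists>\<omega>\<in>states. \<forall>(u, n)\<in>I. close (act u \<omega>) \<omega> (e n)" if "finite I" "I \<subseteq> U \<times> UNIV" for I
    using that
  proof (induction I)
    case empty
    show ?case using vector_state by blast
  next
    case (insert vn I)
    obtain v n where vn: "vn = (v, n)" by force
    have v: "v \<in> U" "unitary_op v" "v \<in> \<R>" using insert U vn by auto
    obtain \<omega> where \<omega>: "\<omega> \<in> states" and cl: "\<And>u n. (u, n) \<in> I \<Longrightarrow> close (act u \<omega>) \<omega> (e n)"
      using insert by fastforce
    define s where "s k = (act v ^^ k) \<omega>" for k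
    have s: "s k \<in> states" for k unfolding s_def by (rule funpow_act_state[OF v(2,3) \<omega>])
    define \<omega>' where "\<omega>' = (\<lambda>T. if T \<in> \<B> then cmean (\<lambda>f. (\<Sum>k<Suc n. f k) / Suc n) (\<lambda>k. s k T) else 0)"
    have \<omega>': "\<omega>' \<in> states" unfolding \<omega>'_def by (rule averaged_state[OF is_mean_average]) (rule s)
    have \<omega>'T: "\<omega>' T = (\<Sum>k<Suc n. s k T) / of_nat (Suc n)" if "T \<in> \<B>" for T
      using that by (simp only: \<omega>'_def cmean_average if_True)
    have act\<omega>': "act u \<omega>' T = (\<Sum>k<Suc n. act u (s k) T) / of_nat (Suc n)" if "u \<in> U" "T \<in> \<B>" for u T
    proof -
      have "Ad (adj u) T \<in> \<B>" using that U by simp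
      then show ?thesis using that(2) by (simp only: act_def if_True \<omega>'T)
    qed
    have "close (act v \<omega>') \<omega>' (e n)"
      unfolding close_def
    proof (intro ballI, clarify)
      fix T C assume T: "T \<in> \<B>" and C: "op_le T C"
      have "act v (s k) = s (Suc k)" for k by (simp add: s_def)
      then have "act v \<omega>' T - \<omega>' T = (\<Sum>k<Suc n. s (Suc k) T - s k T) / of_nat (Suc n)"
        using act\<omega>'[OF v(1) T] \<omega>'T[OF T] by (simp only: sum_subtractf diff_divide_distrib)
      also have "(\<Sum>k<Suc n. s (Suc k) T - s k T) = s (Suc n) T - s 0 T"
        by (rule sum_lessThan_telescope)
      finally have "cmod (act v \<omega>' T - \<omega>' T) = cmod (s (Suc n) T - s 0 T) / real (Suc n)"
        by (simp only: norm_divide norm_of_nat)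
      also have "\<dots> \<le> (C + C) / real (Suc n)"
        using state_le[OF s T C] by (intro divide_right_mono order_trans[OF norm_triangle_ineq4] add_mono) auto
      finally show "cmod (act v \<omega>' T - \<omega>' T) \<le> e n * C" by (simp add: e_def)
    qed
    \<comment> \<open>Commutation makes \<open>act v\<close> preserve near-invariance under
      \<open>u\<close>, so averaging along \<open>v\<close> does not spoil the conditions already
      obtained.\<close>
    moreover have "close (act u \<omega>') \<omega>' (e m)" if um: "(u, m) \<in> I" for u m
      unfolding close_def
    proof (intro ballI, clarify)
      fix T C assume T: "T \<in> \<B>" and C: "op_le T C"
      have u: "u \<in> U" "unitary_op u" using um insert U by auto
      have "close (act u (s k)) (s k) (e m)" for k
      proof (induction k)
        case 0
        show ?case using cl[OF um] by (simp add: s_def)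
      next
        case (Suc k)
        have "act u (s (Suc k)) = act v (act u (s k))"
          using act_act[OF u(2) v(2)] act_act[OF v(2) u(2)] comm[OF u(1) v(1)] by (simp add: s_def)
        then show ?case using act_close[OF v(2) Suc] by (simp add: s_def)
      qed
      then have k: "cmod (act u (s k) T - s k T) \<le> e m * C" for k
        using T C by (simp add: close_def)
      have "act u \<omega>' T - \<omega>' T = (\<Sum>k<Suc n. act u (s k) T - s k T) / of_nat (Suc n)"
        using act\<omega>'[OF u(1) T] \<omega>'T[OF T] by (simp only: sum_subtractf diff_divide_distrib)
      then have "cmod (act u \<omega>' T - \<omega>' T) = cmod (\<Sum>k<Suc n. act u (s k) T - s k T) / real (Suc n)"
        by (simp only: norm_divide norm_of_nat)
      also have "\<dots> \<le> (\<Sum>k<Suc n. e m * C) / real (Suc n)"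
        by (intro divide_right_mono order_trans[OF norm_sum] sum_mono k) simp
      also have "\<dots> = e m * C" by simp
      finally show "cmod (act u \<omega>' T - \<omega>' T) \<le> e m * C" .
    qed
    ultimately show ?case using \<omega>' vn by (intro bexI[where x=\<omega>']) auto
  qed
  have "states \<inter> (\<Inter>i\<in>U \<times> UNIV. D i) \<noteq> {}"
  proof (rule compact_imp_fip_image[OF compact_states])
    show "closed (D i)" for i
      unfolding D_def close_def
      by (cases i, simp only: prod.case, intro closed_Collect_ball closed_Collect_le continuous_intros
        continuous_act continuous_on_eval)
    show "states \<inter> (\<Inter>i\<in>I. D i) \<noteq> {}" if "finite I" "I \<subseteq> U \<times> UNIV" for I
      using fin[OF that] by (auto simp: D_def)
  qed
  then obtain \<omega> where \<omega>: "\<omega> \<in> states" and cl: "\<And>u n. u \<in> U \<Longrightarrow> close (act u \<omega>) \<omega> (e n)"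
    unfolding D_def by blast
  have "act u \<omega> = \<omega>" if u: "u \<in> U" for u
  proof
    fix T
    show "act u \<omega> T = \<omega> T"
    proof (cases "T \<in> \<B>")
      case True
      obtain C where C: "op_le T C" using True by (metis bop_op_le)
      have "(\<lambda>n. 2 * C * inverse (real (Suc n))) \<longlonglongrightarrow> 2 * C * 0"
        by (intro tendsto_intros LIMSEQ_inverse_real_of_nat)
      moreover have "cmod (act u \<omega> T - \<omega> T) \<le> 2 * C * inverse (real (Suc n))" for n
        using cl[OF u, of n] True C by (simp add: close_def e_def field_simps)
      ultimately have "cmod (act u \<omega> T - \<omega> T) \<le> 2 * C * 0" by (intro LIMSEQ_le_const) auto
      then show ?thesis by simp
    next
      case False
      then show ?thesis using state_outside[OF \<omega>] by (simp add: act_def)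
    qed
  qed
  then show ?thesis using \<omega> by blast
qed

lemma state_sesquilinear:
  assumes \<omega>: "\<omega> \<in> states" and S: "S \<in> \<B>" and T: "T \<in> \<B>"
  shows "\<omega> (adj S \<circ> S) + c * \<omega> (adj S \<circ> T) + cnj c * (\<omega> (adj T \<circ> S) + c * \<omega> (adj T \<circ> T)) \<in> \<real>\<^sub>\<ge>\<^sub>0"
proof -
  let ?X = "\<lambda>f x. 1 * S f x + c * T f x"
  have X: "?X \<in> \<B>" by (intro bop_plus bop_smult S T)
  let ?Y = "\<lambda>f x. ((adj S \<circ> S) f x + c * (adj S \<circ> T) f x) + cnj c * ((adj T \<circ> S) f x + c * (adj T \<circ> T) f x)"
  have "adj ?X \<circ> ?X = ?Y"
  proof (rule ext)
    fix f
    have a: "adj R (?X f) = (\<lambda>x. adj R (S f) x + c * adj R (T f) x)" if "R \<in> \<B>" for R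
      using bop_add_scale[OF adj_bop[OF that] bop_ell2[OF S] bop_ell2[OF T]] by simp
    show "(adj ?X \<circ> ?X) f = ?Y f"
      unfolding adj_lin[OF S T] comp_apply a[OF S] a[OF T] by simp
  qed
  moreover have "\<omega> ?Y = \<omega> (adj S \<circ> S) + c * \<omega> (adj S \<circ> T) + cnj c * (\<omega> (adj T \<circ> S) + c * \<omega> (adj T \<circ> T))"
    by (simp only: state_add[OF \<omega>] state_scale[OF \<omega>] bop_plus bop_smult bop_comp adj_bop S T)
  ultimately show ?thesis using state_nonneg[OF \<omega> X] by simp
qed

lemma state_cauchy_schwarz:
  assumes \<omega>: "\<omega> \<in> states" and S: "S \<in> \<B>" and T: "T \<in> \<B>"
  shows "(cmod (\<omega> (adj S \<circ> T)))\<^sup>2 \<le> Re (\<omega> (adj S \<circ> S)) * Re (\<omega> (adj T \<circ> T))"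
proof (rule nonneg_quadratic_imp)
  fix c
  note q = state_sesquilinear[OF assms]
  have SS: "Im (\<omega> (adj S \<circ> S)) = 0" and TT: "Im (\<omega> (adj T \<circ> T)) = 0"
    using state_nonneg[OF \<omega> S] state_nonneg[OF \<omega> T] by (simp_all add: complex_nonneg_Reals_iff)
  \<comment> \<open>The cases \<open>c = 1\<close> and \<open>c = \<i>\<close> extract hermitian
    symmetry from positivity.\<close>
  have herm: "\<omega> (adj T \<circ> S) = cnj (\<omega> (adj S \<circ> T))"
    using q[of 1] q[of \<i>] SS TT by (simp add: complex_nonneg_Reals_iff complex_eq_iff)
  have "0 \<le> Re (\<omega> (adj S \<circ> S) + c * \<omega> (adj S \<circ> T) + cnj c * (\<omega> (adj T \<circ> S) + c * \<omega> (adj T \<circ> T)))"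
    using q[of c] by (simp only: complex_nonneg_Reals_iff)
  also have "\<dots> = Re (\<omega> (adj S \<circ> S)) + 2 * Re (c * \<omega> (adj S \<circ> T)) + (cmod c)\<^sup>2 * Re (\<omega> (adj T \<circ> T))"
  proof -
    have "cnj c * (c * z) = of_real ((cmod c)\<^sup>2) * z" for z
      using complex_norm_square[of c] by (simp add: ac_simps)
    then have "cnj c * (cnj z + c * y) = cnj (c * z) + of_real ((cmod c)\<^sup>2) * y" for z y
      by (simp add: distrib_left)
    then show ?thesis unfolding herm by simp
  qed
  finally show "0 \<le> Re (\<omega> (adj S \<circ> S)) + 2 * Re (c * \<omega> (adj S \<circ> T)) + (cmod c)\<^sup>2 * Re (\<omega> (adj T \<circ> T))" .
qed

end

section \<open>Abelian invariant subalgebras\<close>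

context group
begin

section \<open>Multiplication operators and the mean carried by a state\<close>

definition Mop :: "('a \<Rightarrow> real) \<Rightarrow> 'a operator" where
  "Mop f = (\<lambda>\<psi>. if \<psi> \<in> \<H> then (\<lambda>x. if x \<in> carrier G then of_real (f x) * \<psi> x else 0) else (\<lambda>_. 0))"

lemma Mop_apply: "\<psi> \<in> \<H> \<Longrightarrow> x \<in> carrier G \<Longrightarrow> Mop f \<psi> x = of_real (f x) * \<psi> x"
  by (simp add: Mop_def)

lemma Mop_outside: "x \<notin> carrier G \<Longrightarrow> Mop f \<psi> x = 0"
  by (simp add: Mop_def)

lemma
  assumes "\<And>x. x \<in> carrier G \<Longrightarrow> \<bar>f x\<bar> \<le> C" "0 \<le> C"
  shows Mop_op_le: "op_le (Mop f) C" and Mop_bop_le: "Mop f \<in> \<B>"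
proof -
  have b: "Mop f \<psi> \<in> \<H> \<and> nrm (Mop f \<psi>) \<le> C * nrm \<psi>" if \<psi>: "\<psi> \<in> \<H>" for \<psi>
  proof -
    have "(\<Sum>x\<in>E. (cmod (Mop f \<psi> x))\<^sup>2) \<le> (C * nrm \<psi>)\<^sup>2" if E: "finite E" "E \<subseteq> carrier G" for E
    proof -
      have "(\<Sum>x\<in>E. (cmod (Mop f \<psi> x))\<^sup>2) \<le> (\<Sum>x\<in>E. C\<^sup>2 * (cmod (\<psi> x))\<^sup>2)"
      proof (rule sum_mono)
        fix x assume "x \<in> E"
        then have x: "x \<in> carrier G" using E by blast
        have "\<bar>f x\<bar>\<^sup>2 \<le> C\<^sup>2" using assms(1)[OF x] by (intro power_mono) auto
        then show "(cmod (Mop f \<psi> x))\<^sup>2 \<le> C\<^sup>2 * (cmod (\<psi> x))\<^sup>2"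
          using \<psi> x by (simp add: Mop_apply norm_mult power_mult_distrib mult_right_mono)
      qed
      also have "\<dots> \<le> C\<^sup>2 * (nrm \<psi>)\<^sup>2"
        using sum_le_nrm2[OF \<psi> E] by (simp add: mult_left_mono flip: sum_distrib_left)
      finally show ?thesis by (simp add: power_mult_distrib)
    qed
    then show ?thesis using ell2I[of "Mop f \<psi>" "C * nrm \<psi>"] assms(2) by (simp add: Mop_outside)
  qed
  then show le: "op_le (Mop f) C" using assms(2) by (simp add: op_le_def)
  show "Mop f \<in> \<B>"
    by (rule bopI[OF _ _ _ _ le]) (use b in \<open>auto simp: Mop_def fun_eq_iff algebra_simps\<close>)
qed

lemma Mop_bop [simp]:
  assumes "f \<in> \<F>" shows "Mop f \<in> \<B>"
proof -
  obtain C where C: "\<forall>x\<in>carrier G. \<bar>f x\<bar> \<le> C" using assms by (auto simp: bdd_on_def)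
  then have "0 \<le> C" using one_closed by (meson abs_ge_zero order_trans)
  then show ?thesis using C by (intro Mop_bop_le) auto
qed

lemma Mop_cong: "(\<And>x. x \<in> carrier G \<Longrightarrow> f x = g x) \<Longrightarrow> Mop f = Mop g"
  by (auto simp: Mop_def fun_eq_iff)

lemma Mop_add: "Mop (\<lambda>x. f x + g x) = (\<lambda>\<psi> x. Mop f \<psi> x + Mop g \<psi> x)"
  by (auto simp: Mop_def fun_eq_iff algebra_simps)

lemma Mop_scale: "Mop (\<lambda>x. c * f x) = (\<lambda>\<psi> x. of_real c * Mop f \<psi> x)"
  by (auto simp: Mop_def fun_eq_iff)

lemma Mop_const: "Mop (\<lambda>_. c) = scalar_op G (of_real c)"
  by (auto simp: Mop_def scalar_op_def fun_eq_iff ell2_outside)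

lemma Mop_comp:
  assumes "f \<in> \<F>" "g \<in> \<F>" shows "Mop f \<circ> Mop g = Mop (\<lambda>x. f x * g x)"
proof (rule bop_eqI)
  fix \<psi> assume \<psi>: "\<psi> \<in> \<H>"
  show "(Mop f \<circ> Mop g) \<psi> = Mop (\<lambda>x. f x * g x) \<psi>"
    by (rule ell2_eqI) (use assms \<psi> in \<open>simp_all add: Mop_apply\<close>)
qed (use assms in simp_all)

lemma Mop_adj:
  assumes "f \<in> \<F>" shows "adj (Mop f) = Mop f"
proof (rule adj_unique)
  fix \<psi> \<xi> assume H: "\<psi> \<in> \<H>" "\<xi> \<in> \<H>"
  show "ip (Mop f \<psi>) \<xi> = ip \<psi> (Mop f \<xi>)"
    unfolding ell2_inner_def by (rule infsum_cong) (simp add: Mop_apply H)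
qed (use assms in simp)

lemma Mop_Ad:
  assumes g: "g \<in> carrier G" and f: "f \<in> \<F>"
  shows "Ad (\<L> (inv g)) (Mop f) = Mop (shift g f)"
proof (rule bop_eqI)
  fix \<psi> assume \<psi>: "\<psi> \<in> \<H>"
  show "Ad (\<L> (inv g)) (Mop f) \<psi> = Mop (shift g f) \<psi>"
  proof (rule ell2_eqI)
    fix x assume x: "x \<in> carrier G"
    have "inv g \<otimes> (g \<otimes> x) = x" using g x by (simp flip: m_assoc)
    then show "Ad (\<L> (inv g)) (Mop f) \<psi> x = Mop (shift g f) \<psi> x"
      using g f \<psi> x by (simp add: Ad_lam_apply lam_apply Mop_apply shift_def)
  qed (use g f in simp_all)
qed (use g f in simp_all)

text \<open>The restriction of a state to the bounded functions, seen as multiplication operators;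
  for a state it is a mean on the group.\<close>

definition rs :: "('a operator \<Rightarrow> complex) \<Rightarrow> ('a \<Rightarrow> real) \<Rightarrow> real" where
  "rs \<omega> f = (if f \<in> \<F> then Re (\<omega> (Mop f)) else 0)"

lemma state_Mop_nonneg:
  assumes \<omega>: "\<omega> \<in> states" and f: "f \<in> \<F>" "\<And>x. x \<in> carrier G \<Longrightarrow> 0 \<le> f x"
  shows "\<omega> (Mop f) \<in> \<real>\<^sub>\<ge>\<^sub>0"
proof -
  define r where "r x = sqrt \<bar>f x\<bar>" for x
  obtain C where C: "\<forall>x\<in>carrier G. \<bar>f x\<bar> \<le> C" using f(1) by (auto simp: bdd_on_def)
  have r: "r \<in> \<F>" by (rule bdd_onI[where C="sqrt C"]) (use C in \<open>simp add: r_def\<close>)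
  have "Mop f = adj (Mop r) \<circ> Mop r"
    unfolding Mop_adj[OF r] Mop_comp[OF r r] by (rule Mop_cong) (simp add: r_def f)
  then show ?thesis using state_nonneg[OF \<omega> Mop_bop[OF r]] by simp
qed

text \<open>Adding a constant makes the function nonnegative, and the state has real values on real
  constants.\<close>

lemma state_Mop_real:
  assumes \<omega>: "\<omega> \<in> states" and f: "f \<in> \<F>"
  shows "\<omega> (Mop f) = of_real (rs \<omega> f)"
proof -
  obtain C where C: "\<forall>x\<in>carrier G. \<bar>f x\<bar> \<le> C" using f by (auto simp: bdd_on_def)
  have "\<omega> (Mop (\<lambda>x. f x + C)) \<in> \<real>\<^sub>\<ge>\<^sub>0"
    by (rule state_Mop_nonneg[OF \<omega>]) (use f C in fastforce)+
  moreover have "\<omega> (Mop (\<lambda>x. f x + C)) = \<omega> (Mop f) + \<omega> (Mop (\<lambda>_. C))"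
    unfolding Mop_add by (rule state_add[OF \<omega>]) (use f in simp_all)
  moreover have "\<omega> (Mop (\<lambda>_. C)) = of_real C"
    unfolding Mop_const using state_tau[OF \<omega> vna_scalar[OF R_vna]]
    by (simp add: \<tau>_def scalar_op_apply) (simp add: delta_def)
  ultimately have "Im (\<omega> (Mop f)) = 0" by (simp add: complex_nonneg_Reals_iff)
  then show ?thesis using f by (simp add: rs_def complex_eq_iff)
qed

lemma rs_means:
  assumes \<omega>: "\<omega> \<in> states" shows "rs \<omega> \<in> means"
proof -
  have "is_mean (carrier G) (\<lambda>f. Re (\<omega> (Mop f)))"
    unfolding is_mean_def
  proof (intro conjI ballI allI impI)
    fix f g assume "f \<in> \<F>" "g \<in> \<F>"
    then show "Re (\<omega> (Mop (\<lambda>i. f i + g i))) = Re (\<omega> (Mop f)) + Re (\<omega> (Mop g))"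
      by (simp add: Mop_add state_add[OF \<omega>])
  next
    fix f c assume "f \<in> \<F>"
    then show "Re (\<omega> (Mop (\<lambda>i. c * f i))) = c * Re (\<omega> (Mop f))"
      by (simp add: Mop_scale state_scale[OF \<omega>])
  next
    fix f assume "f \<in> \<F>" "\<forall>i\<in>carrier G. 0 \<le> f i"
    then show "0 \<le> Re (\<omega> (Mop f))" using state_Mop_nonneg[OF \<omega>] by (simp add: complex_nonneg_Reals_iff)
  next
    show "Re (\<omega> (Mop (\<lambda>_. 1))) = 1"
      using state_tau[OF \<omega> vna_scalar[OF R_vna, of 1]] tau_idop by (simp add: Mop_const)
  qed
  then show ?thesis using is_mean_restrict by (simp add: rs_def[abs_def])
qed

lemma continuous_rs: "continuous_on S (\<lambda>\<omega>. rs \<omega> f)"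
  unfolding rs_def by (cases "f \<in> \<F>") (auto intro!: continuous_intros continuous_on_eval)

text \<open>Zero variance says that \<open>f\<close> minus its value is null for
  \<open>\<omega>\<close>; by Cauchy-Schwarz it remains null after multiplication by
  \<open>x\<close> on the right. This is the multiplicative domain argument.\<close>

lemma state_variance_zero:
  assumes \<omega>: "\<omega> \<in> states" and f: "f \<in> \<F>" and x: "x \<in> \<R>"
    and var: "rs \<omega> (\<lambda>y. f y * f y) = rs \<omega> f * rs \<omega> f"
  shows "\<omega> (Mop f \<circ> x) = of_real (rs \<omega> f) * \<tau> x"
proof -
  define c where "c = rs \<omega> f"
  note N = means_mean[OF rs_means[OF \<omega>]]
  define f' where "f' y = f y - c" for y
  have f': "f' \<in> \<F>" using f by (simp add: f'_def[abs_def])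
  have "rs \<omega> (\<lambda>y. f' y * f' y) = rs \<omega> (\<lambda>y. f y * f y + ((- 2 * c) * f y + c * c))"
    by (rule arg_cong[where f="rs \<omega>"]) (auto simp: f'_def algebra_simps)
  also have "\<dots> = rs \<omega> (\<lambda>y. f y * f y) + (- 2 * c * rs \<omega> f + c * c)"
    using mean_add[OF N bdd_on_mult[OF f f] bdd_on_add[OF bdd_on_scale[OF f] bdd_on_const], of "- 2 * c" "c * c"]
      mean_add[OF N bdd_on_scale[OF f] bdd_on_const, of "- 2 * c" "c * c"]
      mean_scale[OF N f, of "- 2 * c"] mean_const[OF N, of "c * c"] by linarith
  also have "\<dots> = 0" using var by (simp add: c_def)
  finally have z: "\<omega> (Mop f' \<circ> Mop f') = 0"
    using state_Mop_real[OF \<omega>, of "\<lambda>y. f' y * f' y"] f' by (simp add: Mop_comp)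
  have "(cmod (\<omega> (adj (Mop f') \<circ> x)))\<^sup>2 \<le> Re (\<omega> (adj (Mop f') \<circ> Mop f')) * Re (\<omega> (adj x \<circ> x))"
    by (rule state_cauchy_schwarz[OF \<omega>]) (use f' x in simp_all)
  then have "(cmod (\<omega> (Mop f' \<circ> x)))\<^sup>2 \<le> 0" unfolding Mop_adj[OF f'] z by simp
  then have z': "\<omega> (Mop f' \<circ> x) = 0" by simp
  have "Mop f \<circ> x = (\<lambda>\<psi> y. (Mop f' \<circ> x) \<psi> y + of_real c * x \<psi> y)"
  proof (rule bop_eqI)
    show "(\<lambda>\<psi> y. (Mop f' \<circ> x) \<psi> y + of_real c * x \<psi> y) \<in> \<B>"
      by (intro bop_plus bop_smult bop_comp) (use f' x in simp_all)
    fix \<psi> assume "\<psi> \<in> \<H>"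
    show "(Mop f \<circ> x) \<psi> = (\<lambda>y. (Mop f' \<circ> x) \<psi> y + of_real c * x \<psi> y)"
    proof
      fix y
      show "(Mop f \<circ> x) \<psi> y = (Mop f' \<circ> x) \<psi> y + of_real c * x \<psi> y"
        using x by (cases "y \<in> carrier G")
          (simp_all add: Mop_apply Mop_outside f'_def ell2_outside[OF bop_ell2[OF R_bop]] algebra_simps)
    qed
  qed (use f x in simp)
  moreover have "\<omega> (\<lambda>\<psi> y. (Mop f' \<circ> x) \<psi> y + of_real c * x \<psi> y) = \<omega> (Mop f' \<circ> x) + of_real c * \<omega> x"
    using f' x by (simp only: state_add[OF \<omega>] state_scale[OF \<omega>] bop_comp bop_smult Mop_bop R_bop)
  ultimately show ?thesis using z' state_tau[OF \<omega> x] by (simp add: c_def)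
qed

end

text \<open>The square of a convex combination falls short of the combination of squares by
  \<open>t * (1 - t) * (y a - z a)\<^sup>2\<close>. At a maximum this loss must vanish, so the
  endpoints agree.\<close>

lemma convex_maximum_rigid:
  fixes x y z :: "'i \<Rightarrow> real"
  assumes "finite F" "0 < t" "t < 1"
    and x: "\<And>a. a \<in> F \<Longrightarrow> x a = t * y a + (1 - t) * z a" and p: "p = t * q + (1 - t) * r"
    and y: "q + (\<Sum>a\<in>F. (y a)\<^sup>2) \<le> p + (\<Sum>a\<in>F. (x a)\<^sup>2)"
    and z: "r + (\<Sum>a\<in>F. (z a)\<^sup>2) \<le> p + (\<Sum>a\<in>F. (x a)\<^sup>2)"
    and a: "a \<in> F"
  shows "y a = x a"
proof -
  have "(\<Sum>a\<in>F. (x a)\<^sup>2) = (\<Sum>a\<in>F. t * (y a)\<^sup>2 + (1 - t) * (z a)\<^sup>2 - t * (1 - t) * (y a - z a)\<^sup>2)"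
    by (rule sum.cong) (simp_all add: x power2_eq_square algebra_simps)
  also have "\<dots> = t * (\<Sum>a\<in>F. (y a)\<^sup>2) + (1 - t) * (\<Sum>a\<in>F. (z a)\<^sup>2) - t * (1 - t) * (\<Sum>a\<in>F. (y a - z a)\<^sup>2)"
    by (simp add: sum.distrib sum_subtractf sum_distrib_left)
  finally have s: "p + (\<Sum>a\<in>F. (x a)\<^sup>2) = t * (q + (\<Sum>a\<in>F. (y a)\<^sup>2)) + (1 - t) * (r + (\<Sum>a\<in>F. (z a)\<^sup>2))
      - t * (1 - t) * (\<Sum>a\<in>F. (y a - z a)\<^sup>2)"
    by (simp add: p algebra_simps)
  have "t * (q + (\<Sum>a\<in>F. (y a)\<^sup>2)) \<le> t * (p + (\<Sum>a\<in>F. (x a)\<^sup>2))"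
    "(1 - t) * (r + (\<Sum>a\<in>F. (z a)\<^sup>2)) \<le> (1 - t) * (p + (\<Sum>a\<in>F. (x a)\<^sup>2))"
    using y z assms by (auto intro: mult_left_mono)
  then have "t * (1 - t) * (\<Sum>a\<in>F. (y a - z a)\<^sup>2) \<le> 0"
    using s by (simp add: algebra_simps)
  then have "(\<Sum>a\<in>F. (y a - z a)\<^sup>2) \<le> 0" using assms by (simp add: mult_le_0_iff)
  moreover have "0 \<le> (\<Sum>a\<in>F. (y a - z a)\<^sup>2)" by (rule sum_nonneg) simp
  ultimately have "(\<Sum>a\<in>F. (y a - z a)\<^sup>2) = 0" by simp
  then have "y a = z a" using a \<open>finite F\<close> by (simp add: sum_nonneg_eq_0_iff)
  then show ?thesis using x[OF a] by (simp add: algebra_simps)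
qed

locale invariant_abelian = group +
  fixes A
  assumes A_vna: "vna A" and A_R: "A \<subseteq> \<R>"
    and A_Ad: "\<And>g x. g \<in> carrier G \<Longrightarrow> x \<in> A \<Longrightarrow> Ad (\<L> g) x \<in> A"
    and A_comm: "\<And>x y. x \<in> A \<Longrightarrow> y \<in> A \<Longrightarrow> x \<circ> y = y \<circ> x"
begin

text \<open>Hypertraces relative to \<open>A\<close>: invariance under \<open>act u\<close> amounts
  to \<open>\<omega> (u \<circ> T) = \<omega> (T \<circ> u)\<close>.\<close>

definition central_states :: "('a operator \<Rightarrow> complex) set" where
  "central_states = {\<omega> \<in> states. \<forall>u\<in>{u \<in> A. unitary_op u}. act u \<omega> = \<omega>}"

lemma central_state: "\<omega> \<in> central_states \<Longrightarrow> \<omega> \<in> states"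
  by (simp add: central_states_def)

lemma central_act: "\<omega> \<in> central_states \<Longrightarrow> u \<in> A \<Longrightarrow> unitary_op u \<Longrightarrow> act u \<omega> = \<omega>"
  by (simp add: central_states_def)

lemma central_nonempty: "central_states \<noteq> {}"
  using invariant_state_exists[of "{u \<in> A. unitary_op u}"] A_R A_comm
  unfolding central_states_def by blast

lemma compact_central: "compact central_states"
proof -
  have "central_states = states \<inter> {\<omega>. \<forall>u\<in>{u \<in> A. unitary_op u}. \<forall>T. act u \<omega> T = \<omega> T}"
    unfolding central_states_def fun_eq_iff by blast
  moreover have "closed {\<omega>. \<forall>u\<in>{u \<in> A. unitary_op u}. \<forall>T. act u \<omega> T = \<omega> T}"
    by (intro closed_Collect_ball closed_Collect_all closed_Collect_eq continuous_act continuous_on_eval)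
  ultimately show ?thesis using compact_states by (simp add: compact_Int_closed)
qed

text \<open>\<open>A\<close> is invariant, so conjugation by \<open>g\<close> permutes its
  unitaries.\<close>

lemma central_translate:
  assumes \<omega>: "\<omega> \<in> central_states" and g: "g \<in> carrier G"
  shows "act (\<L> g) \<omega> \<in> central_states"
proof -
  have "act u (act (\<L> g) \<omega>) = act (\<L> g) \<omega>" if u: "u \<in> A" "unitary_op u" for u
  proof -
    define v where "v = Ad (\<L> (inv g)) u"
    have v: "v \<in> A" "unitary_op v" using u g A_Ad by (auto simp: v_def Ad_unitary)
    have uB: "u \<in> \<B>" using u(2) by (rule unitary_bop)
    have "u \<circ> \<L> g = \<L> g \<circ> v"
      by (rule bop_eqI) (use uB g in \<open>auto simp: v_def Ad_lam_apply\<close>)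
    then have "act u (act (\<L> g) \<omega>) = act (\<L> g) (act v \<omega>)"
      using u g v by (simp add: act_act)
    then show ?thesis using central_act[OF \<omega> v] by simp
  qed
  then show ?thesis
    using act_state[OF lam_unitary[OF g] lam_R[OF g] central_state[OF \<omega>]] by (simp add: central_states_def)
qed

lemma central_average:
  assumes M: "is_mean I M" and \<omega>: "\<And>i. i \<in> I \<Longrightarrow> \<omega> i \<in> central_states"
  shows "(\<lambda>T. if T \<in> \<B> then cmean M (\<lambda>i. \<omega> i T) else 0) \<in> central_states" (is "?\<omega> \<in> _")
proof -
  have "act u ?\<omega> = ?\<omega>" if u: "u \<in> A" "unitary_op u" for u
  proof
    fix T
    show "act u ?\<omega> T = ?\<omega> T"
    proof (cases "T \<in> \<B>")
      case True
      have AdT: "Ad (adj u) T \<in> \<B>" using True unitary_bop[OF u(2)] by simp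
      obtain C where C: "op_le T C" using True by (metis bop_op_le)
      have "cmean M (\<lambda>i. \<omega> i (Ad (adj u) T)) = cmean M (\<lambda>i. \<omega> i T)"
      proof (rule cmean_cong[OF M])
        show "cmod (\<omega> i T) \<le> C" if "i \<in> I" for i
          using state_le[OF central_state[OF \<omega>[OF that]] True C] .
        show "\<omega> i (Ad (adj u) T) = \<omega> i T" if "i \<in> I" for i
          using fun_cong[OF central_act[OF \<omega>[OF that] u], of T] True by (simp add: act_def)
      qed
      then show ?thesis using True AdT by (simp add: act_def)
    qed (simp add: act_def)
  qed
  moreover have "?\<omega> \<in> states" by (rule averaged_state[OF M central_state[OF \<omega>]])
  ultimately show ?thesis by (simp add: central_states_def)
qed

text \<open>Averaging the translates of \<open>\<omega>\<close> against \<open>\<mu>\<close>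
  realizes the convolution, so the means carried by central states absorb convolution from the
  left.\<close>

lemma convol_rs:
  assumes \<mu>: "\<mu> \<in> means" and \<omega>: "\<omega> \<in> central_states"
  shows "\<exists>\<omega>'\<in>central_states. rs \<omega>' = convol \<mu> (rs \<omega>)"
proof -
  define \<omega>' where "\<omega>' = (\<lambda>T. if T \<in> \<B> then cmean \<mu> (\<lambda>g. act (\<L> g) \<omega> T) else 0)"
  have \<omega>': "\<omega>' \<in> central_states"
    unfolding \<omega>'_def by (rule central_average[OF means_mean[OF \<mu>] central_translate[OF \<omega>]])
  have "rs \<omega>' f = convol \<mu> (rs \<omega>) f" for f
  proof (cases "f \<in> \<F>")
    case True
    have "rs \<omega>' f = \<mu> (\<lambda>g. Re (act (\<L> g) \<omega> (Mop f)))"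
      using True by (simp add: rs_def \<omega>'_def cmean_def)
    also have "\<dots> = \<mu> (poisson (rs \<omega>) f)"
    proof (rule mean_cong[OF means_mean[OF \<mu>]])
      show "poisson (rs \<omega>) f \<in> \<F>" using True rs_means[OF central_state[OF \<omega>]] by simp
      show "Re (act (\<L> g) \<omega> (Mop f)) = poisson (rs \<omega>) f g" if "g \<in> carrier G" for g
        using that True by (simp add: act_def lam_adj Mop_Ad poisson_def rs_def)
    qed
    finally show ?thesis using True by (simp add: convol_apply)
  qed (simp add: rs_def convol_def)
  then show ?thesis using \<omega>' by blast
qed

text \<open>The convolution of a central state with \<open>m\<close> lies in \<open>K\<close>, and
  by minimality a further convolution on the left reaches \<open>k\<close>; by associativity the
  central state absorbs that factor.\<close>

lemma central_lift:
  assumes K: "left_ideal K" and min: "\<And>m k. m \<in> K \<Longrightarrow> k \<in> K \<Longrightarrow> \<exists>\<mu>\<in>means. k = convol \<mu> m"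
    and m: "m \<in> K" and k: "k \<in> K"
  shows "\<exists>\<omega>\<in>central_states. k = convol (rs \<omega>) m"
proof -
  obtain \<omega> where \<omega>: "\<omega> \<in> central_states" using central_nonempty by blast
  have r: "rs \<omega> \<in> means" using rs_means[OF central_state[OF \<omega>]] .
  have mm: "m \<in> means" using K m by (auto simp: left_ideal_def)
  have "convol (rs \<omega>) m \<in> K" using K r m by (simp add: left_ideal_def)
  then obtain \<mu> where \<mu>: "\<mu> \<in> means" "k = convol \<mu> (convol (rs \<omega>) m)" using min k by blast
  obtain \<omega>' where "\<omega>' \<in> central_states" "rs \<omega>' = convol \<mu> (rs \<omega>)" using convol_rs[OF \<mu>(1) \<omega>] by blast
  then show ?thesis using \<mu> convol_assoc[OF \<mu>(1) r mm] by metis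
qed

text \<open>
  At a maximum of a functional that is strictly convex in the directions \<open>F\<close>, reweighting the state
  by a function cannot change the values on these directions, which forces zero variance.
\<close>

lemma zero_variance_maximum:
  fixes c :: real
  assumes K: "left_ideal K" and min: "\<And>m k. m \<in> K \<Longrightarrow> k \<in> K \<Longrightarrow> \<exists>\<mu>\<in>means. k = convol \<mu> m"
    and m: "m \<in> K" and F: "finite F" "F \<subseteq> carrier G" and f: "f \<in> \<F>" and f1: "f1 \<in> \<F>"
  defines "J \<equiv> \<lambda>\<omega>. c * rs \<omega> (poisson m f1) + (\<Sum>a\<in>F. (rs \<omega> (shift a (poisson m f)))\<^sup>2)"
  shows "\<exists>\<omega>\<in>central_states. (\<forall>\<omega>'\<in>central_states. J \<omega>' \<le> J \<omega>) \<and>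
    (\<forall>a\<in>F. rs \<omega> (\<lambda>y. shift a (poisson m f) y * shift a (poisson m f) y)
      = rs \<omega> (shift a (poisson m f)) * rs \<omega> (shift a (poisson m f)))"
proof -
  have mm: "m \<in> means" using K m by (auto simp: left_ideal_def)
  have "continuous_on central_states J"
    unfolding J_def by (intro continuous_intros continuous_rs)
  then obtain \<omega> where \<omega>: "\<omega> \<in> central_states" and max: "\<forall>\<omega>'\<in>central_states. J \<omega>' \<le> J \<omega>"
    using continuous_attains_sup[OF compact_central central_nonempty] by blast
  define b where "b a = shift a (poisson m f)" for a
  define p1 where "p1 = poisson m f1"
  have bF: "b a \<in> \<F>" if "a \<in> carrier G" for a using that f mm by (simp add: b_def)
  have p1F: "p1 \<in> \<F>" using f1 mm by (simp add: p1_def)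
  have J: "J \<omega>' = c * rs \<omega>' p1 + (\<Sum>a\<in>F. (rs \<omega>' (b a))\<^sup>2)" for \<omega>' by (simp add: J_def b_def p1_def)
  define M where "M = rs \<omega>"
  have M: "is_mean (carrier G) M" unfolding M_def by (rule means_mean[OF rs_means[OF central_state[OF \<omega>]]])
  \<comment> \<open>Reweighting by \<open>w\<close> gives a mean \<open>\<mu>\<close> that need not
    come from a central state. Its convolution with \<open>m\<close> lies in \<open>K\<close>, so
    \<open>central_lift\<close> supplies a central state with the same values on all Poisson
    transforms by \<open>m\<close>.\<close>
  have weight: "\<exists>\<omega>'\<in>central_states. rs \<omega>' p1 = M (\<lambda>y. w y * p1 y) / M w \<and>
      (\<forall>a\<in>carrier G. rs \<omega>' (b a) = M (\<lambda>y. w y * b a y) / M w)"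
    if w: "w \<in> \<F>" "\<And>y. y \<in> carrier G \<Longrightarrow> 0 \<le> w y" "0 < M w" for w
  proof -
    define \<mu> where "\<mu> = (\<lambda>h. if h \<in> \<F> then M (\<lambda>y. w y * h y) / M w else 0)"
    have \<mu>: "\<mu> \<in> means"
      unfolding \<mu>_def
    proof (rule is_mean_restrict, unfold is_mean_def, intro conjI ballI allI impI)
      fix g h assume gh: "g \<in> \<F>" "h \<in> \<F>"
      have "M (\<lambda>y. w y * (g y + h y)) = M (\<lambda>y. w y * g y) + M (\<lambda>y. w y * h y)"
        using mean_add[OF M bdd_on_mult[OF w(1) gh(1)] bdd_on_mult[OF w(1) gh(2)]] by (simp add: distrib_left)
      then show "M (\<lambda>y. w y * (g y + h y)) / M w = M (\<lambda>y. w y * g y) / M w + M (\<lambda>y. w y * h y) / M w"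
        by (simp add: add_divide_distrib)
    next
      fix g d assume g: "g \<in> \<F>"
      show "M (\<lambda>y. w y * (d * g y)) / M w = d * (M (\<lambda>y. w y * g y) / M w)"
        using mean_scale[OF M bdd_on_mult[OF w(1) g], of d] by (simp add: mult.left_commute)
    next
      fix g assume g: "g \<in> \<F>" "\<forall>i\<in>carrier G. 0 \<le> g i"
      have "0 \<le> M (\<lambda>y. w y * g y)"
        by (rule mean_nonneg[OF M bdd_on_mult[OF w(1) g(1)]]) (use w(2) g(2) in simp)
      then show "0 \<le> M (\<lambda>y. w y * g y) / M w" using w(3) by simp
    next
      show "M (\<lambda>y. w y * 1) / M w = 1" using w(3) by simp
    qed
    have "convol \<mu> m \<in> K" using K \<mu> m by (simp add: left_ideal_def)
    then obtain \<omega>' where \<omega>': "\<omega>' \<in> central_states" and eq: "convol \<mu> m = convol (rs \<omega>') m"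
      using central_lift[OF K min m] by blast
    have r: "rs \<omega>' (poisson m h) = \<mu> (poisson m h)" if "h \<in> \<F>" for h
      using fun_cong[OF eq, of h] that by (simp add: convol_apply)
    have sh: "rs \<omega>' (b a) = M (\<lambda>y. w y * b a y) / M w" if a: "a \<in> carrier G" for a
    proof -
      have pe: "b a y = poisson m (shift a f) y" if "y \<in> carrier G" for y
        using poisson_shift[OF mm f a that] by (simp add: b_def shift_def[of a "poisson m f"])
      have pF: "poisson m (shift a f) \<in> \<F>" using a f mm by simp
      have "rs \<omega>' (b a) = rs \<omega>' (poisson m (shift a f))"
        by (rule mean_cong[OF means_mean[OF rs_means[OF central_state[OF \<omega>']]] pF pe])
      also have "\<dots> = \<mu> (poisson m (shift a f))" using r a f by simp
      also have "\<dots> = \<mu> (b a)" by (rule mean_cong[OF means_mean[OF \<mu>] pF pe, symmetric])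
      finally show ?thesis using bF[OF a] by (simp add: \<mu>_def)
    qed
    have "rs \<omega>' p1 = M (\<lambda>y. w y * p1 y) / M w"
      using r[OF f1] p1F by (simp add: \<mu>_def p1_def)
    then show ?thesis using sh \<omega>' by blast
  qed
  have "M (\<lambda>y. b a y * b a y) = M (b a) * M (b a)" if a: "a \<in> F" for a
  proof -
    have ac: "a \<in> carrier G" using a F by blast
    obtain C0 where C0: "\<forall>y\<in>carrier G. \<bar>b a y\<bar> \<le> C0" using bF[OF ac] by (auto simp: bdd_on_def)
    define C where "C = \<bar>C0\<bar> + 1"
    have C: "C > 0" "\<And>y. y \<in> carrier G \<Longrightarrow> \<bar>b a y\<bar> \<le> C" using C0 by (auto simp: C_def intro: order_trans)
    \<comment> \<open>This scale keeps \<open>w\<close> between 1/4 and 3/4, so that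
      \<open>w\<close> and \<open>1 - w\<close> are both weights of positive mass.\<close>
    define d where "d = 1 / (4 * C)"
    have d: "d > 0" "\<And>y. y \<in> carrier G \<Longrightarrow> \<bar>d * b a y\<bar> \<le> 1 / 4"
      using C by (auto simp: d_def abs_mult field_simps)
    define w where "w y = d * b a y + 1 / 2" for y
    define w' where "w' y = 1 - w y" for y
    have wF: "w \<in> \<F>" "w' \<in> \<F>" using bF[OF ac] by (simp_all add: w_def[abs_def] w'_def[abs_def])
    have wb: "1 / 4 \<le> w y" "w y \<le> 3 / 4" if "y \<in> carrier G" for y using d(2)[OF that] by (auto simp: w_def abs_le_iff)
    have Mw: "1 / 4 \<le> M w" "M w \<le> 3 / 4"
      using mean_mono[OF M bdd_on_const wF(1) wb(1)] mean_le[OF M wF(1) wb(2)] mean_const[OF M, of "1/4"] by auto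
    have Mw': "M w' = 1 - M w"
      using mean_diff[OF M bdd_on_const wF(1), of 1] mean_one[OF M] by (simp add: w'_def[abs_def])
    have split: "M h = M (\<lambda>y. w y * h y) + M (\<lambda>y. w' y * h y)" if "h \<in> \<F>" for h
    proof -
      have "(\<lambda>y. w y * h y + w' y * h y) = h" by (auto simp: w'_def algebra_simps)
      then show ?thesis
        using mean_add[OF M bdd_on_mult[OF wF(1) that] bdd_on_mult[OF wF(2) that]] by simp
    qed
    obtain \<omega>1 where \<omega>1: "\<omega>1 \<in> central_states" "rs \<omega>1 p1 = M (\<lambda>y. w y * p1 y) / M w"
      "\<forall>a\<in>carrier G. rs \<omega>1 (b a) = M (\<lambda>y. w y * b a y) / M w"
      using weight[OF wF(1)] wb Mw by force
    obtain \<omega>2 where \<omega>2: "\<omega>2 \<in> central_states" "rs \<omega>2 p1 = M (\<lambda>y. w' y * p1 y) / M w'"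
      "\<forall>a\<in>carrier G. rs \<omega>2 (b a) = M (\<lambda>y. w' y * b a y) / M w'"
      using weight[OF wF(2)] wb Mw Mw' by (force simp: w'_def)
    \<comment> \<open>On the functions in question \<open>\<omega>\<close> is the convex combination
      of the two lifted states with weights \<open>M w\<close> and \<open>1 - M w\<close>.\<close>
    have "rs \<omega>1 (b a) = rs \<omega> (b a)"
    proof (rule convex_maximum_rigid[OF F(1), where t="M w" and z="\<lambda>a. rs \<omega>2 (b a)" and p="c * rs \<omega> p1"
          and q="c * rs \<omega>1 p1" and r="c * rs \<omega>2 p1"])
      show "0 < M w" "M w < 1" using Mw by auto
      have nz: "M w \<noteq> 0" "1 - M w \<noteq> 0" using Mw by auto
      show "rs \<omega> (b a) = M w * rs \<omega>1 (b a) + (1 - M w) * rs \<omega>2 (b a)" if "a \<in> F" for a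
      proof -
        have "a \<in> carrier G" using that F by blast
        then show ?thesis using \<omega>1(3) \<omega>2(3) split[OF bF, of a] nz by (simp add: Mw' flip: M_def)
      qed
      show "c * rs \<omega> p1 = M w * (c * rs \<omega>1 p1) + (1 - M w) * (c * rs \<omega>2 p1)"
        using \<omega>1(2) \<omega>2(2) split[OF p1F] nz by (simp add: Mw' distrib_left flip: M_def)
      show "c * rs \<omega>1 p1 + (\<Sum>a\<in>F. (rs \<omega>1 (b a))\<^sup>2) \<le> c * rs \<omega> p1 + (\<Sum>a\<in>F. (rs \<omega> (b a))\<^sup>2)"
        "c * rs \<omega>2 p1 + (\<Sum>a\<in>F. (rs \<omega>2 (b a))\<^sup>2) \<le> c * rs \<omega> p1 + (\<Sum>a\<in>F. (rs \<omega> (b a))\<^sup>2)"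
        using max \<omega>1(1) \<omega>2(1) by (simp_all add: J)
    qed (rule a)
    \<comment> \<open>So \<open>w\<close> and \<open>b a\<close> are uncorrelated; as
      \<open>w\<close> is affine in \<open>b a\<close> with slope \<open>d\<close>, the variance of
      \<open>b a\<close> vanishes.\<close>
    then have "M (\<lambda>y. w y * b a y) = M w * M (b a)"
      using \<omega>1(3) ac Mw by (simp add: M_def field_simps)
    moreover have "M (\<lambda>y. w y * b a y) = d * M (\<lambda>y. b a y * b a y) + (1 / 2) * M (b a)"
    proof -
      have "(\<lambda>y. w y * b a y) = (\<lambda>y. d * (b a y * b a y) + (1 / 2) * b a y)"
        by (auto simp: w_def algebra_simps)
      then show ?thesis
        using bF[OF ac] by (simp add: mean_add[OF M] mean_scale[OF M] del: times_divide_eq_left)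
    qed
    moreover have "M w = d * M (b a) + 1 / 2"
      unfolding w_def[abs_def] using bF[OF ac] mean_const[OF M, of "1/2"] by (simp add: mean_add[OF M] mean_scale[OF M])
    ultimately have "d * M (\<lambda>y. b a y * b a y) = d * (M (b a) * M (b a))" by (simp add: algebra_simps)
    then show ?thesis using d(1) by simp
  qed
  then show ?thesis using \<omega> max unfolding M_def b_def by blast
qed

end

section \<open>Fourier coefficients of unitaries in the abelian algebra\<close>

context group
begin

lemma lam_Mop:
  assumes "g \<in> carrier G" "f \<in> \<F>"
  shows "\<L> g \<circ> Mop f = Mop (shift (inv g) f) \<circ> \<L> g"
proof (rule bop_eqI)
  fix \<psi> assume \<psi>: "\<psi> \<in> \<H>"
  have "Mop (shift (inv g) f) (\<L> g \<psi>) = Ad (\<L> g) (Mop f) (\<L> g \<psi>)"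
    using Mop_Ad[of "inv g" f] assms by simp
  then show "(\<L> g \<circ> Mop f) \<psi> = (Mop (shift (inv g) f) \<circ> \<L> g) \<psi>"
    using assms \<psi> by (simp add: Ad_lam_apply)
qed (use assms in simp_all)

lemma scalarI_coefficients:
  assumes "x \<in> \<R>" "\<And>g. g \<in> carrier G \<Longrightarrow> g \<noteq> \<one> \<Longrightarrow> hat x g = 0"
  shows "x = scalar_op G (\<tau> x)"
proof (rule R_eqI[OF assms(1) vna_scalar[OF R_vna]])
  fix g assume g: "g \<in> carrier G"
  show "hat x g = hat (scalar_op G (\<tau> x)) g"
    using assms(2)[OF g] g by (cases "g = \<one>") (simp_all add: scalar_op_apply \<tau>_def, simp_all add: delta_def)
qed

text \<open>On \<R> the state is the trace, so Cauchy-Schwarz measures the left factor in the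
  2-norm. This controls the truncation of coefficients.\<close>

lemma state_left_approx:
  assumes \<omega>: "\<omega> \<in> states" and r: "r \<in> \<R>" and X: "X \<in> \<B>" "op_le X C"
  shows "cmod (\<omega> (r \<circ> X)) \<le> nrm (hat r) * C"
proof (rule power2_le_imp_le)
  have C: "0 \<le> C" using X by (simp add: op_le_def)
  have "(cmod (\<omega> (adj (adj r) \<circ> X)))\<^sup>2 \<le> Re (\<omega> (adj (adj r) \<circ> adj r)) * Re (\<omega> (adj X \<circ> X))"
    by (rule state_cauchy_schwarz[OF \<omega> _ X(1)]) (use r in simp)
  moreover have "Re (\<omega> (adj (adj r) \<circ> adj r)) = (nrm (hat r))\<^sup>2"
  proof -
    have "\<omega> (adj (adj r) \<circ> adj r) = ip (hat (adj r)) (hat (adj r))"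
      using state_tau[OF \<omega>, of "adj (adj r) \<circ> adj r"] r by (simp add: tau_comp)
    then show ?thesis using r by (simp add: ip_self nrm_hat_adj)
  qed
  moreover have "Re (\<omega> (adj X \<circ> X)) \<le> C * C"
    using state_le[OF \<omega> _ op_le_comp[OF X(1) op_le_adj[OF X] X(2)]] X complex_Re_le_cmod order_trans
    by (metis bop_comp adj_bop)
  ultimately have "(cmod (\<omega> (r \<circ> X)))\<^sup>2 \<le> (nrm (hat r))\<^sup>2 * Re (\<omega> (adj X \<circ> X))" using r by simp
  also have "\<dots> \<le> (nrm (hat r))\<^sup>2 * (C * C)"
    using \<open>Re (\<omega> (adj X \<circ> X)) \<le> C * C\<close> by (intro mult_left_mono) auto
  finally show "(cmod (\<omega> (r \<circ> X)))\<^sup>2 \<le> (nrm (hat r) * C)\<^sup>2" by (simp add: power2_eq_square ac_simps)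
  show "0 \<le> nrm (hat r) * C" using C by simp
qed

lemma truncation:
  assumes u: "u \<in> \<R>" and "finite E" "E \<subseteq> carrier G"
  defines "S \<equiv> \<lambda>E f x. \<Sum>g\<in>E. hat u g * \<L> g f x"
  shows "S E \<in> \<R> \<and> hat (S E) = restr E (hat u) \<and>
    (\<omega> \<in> states \<longrightarrow> X \<in> \<B> \<longrightarrow> \<omega> (S E \<circ> X) = (\<Sum>g\<in>E. hat u g * \<omega> (\<L> g \<circ> X)))"
  using assms(2,3)
proof (induction E)
  case empty
  have "S {} = scalar_op G 0" by (auto simp: S_def scalar_op_def)
  then have "S {} \<in> \<R>" by (simp add: vna_scalar[OF R_vna])
  moreover have "\<omega> (S {} \<circ> X) = 0" if "\<omega> \<in> states" "X \<in> \<B>"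
  proof -
    have "S {} \<circ> X = (\<lambda>f x. 0 * X f x)" by (auto simp: S_def)
    then show ?thesis using state_scale[OF that, of 0] by simp
  qed
  ultimately show ?case by (simp add: S_def)
next
  case (insert a E)
  have a: "a \<in> carrier G" and SE: "S E \<in> \<R>" using insert by auto
  have eq: "S (insert a E) = (\<lambda>f x. 1 * S E f x + hat u a * \<L> a f x)"
    unfolding S_def using insert.hyps by (intro ext) (simp add: add.commute)
  have "S (insert a E) \<in> \<R>" unfolding eq by (rule vna_lin[OF R_vna SE lam_R[OF a]])
  moreover have "hat (S (insert a E)) = restr (insert a E) (hat u)"
    using insert a by (simp add: eq lam_delta restr_insert)
  moreover have "\<omega> (S (insert a E) \<circ> X) = (\<Sum>g\<in>insert a E. hat u g * \<omega> (\<L> g \<circ> X))"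
    if "\<omega> \<in> states" "X \<in> \<B>"
  proof -
    have "S (insert a E) \<circ> X = (\<lambda>f x. (S E \<circ> X) f x + hat u a * (\<L> a \<circ> X) f x)" by (auto simp: eq)
    then have "\<omega> (S (insert a E) \<circ> X) = \<omega> (S E \<circ> X) + hat u a * \<omega> (\<L> a \<circ> X)"
      using that a SE by (simp only: state_add[OF that(1)] state_scale[OF that(1)] bop_comp bop_smult R_bop lam_bop)
    also have "\<omega> (S E \<circ> X) = (\<Sum>g\<in>E. hat u g * \<omega> (\<L> g \<circ> X))"
      using insert.IH insert.prems that by blast
    finally show ?thesis unfolding sum.insert[OF insert.hyps(1,2)] by (simp only: add.commute)
  qed
  ultimately show ?case by blast
qed

end

context invariant_abelian
begin

text \<open>With \<open>X = Mop F0 \<circ> \<L> (inv h)\<close>, centrality equates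
  \<open>\<omega> (X \<circ> u)\<close> and \<open>\<omega> (u \<circ> X)\<close>. Up to truncation
  both are the coefficient at \<open>h\<close>, multiplied by the value of \<open>\<omega>\<close>
  on \<open>F0\<close> and on its translate by \<open>inv h\<close>. These values stay apart, so the
  coefficient vanishes.\<close>

lemma unitary_coefficient:
  assumes rad: "is_amenable_radical G {\<one>}"
    and u: "u \<in> A" "unitary_op u" and h: "h \<in> carrier G" "h \<noteq> \<one>"
  shows "hat u h = 0"
proof (rule ccontr)
  assume nz: "hat u h \<noteq> 0"
  have uR: "u \<in> \<R>" using u A_R by blast
  obtain K where K: "left_ideal K" and min: "\<And>m k. m \<in> K \<Longrightarrow> k \<in> K \<Longrightarrow> \<exists>\<mu>\<in>means. k = convol \<mu> m"
    using minimal_left_ideal by metis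
  have "inv h \<noteq> \<one>" using h by (metis inv_inv inv_one)
  then have "inv h \<notin> fixator K" using fixator_trivial[OF rad K] by blast
  then obtain m f where m: "m \<in> K" and f: "f \<in> \<F>" and neq: "m (shift (inv h) f) \<noteq> m f"
    using h by (auto simp: fixator_def)
  have mm: "m \<in> means" using K m by (auto simp: left_ideal_def)
  note M = means_mean[OF mm]
  have ih: "inv h \<in> carrier G" using h by simp
  \<comment> \<open>The sign makes the separation \<open>d\<close> positive, so that maximizing is
    the right direction.\<close>
  define s where "s = sgn (m (shift (inv h) f) - m f)"
  define f0 where "f0 = (\<lambda>x. s * f x)"
  have f0: "f0 \<in> \<F>" using f by (simp add: f0_def)
  define d where "d = m (shift (inv h) f0) - m f0"
  have "m (shift (inv h) f0) = s * m (shift (inv h) f)"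
    using mean_scale[OF M shift_bdd[OF ih f], of s] by (simp add: f0_def shift_def)
  moreover have "m f0 = s * m f" unfolding f0_def by (rule mean_scale[OF M f])
  ultimately have "d = s * (m (shift (inv h) f) - m f)" by (simp add: d_def algebra_simps)
  then have "d = \<bar>m (shift (inv h) f) - m f\<bar>" by (simp add: s_def abs_sgn mult.commute)
  then have d: "d > 0" using neq by simp
  define f1 where "f1 = (\<lambda>x. shift (inv h) f0 x - f0 x)"
  have f1: "f1 \<in> \<F>" using f0 ih by (simp add: f1_def)
  have mf1: "m f1 = d" using mean_diff[OF M shift_bdd[OF ih f0] f0] by (simp add: f1_def d_def)
  \<comment> \<open>\<open>m\<close> is its own convolution with the mean of some central state, so
    the value \<open>d\<close> is attained among central states.\<close>
  obtain \<omega>d where \<omega>d: "\<omega>d \<in> central_states" and "m = convol (rs \<omega>d) m"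
    using central_lift[OF K min m m] by blast
  then have rd: "rs \<omega>d (poisson m f1) = d" using f1 mf1 by (metis convol_apply)
  obtain C0 where C0: "\<forall>x\<in>carrier G. \<bar>f0 x\<bar> \<le> C0" using f0 by (auto simp: bdd_on_def)
  define C where "C = \<bar>C0\<bar> + 1"
  have C: "C > 0" "\<And>x. x \<in> carrier G \<Longrightarrow> \<bar>f0 x\<bar> \<le> C" using C0 by (auto simp: C_def intro: order_trans)
  define F0 where "F0 = poisson m f0"
  have F0: "F0 \<in> \<F>" "\<And>x. x \<in> carrier G \<Longrightarrow> \<bar>F0 x\<bar> \<le> C"
    using f0 mm poisson_le[OF mm C(2)] by (simp_all add: F0_def)
  \<comment> \<open>The truncation error is then at most \<open>cmod (hat u h) * d / 4\<close>, half
    of the lower bound for the discrepancy.\<close>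
  define e where "e = cmod (hat u h) * d / (4 * C)"
  have e: "e > 0" using nz d C by (simp add: e_def)
  obtain Fr where Fr: "finite Fr" "Fr \<subseteq> carrier G"
    "\<And>E. Fr \<subseteq> E \<Longrightarrow> finite E \<Longrightarrow> E \<subseteq> carrier G \<Longrightarrow> nrm (\<lambda>x. hat u x - restr E (hat u) x) < e"
    using restr_approx[OF bop_ell2[OF R_bop[OF uR], of "delta \<one>"] e] by metis
  \<comment> \<open>\<open>h\<close> carries the coefficient in question; \<open>\<one>\<close> puts
    \<open>F0\<close> itself among the functions of zero variance.\<close>
  define E where "E = insert h (insert \<one> Fr)"
  have E: "finite E" "E \<subseteq> carrier G" "h \<in> E" "\<one> \<in> E" "Fr \<subseteq> E" using Fr h by (auto simp: E_def)
  \<comment> \<open>Moving \<open>\<L> g\<close> past \<open>Mop F0\<close> translates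
    \<open>F0\<close> by \<open>inv g\<close>.\<close>
  define I where "I = (\<lambda>g. inv g) ` E"
  have I: "finite I" "I \<subseteq> carrier G" using E by (auto simp: I_def)
  \<comment> \<open>The squares contribute at most \<open>card I * C\<^sup>2 = c * d / 2\<close>, so
    at the maximum the linear term is still at least \<open>c * d / 2\<close>.\<close>
  define c where "c = 2 * (card I * C\<^sup>2) / d"
  have cd: "c * d = 2 * (card I * C\<^sup>2)" using d by (simp add: c_def)
  have "card I > 0" using I E by (auto simp: I_def card_gt_0_iff)
  then have c: "c > 0" using C d by (simp add: c_def)
  obtain \<omega> where \<omega>: "\<omega> \<in> central_states"
    and max: "\<forall>\<omega>'\<in>central_states. c * rs \<omega>' (poisson m f1) + (\<Sum>a\<in>I. (rs \<omega>' (shift a F0))\<^sup>2)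
      \<le> c * rs \<omega> (poisson m f1) + (\<Sum>a\<in>I. (rs \<omega> (shift a F0))\<^sup>2)"
    and var: "\<forall>a\<in>I. rs \<omega> (\<lambda>y. shift a F0 y * shift a F0 y) = rs \<omega> (shift a F0) * rs \<omega> (shift a F0)"
    using zero_variance_maximum[OF K min m I f0 f1, of c] unfolding F0_def by blast
  note \<omega>s = central_state[OF \<omega>]
  note N = means_mean[OF rs_means[OF \<omega>s]]
  have large: "d / 2 \<le> rs \<omega> (poisson m f1)"
  proof -
    have "c * d \<le> c * rs \<omega>d (poisson m f1) + (\<Sum>a\<in>I. (rs \<omega>d (shift a F0))\<^sup>2)"
      by (simp add: rd sum_nonneg)
    also have "\<dots> \<le> c * rs \<omega> (poisson m f1) + (\<Sum>a\<in>I. (rs \<omega> (shift a F0))\<^sup>2)"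
      using max \<omega>d by blast
    also have "(\<Sum>a\<in>I. (rs \<omega> (shift a F0))\<^sup>2) \<le> (\<Sum>a\<in>I. C\<^sup>2)"
    proof (rule sum_mono)
      fix a assume "a \<in> I"
      then have a: "a \<in> carrier G" using I by blast
      have "\<bar>rs \<omega> (shift a F0)\<bar> \<le> C" by (rule mean_abs_le[OF N]) (use a F0(2) in \<open>simp add: shift_def\<close>)
      then have "\<bar>rs \<omega> (shift a F0)\<bar>\<^sup>2 \<le> C\<^sup>2" by (intro power_mono) auto
      then show "(rs \<omega> (shift a F0))\<^sup>2 \<le> C\<^sup>2" by simp
    qed
    finally have "c * d \<le> c * rs \<omega> (poisson m f1) + card I * C\<^sup>2" by simp
    then have "c * (d / 2) \<le> c * rs \<omega> (poisson m f1)" using cd by simp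
    then show ?thesis using c by simp
  qed
  have diff: "rs \<omega> (poisson m f1) = rs \<omega> (shift (inv h) F0) - rs \<omega> F0"
  proof -
    have "rs \<omega> (poisson m f1) = rs \<omega> (\<lambda>y. shift (inv h) F0 y - F0 y)"
    proof (rule mean_cong[OF N])
      show "(\<lambda>y. shift (inv h) F0 y - F0 y) \<in> \<F>" using F0(1) ih by simp
      fix y assume y: "y \<in> carrier G"
      have "shift y f1 = (\<lambda>x. shift y (shift (inv h) f0) x - shift y f0 x)"
        by (simp add: f1_def shift_def)
      then have "poisson m f1 y = poisson m (shift (inv h) f0) y - poisson m f0 y"
        using mean_diff[OF M shift_bdd[OF y shift_bdd[OF ih f0]] shift_bdd[OF y f0]] by (simp add: poisson_def)
      then show "poisson m f1 y = shift (inv h) F0 y - F0 y"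
        using poisson_shift[OF mm f0 ih y] by (simp add: F0_def shift_def[of "inv h" "poisson m f0"])
    qed
    then show ?thesis using mean_diff[OF N shift_bdd[OF ih F0(1)] F0(1)] by simp
  qed
  have dec: "\<omega> (Mop (shift (inv g) F0) \<circ> x) = of_real (rs \<omega> (shift (inv g) F0)) * \<tau> x"
    if "g \<in> E" "x \<in> \<R>" for g x
  proof (rule state_variance_zero[OF \<omega>s _ that(2)])
    have "inv g \<in> I" using that by (simp add: I_def)
    then show "shift (inv g) F0 \<in> \<F>"
      "rs \<omega> (\<lambda>y. shift (inv g) F0 y * shift (inv g) F0 y) = rs \<omega> (shift (inv g) F0) * rs \<omega> (shift (inv g) F0)"
      using var I F0(1) by auto
  qed
  define X where "X = Mop F0 \<circ> \<L> (inv h)"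
  have XB: "X \<in> \<B>" using F0(1) ih by (simp add: X_def)
  have "op_le X (C * 1)"
    unfolding X_def using ih C by (intro op_le_comp lam_bop Mop_op_le F0(2) unitary_op_le lam_unitary) auto
  then have XC: "op_le X C" by simp
  have right: "\<omega> (X \<circ> u) = of_real (rs \<omega> F0) * hat u h"
  proof -
    have F0_one: "Mop (shift (inv \<one>) F0) = Mop F0" by (rule Mop_cong) (simp add: shift_def)
    then have "rs \<omega> (shift (inv \<one>) F0) = rs \<omega> F0" using F0(1) by (simp add: rs_def)
    moreover have "\<tau> (\<L> (inv h) \<circ> u) = hat u h" using h uR by (simp add: \<tau>_def lam_apply)
    ultimately show ?thesis
      using dec[OF E(4) R_comp[OF lam_R[OF ih] uR]] F0_one by (simp add: X_def comp_assoc)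
  qed
  have left: "\<omega> (u \<circ> X) = \<omega> (X \<circ> u)"
  proof -
    have "Ad (adj u) (u \<circ> X) = X \<circ> u"
      by (rule bop_eqI) (use u(2) XB unitary_bop[OF u(2)] in \<open>auto simp: Ad_apply\<close>)
    then show ?thesis
      using fun_cong[OF central_act[OF \<omega> u], of "u \<circ> X"] XB unitary_bop[OF u(2)] by (simp add: act_def)
  qed
  define S where "S = (\<lambda>f x. \<Sum>g\<in>E. hat u g * \<L> g f x)"
  have S: "S \<in> \<R>" "hat S = restr E (hat u)" "\<omega> (S \<circ> X) = (\<Sum>g\<in>E. hat u g * \<omega> (\<L> g \<circ> X))"
    using truncation[OF uR E(1,2), of \<omega> X] \<omega>s XB unfolding S_def by blast+
  \<comment> \<open>The trace of \<open>\<L> (g \<otimes> inv h)\<close> leaves only the term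
    \<open>g = h\<close>.\<close>
  have "\<omega> (\<L> g \<circ> X) = (if g = h then of_real (rs \<omega> (shift (inv h) F0)) else 0)" if "g \<in> E" for g
  proof -
    have g: "g \<in> carrier G" using that E by blast
    have "\<L> g \<circ> X = Mop (shift (inv g) F0) \<circ> \<L> (g \<otimes> inv h)"
      using lam_Mop[OF g F0(1)] lam_comp[OF g ih] by (simp add: X_def flip: comp_assoc) (simp add: comp_assoc)
    then have "\<omega> (\<L> g \<circ> X) = of_real (rs \<omega> (shift (inv g) F0)) * \<tau> (\<L> (g \<otimes> inv h))"
      using dec[OF that, of "\<L> (g \<otimes> inv h)"] g ih by simp
    moreover have "g \<otimes> inv h = \<one> \<longleftrightarrow> g = h" using g h by (metis inv_equality inv_inv r_inv ih)
    ultimately show ?thesis using g ih by (simp add: tau_lam)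
  qed
  then have "\<omega> (S \<circ> X) = (\<Sum>g\<in>E. if g = h then hat u h * of_real (rs \<omega> (shift (inv h) F0)) else 0)"
    unfolding S(3) by (intro sum.cong) auto
  also have "\<dots> = hat u h * of_real (rs \<omega> (shift (inv h) F0))" using E by simp
  finally have SX: "\<omega> (S \<circ> X) = hat u h * of_real (rs \<omega> (shift (inv h) F0))" .
  define r where "r = (\<lambda>f x. 1 * u f x + (- 1) * S f x)"
  have rR: "r \<in> \<R>" unfolding r_def by (rule vna_lin[OF R_vna uR S(1)])
  have "nrm (hat r) < e" using Fr(3)[OF E(5,1,2)] by (simp add: r_def S(2))
  have "u \<circ> X = (\<lambda>f x. (S \<circ> X) f x + (r \<circ> X) f x)" by (auto simp: r_def)
  then have "\<omega> (u \<circ> X) = \<omega> (S \<circ> X) + \<omega> (r \<circ> X)"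
    using S(1) rR XB by (simp only: state_add[OF \<omega>s] bop_comp R_bop)
  then have "\<omega> (r \<circ> X) = - (hat u h * of_real (rs \<omega> (poisson m f1)))"
    unfolding left right SX diff by (simp add: algebra_simps)
  then have "cmod (hat u h) * \<bar>rs \<omega> (poisson m f1)\<bar> = cmod (\<omega> (r \<circ> X))"
    by (simp add: norm_mult)
  also have "\<dots> \<le> nrm (hat r) * C" by (rule state_left_approx[OF \<omega>s rR XB XC])
  also have "\<dots> \<le> e * C" using \<open>nrm (hat r) < e\<close> C by (intro mult_right_mono) auto
  also have "\<dots> = cmod (hat u h) * (d / 4)" using C by (simp add: e_def)
  finally have "\<bar>rs \<omega> (poisson m f1)\<bar> \<le> d / 4" using nz by simp
  then show False using large d by simp
qed

text \<open>Unitaries have no coefficient except at \<open>\<one>\<close>, and scalars are closed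
  under linear combinations and inverses.\<close>

lemma scalar_of_trivial_radical:
  assumes rad: "is_amenable_radical G {\<one>}" and "a \<in> A"
  shows "\<exists>c. a = scalar_op G c"
  using A_vna \<open>a \<in> A\<close>
proof (induction rule: vna_unitary_induct)
  case (unitary u)
  then show ?case using scalarI_coefficients[of u] unitary_coefficient[OF rad] A_R by blast
next
  case (lin S T s t)
  then obtain a b where "S = scalar_op G a" "T = scalar_op G b" by blast
  then have "(\<lambda>f x. s * S f x + t * T f x) = scalar_op G (s * a + t * b)"
    by (auto simp: scalar_op_def fun_eq_iff algebra_simps)
  then show ?case by blast
next
  case (inverse S T)
  then obtain a where a: "S = scalar_op G a" by blast
  have T: "T \<in> \<B>" using inverse A_vna by (simp add: vna_bop)
  have ST: "(\<lambda>x. a * T f x) = f" if "f \<in> \<H>" for f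
    using fun_cong[OF \<open>S \<circ> T = idop\<close>, of f] that T by (simp add: a scalar_op_apply)
  have "a \<noteq> 0"
  proof
    assume "a = 0"
    then have "delta \<one> = (\<lambda>_. 0)" using ST[of "delta \<one>"] by simp
    then show False using nrm_delta[of \<one>] by simp
  qed
  have "T = scalar_op G (1 / a)"
  proof (rule bop_eqI[OF T])
    fix f assume f: "f \<in> \<H>"
    have "T f x = 1 / a * f x" for x
      using fun_cong[OF ST[OF f], of x] \<open>a \<noteq> 0\<close> by (simp add: field_simps)
    then show "T f = scalar_op G (1 / a) f" using f by (auto simp: scalar_op_apply)
  qed simp
  then show ?case by blast
qed

end

context group
begin

text \<open>The center is abelian and inherits invariance, since conjugation by \<open>g\<close>
  preserves both \<open>P\<close> and its commutant.\<close>

lemma center_scalar: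
  assumes P: "invariant_subalgebra G P" and rad: "is_amenable_radical G {\<one>}"
  shows "P \<inter> commutant G P \<subseteq> range (scalar_op G)"
proof -
  note D = invariant_subalgebraD[OF P]
  have PB: "S \<in> \<B>" if "S \<in> P" for S using vna_bop[OF D(1) that] .
  interpret invariant_abelian G "P \<inter> commutant G P"
  proof
    show "vna (P \<inter> commutant G P)" by (rule vna_center[OF D(1)])
    show "P \<inter> commutant G P \<subseteq> \<R>" using D(2) by blast
    fix x assume x: "x \<in> P \<inter> commutant G P"
    show "x \<circ> y = y \<circ> x" if "y \<in> P \<inter> commutant G P" for y
      using x that unfolding commutant_def by blast
    fix g assume g: "g \<in> carrier G"
    have "Ad (\<L> g) x \<in> commutant G P"
    proof (rule commutantI)
      show "Ad (\<L> g) x \<in> \<B>" using x g PB by simp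
      show "P \<subseteq> \<B>" using PB by blast
      fix S f assume S: "S \<in> P" and f: "f \<in> \<H>"
      have S': "Ad (\<L> (inv g)) S \<in> P" using S g by (simp add: D(3))
      have "x \<circ> Ad (\<L> (inv g)) S = Ad (\<L> (inv g)) S \<circ> x"
        using x S' unfolding commutant_def by blast
      then have "Ad (\<L> g) (x \<circ> Ad (\<L> (inv g)) S) = Ad (\<L> g) (Ad (\<L> (inv g)) S \<circ> x)"
        by (rule arg_cong)
      then have "Ad (\<L> g) x \<circ> S = S \<circ> Ad (\<L> g) x"
        using x S g PB by (simp add: Ad_comp Ad_lam_lam Ad_lam_one)
      then show "Ad (\<L> g) x (S f) = S (Ad (\<L> g) x f)" by (metis comp_apply)
    qed
    then show "Ad (\<L> g) x \<in> P \<inter> commutant G P" using x g D(3) by blast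
  qed
  show ?thesis using scalar_of_trivial_radical[OF rad] by blast
qed

lemma invariant_subalgebra_eq_group_vna:
  assumes P: "invariant_subalgebra G P" "P \<inter> commutant G P \<subseteq> range (scalar_op G)"
    and nf: "nonfactorizable_regular_character G"
  shows "\<exists>H. H \<lhd> G \<and> P = group_vna G H"
proof -
  interpret invariant_factor G P by unfold_locales (rule P)+
  show ?thesis by (rule eq_group_vna[OF nf])
qed

end

theorem theorem1:
  fixes G :: "('a, 'b) monoid_scheme" (structure)
  assumes "group G"
    and "countable (carrier G)"
    and "icc_group G"
    and "nonfactorizable_regular_character G"
  shows "(\<forall>P. invariant_subfactor G P \<longrightarrow> (\<exists>H. H \<lhd> G \<and> P = group_vna G H)) \<and>
         (\<not> amenable_group G \<and> is_amenable_radical G {\<one>} \<longrightarrow> ISR_property G)"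
proof (intro conjI allI impI)
  interpret group G by fact
  note classify = invariant_subalgebra_eq_group_vna[OF _ _ assms(4)]
  show "\<exists>H. H \<lhd> G \<and> P = group_vna G H" if P: "invariant_subfactor G P" for P
  proof (rule classify)
    show "invariant_subalgebra G P" "P \<inter> commutant G P \<subseteq> range (scalar_op G)"
      using P by (auto simp: invariant_subfactor_def is_factor_def vna_center_def)
  qed
  show "ISR_property G" if rad: "\<not> amenable_group G \<and> is_amenable_radical G {\<one>}"
    unfolding ISR_property_def using classify center_scalar rad by blast
qed

end
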